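(* Let $p>3$ be a prime. Let $0<\alpha<1$ and $0<b_0=p^{-l_0}<b_1=p^{-l_1}<1$ be three parameters. Let $F\subseteq B_{\mathfrak r}(0,b_1)$ be a (nonempty) finite set such that $$\frac{\#(F\cap B_{\mathfrak r}(w,b))}{\#F}\le D'(b/b_1)^\alpha$$ for all $w\in\mathfrak r$ and all $b\ge b_0$, and some $D'\ge1$. Let $0<\varepsilon<0.01$ and let $J$ be a metric ball in $\mathbb{Z}_p$. Then there exist a set $J'\subseteq J$ with $\mu(J')\ge(1-\frac1p)\mu(J)$ and a constant $C_\varepsilon$, depending (for the fixed prime $p$) only on $\varepsilon$, $\mu(J)$ and $D'$, such that the following holds. For each $r\in J'$ there exists a subset $F_r\subseteq F$ with $$\#F_r\ge\left(1-\frac1p\right)\#F$$ such that for all $w\in F_r$ and all $b\ge b_0$, $$\frac{\#\{w'\in F:|\xi_r(w')-\xi_r(w)|_p\le b\}}{\#F}\le C_\varepsilon(b/b_1)^{\alpha-\varepsilon}.$$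
   Context: $\mathfrak r=\mathfrak{sl}_2(\mathbb{Q}_p)$ is the space of trace-zero $2\times2$ matrices over $\mathbb{Q}_p$, equipped with the maximum-entry norm with respect to $|\cdot|_p$; $B_{\mathfrak r}(w,b)$ is the closed ball in $\mathfrak r$ of center $w$ and radius $b$. For $r\in\mathbb{Z}_p$, $\xi_r:\mathfrak r\to\mathbb{Q}_p$ is the map $\xi_r(w)=w_{12}-2rw_{11}-w_{21}r^2$, where $w_{ij}$ are the matrix entries of $w$. $\mu$ is Haar measure on $\mathbb{Z}_p$ with $\mu(\mathbb{Z}_p)=1$. $l_0,l_1$ are positive integers.
   Formalization: The final estimate is asserted for all b ≥ b_0 when ε ≤ α, but only for b_0 ≤ b ≤ b_1 when α < ε; in the latter case it fails for large b, since the left side is 1 for b > b_1 while (b/b_1)^(α−ε) tends to 0. *)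

theory Defs
  imports "HOL-Probability.Probability" "HOL-Computational_Algebra.Polynomial_Factorial"
begin

text \<open>
  The prime \<open>p\<close> is carried by a type \<open>'p\<close> of cardinality \<open>p\<close>, so that \<open>\<int>\<^sub>p\<close> is a type of its own.
\<close>

class prime_card =
  assumes prime_card: "prime CARD('a)"

text \<open>
  \<open>\<int>\<^sub>p\<close> is the inverse limit of the rings \<open>\<int>/p\<^sup>n\<close>: an element is the sequence of its residues,
  the \<open>n\<close>-th one being represented by an integer in \<open>{0..<p\<^sup>n}\<close>.
\<close>

typedef ('p::prime_card) padic_int =
    "{x :: nat \<Rightarrow> int. \<forall>n. x (Suc n) mod int CARD('p) ^ n = x n}"
  morphisms res Abs_padic_int
  by (rule exI[of _ "\<lambda>_. 0"]) simp

setup_lifting type_definition_padic_int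

lemma mod_pow_Suc [simp]: "(a mod (p::int) ^ Suc n) mod p ^ n = a mod p ^ n"
  by (rule mod_mod_cancel) simp

lemma mod_pow_trivial: "\<forall>n. x (Suc n) mod (p::int) ^ n = x n \<Longrightarrow> x n mod p ^ n = x n"
  by (metis mod_mod_trivial)

instantiation padic_int :: (prime_card) comm_ring_1
begin

lift_definition zero_padic_int :: "'a padic_int" is "\<lambda>n. 0" by simp

lift_definition one_padic_int :: "'a padic_int" is "\<lambda>n. 1 mod int CARD('a) ^ n"
  by (simp del: power_Suc)

lift_definition plus_padic_int :: "'a padic_int \<Rightarrow> 'a padic_int \<Rightarrow> 'a padic_int"
  is "\<lambda>x y n. (x n + y n) mod int CARD('a) ^ n"
  by (simp del: power_Suc) (metis mod_add_eq)

lift_definition minus_padic_int :: "'a padic_int \<Rightarrow> 'a padic_int \<Rightarrow> 'a padic_int"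
  is "\<lambda>x y n. (x n - y n) mod int CARD('a) ^ n"
  by (simp del: power_Suc) (metis mod_diff_eq)

lift_definition uminus_padic_int :: "'a padic_int \<Rightarrow> 'a padic_int"
  is "\<lambda>x n. (- x n) mod int CARD('a) ^ n"
  by (simp del: power_Suc) (metis mod_minus_eq)

lift_definition times_padic_int :: "'a padic_int \<Rightarrow> 'a padic_int \<Rightarrow> 'a padic_int"
  is "\<lambda>x y n. (x n * y n) mod int CARD('a) ^ n"
  by (simp del: power_Suc) (metis mod_mult_eq)

instance
proof
  fix a b c :: "'a padic_int"
  show "a + b + c = a + (b + c)"
    by transfer (simp only: mod_add_left_eq mod_add_right_eq add.assoc)
  show "a + b = b + a" by transfer (simp only: add.commute)
  show "0 + a = a" by transfer (simp add: mod_pow_trivial)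
  show "- a + a = 0" by transfer (simp add: mod_add_left_eq)
  show "a - b = a + - b" by transfer (simp add: mod_add_right_eq)
  show "a * b * c = a * (b * c)"
    by transfer (simp only: mod_mult_left_eq mod_mult_right_eq mult.assoc)
  show "a * b = b * a" by transfer (simp only: mult.commute)
  show "1 * a = a" by transfer (simp add: mod_mult_left_eq mod_pow_trivial)
  show "(a + b) * c = a * c + b * c"
    by transfer (simp only: mod_mult_left_eq mod_add_eq distrib_right)
  show "(0::'a padic_int) \<noteq> 1"
  proof transfer
    have "1 < CARD('a)" using prime_card prime_gt_1_nat by blast
    then have "(1::int) mod int CARD('a) ^ 1 = 1" by simp
    then show "(\<lambda>n. 0) \<noteq> (\<lambda>n. 1 mod int CARD('a) ^ n)"
      by (auto simp: fun_eq_iff intro: exI[of _ 1])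
  qed
qed

end

lemma prime_card_int: "prime (int CARD('p::prime_card))"
  using prime_card by auto

lemma prime_card_gt_1: "1 < int CARD('p::prime_card)"
  using prime_card_int[where 'p='p] prime_gt_1_int by blast

lemma res_Suc: "res x (Suc n) mod int CARD('p) ^ n = res x n" for x :: "'p::prime_card padic_int"
  using res[of x] by auto

lemma res_mod_le: "m \<le> n \<Longrightarrow> res x n mod int CARD('p) ^ m = res x m"
  for x :: "'p::prime_card padic_int"
proof (induction n rule: dec_induct)
  case base
  show ?case by (metis mod_mod_trivial res_Suc)
next
  case (step n)
  have "res x (Suc n) mod int CARD('p) ^ m
      = res x (Suc n) mod int CARD('p) ^ n mod int CARD('p) ^ m"
    using step.hyps by (simp add: mod_mod_cancel le_imp_power_dvd)
  then show ?case using step by (simp add: res_Suc)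
qed

lemma res_simps [simp]:
  "res (0 :: 'p::prime_card padic_int) n = 0"
  "res (x + y) n = (res x n + res y n) mod int CARD('p) ^ n"
  "res (x - y) n = (res x n - res y n) mod int CARD('p) ^ n"
  "res (- x) n = (- res x n) mod int CARD('p) ^ n"
  "res (x * y) n = (res x n * res y n) mod int CARD('p) ^ n"
  for x y :: "'p::prime_card padic_int"
  by (transfer, simp)+

lemma res_eqI: "(\<And>n. res x n = res y n) \<Longrightarrow> x = y"
  by (metis ext res_inject)

lemma res_bounds: "0 \<le> res x n" "res x n < int CARD('p) ^ n" for x :: "'p::prime_card padic_int"
proof -
  have "0 < int CARD('p) ^ n" using prime_card_gt_1[where 'p='p] by simp
  then show "0 \<le> res x n" "res x n < int CARD('p) ^ n"
    by (metis res_Suc pos_mod_sign pos_mod_bound)+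
qed

lemma res_0 [simp]: "res x 0 = 0"
  using res_bounds[of x 0] by simp

text \<open>The value at \<open>0\<close> is unspecified; \<open>padic_int_abs\<close> treats \<open>0\<close> separately.\<close>

definition padic_val :: "'p::prime_card padic_int \<Rightarrow> nat" where
  "padic_val x = (GREATEST n. res x n = 0)"

definition padic_int_abs :: "'p::prime_card padic_int \<Rightarrow> real" where
  "padic_int_abs x = (if x = 0 then 0 else (1 / real CARD('p)) ^ padic_val x)"

lemma res_eq_0_mono: "res x n = 0 \<Longrightarrow> m \<le> n \<Longrightarrow> res x m = 0"
  by (metis mod_0 res_mod_le)

lemma res_eq_0_iff: "res x n = 0 \<longleftrightarrow> n \<le> padic_val x" if "x \<noteq> 0"
proof -
  obtain N where N: "res x N \<noteq> 0" using \<open>x \<noteq> 0\<close> res_eqI[of x 0] by auto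
  have bd: "\<And>n. res x n = 0 \<Longrightarrow> n \<le> N" using N res_eq_0_mono nat_le_linear by blast
  have "res x (padic_val x) = 0"
    unfolding padic_val_def by (rule GreatestI_nat[where P="\<lambda>n. res x n = 0" and k=0, OF _ bd]) auto
  moreover have "n \<le> padic_val x" if "res x n = 0"
    unfolding padic_val_def by (rule Greatest_le_nat[where P="\<lambda>n. res x n = 0", OF that bd])
  ultimately show ?thesis using res_eq_0_mono by blast
qed

lemma padic_int_abs_le_iff:
  "padic_int_abs x \<le> (1 / real CARD('p)) ^ n \<longleftrightarrow> res x n = 0" for x :: "'p::prime_card padic_int"
proof (cases "x = 0")
  case False
  have "1 < real CARD('p)" using prime_card_gt_1[where 'p='p] by simp
  then show ?thesis
    using False by (simp add: padic_int_abs_def res_eq_0_iff power_decreasing_iff)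
qed (auto simp: padic_int_abs_def)

lemma padic_int_abs_0 [simp]: "padic_int_abs 0 = 0"
  by (simp add: padic_int_abs_def)

lemma padic_int_abs_pos: "x \<noteq> 0 \<Longrightarrow> 0 < padic_int_abs x" for x :: "'p::prime_card padic_int"
  using prime_card_gt_1[where 'p='p] by (simp add: padic_int_abs_def)

lemma padic_int_abs_nonneg [simp]: "0 \<le> padic_int_abs x"
  by (cases "x = 0") (auto intro: less_imp_le padic_int_abs_pos)

lemma padic_int_abs_eq_0_iff [simp]: "padic_int_abs x = 0 \<longleftrightarrow> x = 0"
  using padic_int_abs_pos by fastforce

lemma padic_int_abs_diff_le:
  "padic_int_abs (x - y) \<le> max (padic_int_abs x) (padic_int_abs y)" for x y :: "'p::prime_card padic_int"
proof (cases "x = 0 \<and> y = 0")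
  case False
  have le: "padic_int_abs (u - v) \<le> padic_int_abs u \<and> padic_int_abs (v - u) \<le> padic_int_abs u"
    if u: "u \<noteq> 0" and vu: "padic_int_abs v \<le> padic_int_abs u" for u v :: "'p padic_int"
  proof -
    define n where "n = padic_val u"
    have au: "padic_int_abs u = (1 / real CARD('p)) ^ n"
      using u by (simp add: padic_int_abs_def n_def)
    then have "res u n = 0" "res v n = 0"
      using vu padic_int_abs_le_iff[of u n] padic_int_abs_le_iff[of v n] by auto
    then show ?thesis unfolding au padic_int_abs_le_iff by simp
  qed
  show ?thesis
  proof (cases "padic_int_abs y \<le> padic_int_abs x")
    case True
    then have "x \<noteq> 0"
      using False padic_int_abs_pos[of y] by (cases "x = 0") auto
    then show ?thesis using le[of x y] True by auto
  next
    case False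
    have "y \<noteq> 0" using False padic_int_abs_nonneg[of x] by (cases "y = 0") auto
    then show ?thesis using le[of y x] False by auto
  qed
qed auto

lemma padic_int_abs_minus [simp]: "padic_int_abs (- x) = padic_int_abs x"
  using padic_int_abs_diff_le[of 0 x] padic_int_abs_diff_le[of 0 "- x"] by simp

lemma padic_int_abs_add_le: "padic_int_abs (x + y) \<le> max (padic_int_abs x) (padic_int_abs y)"
  using padic_int_abs_diff_le[of x "- y"] by simp

lemma padic_mult_aux:
  fixes x y :: "'p::prime_card padic_int"
  assumes "x \<noteq> 0" "y \<noteq> 0"
  shows "x * y \<noteq> 0" and "padic_val (x * y) = padic_val x + padic_val y"
proof -
  let ?p = "int CARD('p)" and ?v = "padic_val x" and ?w = "padic_val y"
  define N where "N = Suc (?v + ?w)"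
  have p: "1 < ?p" by (rule prime_card_gt_1)
  have split: "\<exists>u. res z N = ?p ^ padic_val z * u \<and> \<not> ?p dvd u"
    if "z \<noteq> 0" "padic_val z < N" for z :: "'p padic_int"
  proof -
    have "res z N mod ?p ^ padic_val z = 0"
      using that by (simp add: res_mod_le res_eq_0_iff)
    then obtain u where u: "res z N = ?p ^ padic_val z * u" by (metis dvdE mod_0_imp_dvd)
    have "\<not> ?p dvd u"
    proof
      assume "?p dvd u"
      then have "?p ^ Suc (padic_val z) dvd res z N" by (simp add: u mult_dvd_mono mult.commute)
      then have "res z (Suc (padic_val z)) = 0"
        using that res_mod_le[of "Suc (padic_val z)" N z] by (simp add: mod_eq_0_iff_dvd)
      then show False using that by (simp add: res_eq_0_iff)
    qed
    then show ?thesis using u by blast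
  qed
  obtain a b where a: "res x N = ?p ^ ?v * a" "\<not> ?p dvd a"
      and b: "res y N = ?p ^ ?w * b" "\<not> ?p dvd b"
    using split[of x] split[of y] assms by (auto simp: N_def)
  have eq: "res x N * res y N = ?p ^ (?v + ?w) * (a * b)"
    by (simp add: a b power_add)
  have ab: "\<not> ?p dvd a * b"
    using a b prime_card_int[where 'p='p] by (simp add: prime_dvd_mult_iff)
  have "\<not> ?p ^ N dvd res x N * res y N"
  proof
    assume "?p ^ N dvd res x N * res y N"
    then have "?p ^ (?v + ?w) * ?p dvd ?p ^ (?v + ?w) * (a * b)"
      unfolding eq by (simp only: N_def power_Suc2)
    then show False using ab p by (simp add: dvd_mult_cancel_left)
  qed
  then have ne: "res (x * y) N \<noteq> 0" by (simp add: mod_eq_0_iff_dvd)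
  then show nz: "x * y \<noteq> 0" by (metis res_simps(1))
  have "res (x * y) (?v + ?w) = 0"
  proof -
    have "res (x * y) N mod ?p ^ (?v + ?w) = (res x N * res y N) mod ?p ^ (?v + ?w)"
      unfolding res_simps N_def by (simp only: mod_pow_Suc)
    then show ?thesis
      using res_mod_le[of "?v + ?w" N "x * y"] by (simp add: N_def eq[unfolded N_def])
  qed
  then show "padic_val (x * y) = ?v + ?w"
    using ne res_eq_0_iff[OF nz] by (metis N_def le_antisym not_less_eq_eq)
qed

lemma padic_int_abs_mult: "padic_int_abs (x * y) = padic_int_abs x * padic_int_abs y"
  by (cases "x = 0 \<or> y = 0") (auto simp: padic_int_abs_def padic_mult_aux power_add)

instance padic_int :: (prime_card) idom
  by standard (rule padic_mult_aux)

instantiation padic_int :: (prime_card) metric_space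
begin

definition "dist x y = padic_int_abs (x - y)" for x y :: "'a padic_int"

definition "(uniformity :: ('a padic_int \<times> 'a padic_int) filter)
  = (INF e\<in>{0<..}. principal {(x, y). dist x y < e})"

definition "open (U :: 'a padic_int set)
  \<longleftrightarrow> (\<forall>x\<in>U. eventually (\<lambda>(x', y). x' = x \<longrightarrow> y \<in> U) uniformity)"

instance
proof
  fix x y z :: "'a padic_int"
  show "dist x y = 0 \<longleftrightarrow> x = y" by (simp add: dist_padic_int_def)
  have "dist x y \<le> max (padic_int_abs (x - z)) (padic_int_abs (y - z))"
    using padic_int_abs_diff_le[of "x - z" "y - z"] by (simp add: dist_padic_int_def)
  also have "\<dots> \<le> dist x z + dist y z" by (simp add: dist_padic_int_def)
  finally show "dist x y \<le> dist x z + dist y z" .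
qed (simp_all add: uniformity_padic_int_def open_padic_int_def)

end

text \<open>\<open>\<rat>\<^sub>p\<close> is the field of fractions of \<open>\<int>\<^sub>p\<close>, which \<open>to_fract\<close> embeds into it.\<close>

type_synonym 'p padic = "'p padic_int fract"

text \<open>By the lemma \<open>padic_abs_Fract\<close> below, the value does not depend on the representation of \<open>q\<close>.\<close>

definition padic_abs :: "'p::prime_card padic \<Rightarrow> real" where
  "padic_abs q = (THE t. \<exists>a b. b \<noteq> 0 \<and> q = Fract a b \<and> t = padic_int_abs a / padic_int_abs b)"

lemma padic_abs_Fract:
  assumes "b \<noteq> 0"
  shows "padic_abs (Fract a b) = padic_int_abs a / padic_int_abs b"
  unfolding padic_abs_def
proof (rule the_equality)
  fix t assume "\<exists>c d. d \<noteq> 0 \<and> Fract a b = Fract c d \<and> t = padic_int_abs c / padic_int_abs d"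
  then obtain c d where d: "d \<noteq> 0" and eq: "a * d = c * b" and t: "t = padic_int_abs c / padic_int_abs d"
    using assms by (auto simp: eq_fract)
  have "padic_int_abs a * padic_int_abs d = padic_int_abs c * padic_int_abs b"
    using eq by (metis padic_int_abs_mult)
  then show "t = padic_int_abs a / padic_int_abs b"
    using assms d by (simp add: t field_simps)
qed (use assms in blast)

lemma padic_abs_to_fract [simp]: "padic_abs (to_fract a) = padic_int_abs a"
  for a :: "'p::prime_card padic_int"
proof -
  have "padic_int_abs (1::'p padic_int) = 1"
    using padic_int_abs_mult[of "1::'p padic_int" 1] by simp
  then show ?thesis by (simp add: to_fract_def padic_abs_Fract)
qed

lemma padic_int_abs_prime: "padic_int_abs (of_nat CARD('p) :: 'p::prime_card padic_int) = 1 / real CARD('p)"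
proof -
  let ?p = "int CARD('p)" and ?x = "of_nat CARD('p) :: 'p padic_int"
  have p: "1 < ?p" by (rule prime_card_gt_1)
  have res: "res (of_nat m :: 'p padic_int) n = int m mod ?p ^ n" for m n
    by (induction m) (simp_all add: one_padic_int.rep_eq mod_simps)
  have 2: "res ?x 2 \<noteq> 0" and 1: "res ?x 1 = 0"
    using p by (simp_all add: res power2_eq_square zmod_eq_0_iff)
  have "?x \<noteq> 0" using 2 by auto
  with 1 2 have "padic_val ?x = 1"
    using res_eq_0_iff[of ?x 1] res_eq_0_iff[of ?x 2] by linarith
  with \<open>?x \<noteq> 0\<close> show ?thesis by (simp add: padic_int_abs_def)
qed

lemma padic_abs_mult: "padic_abs (x * y) = padic_abs x * padic_abs y"
  by (cases x; cases y) (simp add: padic_abs_Fract padic_int_abs_mult)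

lemma padic_abs_add_le: "padic_abs (x + y) \<le> max (padic_abs x) (padic_abs y)"
proof (cases x; cases y)
  fix a b c d :: "'a padic_int"
  assume xy: "x = Fract a b" "b \<noteq> 0" "y = Fract c d" "d \<noteq> 0"
  have pos: "0 < padic_int_abs b * padic_int_abs d"
    using xy by (simp add: padic_int_abs_pos)
  have "padic_int_abs (a * d + c * b) \<le> max (padic_int_abs (a * d)) (padic_int_abs (c * b))"
    by (rule padic_int_abs_add_le)
  then have "padic_abs (x + y)
      \<le> max (padic_int_abs (a * d)) (padic_int_abs (c * b)) / (padic_int_abs b * padic_int_abs d)"
    using xy pos by (simp add: padic_abs_Fract padic_int_abs_mult divide_right_mono)
  also have "\<dots> = max (padic_abs x) (padic_abs y)"
    using xy pos padic_int_abs_pos[of b] padic_int_abs_pos[of d]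
    by (simp add: padic_abs_Fract padic_int_abs_mult max_def field_simps)
  finally show ?thesis .
qed

definition sl2 :: "('p::prime_card padic ^ 2 ^ 2) set" where
  "sl2 = {w. trace w = 0}"

definition max_norm :: "'p::prime_card padic ^ 2 ^ 2 \<Rightarrow> real" where
  "max_norm w = (MAX (i, j)\<in>UNIV. padic_abs (w $ i $ j))"

definition sl2_ball :: "'p::prime_card padic ^ 2 ^ 2 \<Rightarrow> real \<Rightarrow> ('p padic ^ 2 ^ 2) set" where
  "sl2_ball w b = {v \<in> sl2. max_norm (v - w) \<le> b}"

definition xi :: "'p::prime_card padic_int \<Rightarrow> 'p padic ^ 2 ^ 2 \<Rightarrow> 'p padic" where
  "xi r w = w $ 1 $ 2 - 2 * to_fract r * w $ 1 $ 1 - w $ 2 $ 1 * (to_fract r)\<^sup>2"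

definition haar_prob :: "'p::prime_card padic_int measure \<Rightarrow> bool" where
  "haar_prob \<mu> \<longleftrightarrow> prob_space \<mu> \<and> sets \<mu> = sets borel \<and> (\<forall>a. distr \<mu> borel (\<lambda>x. a + x) = \<mu>)"

lemma res_eq_iff_dist: "res y n = res x n \<longleftrightarrow> dist y x \<le> (1 / real CARD('p)) ^ n"
  for x y :: "'p::prime_card padic_int"
proof -
  have "res (y - x) n = 0 \<longleftrightarrow> res y n mod int CARD('p) ^ n = res x n mod int CARD('p) ^ n"
    by (simp add: mod_eq_dvd_iff mod_eq_0_iff_dvd)
  also have "\<dots> \<longleftrightarrow> res y n = res x n" by (simp add: res_mod_le)
  finally show ?thesis by (simp add: dist_padic_int_def padic_int_abs_le_iff)
qed

definition residue_class :: "nat \<Rightarrow> int \<Rightarrow> 'p::prime_card padic_int set" where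
  "residue_class n k = {x. res x n = k}"

lemma open_residue_class: "open (residue_class n k :: 'p::prime_card padic_int set)"
  unfolding open_dist
proof
  fix x :: "'p padic_int" assume x: "x \<in> residue_class n k"
  have "0 < (1 / real CARD('p)) ^ n" using prime_card_gt_1[where 'p='p] by simp
  moreover have "y \<in> residue_class n k" if "dist y x < (1 / real CARD('p)) ^ n" for y
    using x that res_eq_iff_dist[of y n x] by (simp add: residue_class_def)
  ultimately show "\<exists>e>0. \<forall>y. dist y x < e \<longrightarrow> y \<in> residue_class n k" by blast
qed

lemma borel_residue_class:
  "(borel :: 'p::prime_card padic_int measure) = sigma UNIV (range (\<lambda>(n, k). residue_class n k))"
proof (rule borel_eq_countable_basis)
  show "topological_basis (range (\<lambda>(n, k). residue_class n k :: 'p padic_int set))"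
  proof (rule topological_basisI)
    fix S :: "'p padic_int set" and x assume "open S" "x \<in> S"
    then obtain e where e: "e > 0" "\<And>y. dist y x < e \<Longrightarrow> y \<in> S" unfolding open_dist by blast
    have "\<bar>1 / real CARD('p)\<bar> < 1" using prime_card_gt_1[where 'p='p] by simp
    then obtain n where n: "(1 / real CARD('p)) ^ n < e"
      using real_arch_pow_inv[OF e(1)] by fastforce
    have "residue_class n (res x n) \<subseteq> S"
      using n e(2) res_eq_iff_dist[of _ n x] by (force simp: residue_class_def)
    then show "\<exists>B\<in>range (\<lambda>(n, k). residue_class n k). x \<in> B \<and> B \<subseteq> S"
      by (intro bexI[of _ "residue_class n (res x n)"]) (auto simp: residue_class_def)
  qed (auto intro: open_residue_class)
qed auto

lemma sum_digits_bounds: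
  fixes d :: "nat \<Rightarrow> int"
  assumes p: "1 < p" and d: "\<And>i. 0 \<le> d i \<and> d i < p"
  shows "0 \<le> (\<Sum>i<n. d i * p ^ i) \<and> (\<Sum>i<n. d i * p ^ i) < p ^ n"
proof (induction n)
  case (Suc n)
  have "d n * p ^ n \<le> (p - 1) * p ^ n" using d[of n] p by (intro mult_right_mono) auto
  then show ?case using Suc d[of n] p by (auto simp: algebra_simps)
qed simp

lemma sum_digits:
  fixes d :: "nat \<Rightarrow> int"
  assumes p: "1 < p" and d: "\<And>i. 0 \<le> d i \<and> d i < p" and k: "0 \<le> k" "k < p ^ n"
  shows "(\<Sum>i<n. d i * p ^ i) = k \<longleftrightarrow> (\<forall>i<n. d i = k div p ^ i mod p)"
  using k
proof (induction n arbitrary: k)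
  case (Suc n)
  let ?S = "\<Sum>i<n. d i * p ^ i"
  have pn: "0 < p ^ n" using p by simp
  have S: "0 \<le> ?S \<and> ?S < p ^ n" using sum_digits_bounds[OF p d] .
  have kn: "0 \<le> k mod p ^ n" "k mod p ^ n < p ^ n" using pn by auto
  have top: "k div p ^ n mod p = k div p ^ n"
  proof (rule mod_pos_pos_trivial)
    show "0 \<le> k div p ^ n" using Suc.prems pn by (simp add: pos_imp_zdiv_nonneg_iff)
    have "k div p ^ n * p ^ n \<le> k" using kn(1) div_mult_mod_eq[of k "p ^ n"] by linarith
    then have "k div p ^ n * p ^ n < p * p ^ n" using Suc.prems by simp
    then show "k div p ^ n < p" using pn by simp
  qed
  have low: "k mod p ^ n div p ^ i mod p = k div p ^ i mod p" if "i < n" for i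
  proof -
    obtain m where n: "n = i + Suc m" using \<open>i < n\<close> less_iff_Suc_add[of i n] by auto
    have pi: "0 < p ^ i" using p by simp
    have "k mod p ^ n = p ^ i * (k div p ^ i mod p ^ Suc m) + k mod p ^ i"
      unfolding n power_add using p by (intro zmod_zmult2_eq) simp
    then have "k mod p ^ n div p ^ i = k div p ^ i mod p ^ Suc m"
      using p pi by (simp del: power_Suc)
    then have "k mod p ^ n div p ^ i mod p = k div p ^ i mod p ^ Suc m mod p" by (rule arg_cong)
    also have "\<dots> = k div p ^ i mod p" by (rule mod_mod_cancel) simp
    finally show ?thesis .
  qed
  have "(\<Sum>i<Suc n. d i * p ^ i) = k \<longleftrightarrow> ?S = k mod p ^ n \<and> d n = k div p ^ n"
  proof
    assume "(\<Sum>i<Suc n. d i * p ^ i) = k"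
    then have k_eq: "k = ?S + d n * p ^ n" by simp
    show "?S = k mod p ^ n \<and> d n = k div p ^ n"
      unfolding k_eq using S p by (simp add: div_pos_pos_trivial)
  next
    assume "?S = k mod p ^ n \<and> d n = k div p ^ n"
    then show "(\<Sum>i<Suc n. d i * p ^ i) = k" by (simp add: mod_div_mult_eq)
  qed
  also have "\<dots> \<longleftrightarrow> (\<forall>i<n. d i = k div p ^ i mod p) \<and> d n = k div p ^ n mod p"
    using Suc.IH[OF kn] low top by auto
  also have "\<dots> \<longleftrightarrow> (\<forall>i<Suc n. d i = k div p ^ i mod p)" by (auto simp: less_Suc_eq)
  finally show ?case .
qed simp

text \<open>
  The distribution of \<open>\<Sum>i. d\<^sub>i p\<^sup>i\<close> for independent uniform digits \<open>d\<^sub>i\<close> satisfies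
  \<^const>\<open>haar_prob\<close>.
\<close>

lemma haar_prob_exists: "\<exists>\<mu> :: 'p::prime_card padic_int measure. haar_prob \<mu>"
proof -
  define p where "p = int CARD('p)"
  have p: "1 < p" unfolding p_def by (rule prime_card_gt_1)
  let ?M = "\<lambda>_::nat. uniform_count_measure {0..<p}"
  have prob: "prob_space (uniform_count_measure {0..<p})"
    using p by (intro prob_space_uniform_count_measure) auto
  then interpret product_prob_space ?M UNIV
    by (simp add: product_prob_space_def product_sigma_finite_def product_prob_space_axioms_def
        prob_space_imp_sigma_finite)
  define D where "D = PiM UNIV ?M"
  interpret D: prob_space D unfolding D_def by (rule prob_space_PiM) (rule prob)
  have D_digit: "0 \<le> d i \<and> d i < p" if "d \<in> space D" for d i
    using that by (auto simp: D_def space_PiM PiE_iff space_uniform_count_measure)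
  define g :: "(nat \<Rightarrow> int) \<Rightarrow> 'p padic_int"
    where "g d = Abs_padic_int (\<lambda>n. (\<Sum>i<n. d i * p ^ i) mod p ^ n)" for d
  have res_g: "res (g d) n = (\<Sum>i<n. d i * p ^ i) mod p ^ n" for d n
    unfolding g_def
    by (subst Abs_padic_int_inverse) (auto simp: p_def[symmetric] simp del: power_Suc)
  have cyl: "g -` residue_class n k \<inter> space D
      = {d \<in> space D. \<forall>i\<in>{..<n}. d i \<in> {k div p ^ i mod p}}" if "0 \<le> k" "k < p ^ n" for n k
  proof -
    have "res (g d) n = k \<longleftrightarrow> (\<forall>i<n. d i = k div p ^ i mod p)" if d: "d \<in> space D" for d
    proof -
      have "(\<Sum>i<n. d i * p ^ i) mod p ^ n = (\<Sum>i<n. d i * p ^ i)"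
        using sum_digits_bounds[of p d n] p D_digit[OF d] by simp
      then show ?thesis
        using sum_digits[of p d k n] p D_digit[OF d] that \<open>0 \<le> k\<close> \<open>k < p ^ n\<close> by (simp add: res_g)
    qed
    then show ?thesis by (auto simp: residue_class_def)
  qed
  have empty: "residue_class n k = ({} :: 'p padic_int set)" if "\<not> (0 \<le> k \<and> k < p ^ n)" for n k
    using that res_bounds[where 'p='p] by (auto simp: residue_class_def p_def)
  have digit: "{k div p ^ i mod p} \<in> sets (?M i)" for k i
    using p by (simp add: sets_uniform_count_measure)
  have meas: "g \<in> D \<rightarrow>\<^sub>M borel"
    unfolding borel_residue_class
  proof (rule measurable_measure_of)
    fix A :: "'p padic_int set" assume "A \<in> range (\<lambda>(n, k). residue_class n k)"
    then obtain n k where A: "A = residue_class n k" by auto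
    show "g -` A \<inter> space D \<in> sets D"
    proof (cases "0 \<le> k \<and> k < p ^ n")
      case True
      have "{d \<in> space D. d i \<in> {k div p ^ i mod p}} \<in> sets D" for i
        using measurable_sets[OF measurable_component_singleton[of i UNIV ?M] digit[of k i]]
        by (simp add: D_def vimage_def Int_def conj_commute)
      then have "{d \<in> space D. \<forall>i\<in>{..<n}. d i \<in> {k div p ^ i mod p}} \<in> sets D"
        by (intro sets.sets_Collect_finite_All) auto
      then show ?thesis using True by (simp add: A cyl)
    qed (simp add: A empty)
  qed auto
  define \<mu> where "\<mu> = distr D borel g"
  interpret \<mu>: prob_space \<mu> unfolding \<mu>_def by (rule D.prob_space_distr[OF meas])
  have class_meas [measurable]: "residue_class n k \<in> sets (borel :: 'p padic_int measure)" for n k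
    by (intro borel_open open_residue_class)
  have mu_class: "emeasure \<mu> (residue_class n k) = ennreal ((1 / p) ^ n)"
    if "0 \<le> k" "k < p ^ n" for n k
  proof -
    have "emeasure \<mu> (residue_class n k) = (\<Prod>i\<in>{..<n}. emeasure (?M i) {k div p ^ i mod p})"
      unfolding \<mu>_def emeasure_distr[OF meas class_meas] cyl[OF that]
      unfolding D_def by (rule emeasure_PiM_Collect) (use digit in auto)
    also have "\<dots> = (\<Prod>i\<in>{..<n}. ennreal (1 / p))"
      using p by (intro prod.cong) (simp_all add: emeasure_uniform_count_measure)
    finally show ?thesis using p by (simp add: ennreal_power)
  qed
  have sets_mu: "sets \<mu> = sets borel" by (simp add: \<mu>_def)
  have "distr \<mu> borel (\<lambda>x. a + x) = \<mu>" for a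
  proof -
    let ?E = "range (\<lambda>(n, k). residue_class n k :: 'p padic_int set)"
    have pre: "(\<lambda>x. a + x) -` residue_class n k = residue_class n ((k - res a n) mod p ^ n)"
      if "0 \<le> k" "k < p ^ n" for n k
    proof -
      have "(res a n + res x n) mod p ^ n = k \<longleftrightarrow> res x n = (k - res a n) mod p ^ n" for x :: "'p padic_int"
      proof -
        have k: "k mod p ^ n = k" and x: "res x n mod p ^ n = res x n"
          using that res_bounds[of x n] by (simp_all add: p_def)
        show ?thesis
        proof
          assume *: "(res a n + res x n) mod p ^ n = k"
          show "res x n = (k - res a n) mod p ^ n"
            unfolding *[symmetric] mod_diff_left_eq by (simp add: x)
        next
          assume "res x n = (k - res a n) mod p ^ n"
          then show "(res a n + res x n) mod p ^ n = k" by (simp add: mod_add_right_eq k)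
        qed
      qed
      then show ?thesis by (auto simp: residue_class_def p_def)
    qed
    have "continuous_on UNIV (\<lambda>x. a + x)"
      unfolding continuous_on_iff by (auto simp: dist_padic_int_def)
    then have [measurable]: "(\<lambda>x. a + x) \<in> borel \<rightarrow>\<^sub>M borel"
      by (rule borel_measurable_continuous_onI)
    then have shift: "(\<lambda>x. a + x) \<in> \<mu> \<rightarrow>\<^sub>M borel"
      by (simp cong: measurable_cong_sets add: sets_mu)
    have sets_eq: "sets (borel :: 'p padic_int measure) = sigma_sets UNIV ?E"
      unfolding borel_residue_class by (rule sets_measure_of) simp
    have empty_E: "{} \<in> ?E"
      using empty[of 1 0] by (intro range_eqI[of _ _ "(0, 1)"]) simp
    show ?thesis
    proof (rule measure_eqI_generator_eq[where E = ?E and \<Omega> = UNIV and A = "\<lambda>_. residue_class 0 0"])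
      have le: "residue_class n k \<inter> residue_class m l \<in> ?E" if "n \<le> m" for n m k l
      proof (cases "l mod p ^ n = k")
        case True
        then have "residue_class n k \<inter> residue_class m l = (residue_class m l :: 'p padic_int set)"
          using res_mod_le[OF that, where 'p='p] by (auto simp: residue_class_def p_def)
        then show ?thesis by auto
      next
        case False
        then have "residue_class n k \<inter> residue_class m l = ({} :: 'p padic_int set)"
          using res_mod_le[OF that, where 'p='p] by (auto simp: residue_class_def p_def)
        then show ?thesis using empty_E by simp
      qed
      have Int: "residue_class n k \<inter> residue_class m l \<in> ?E" for n m k l
        using le[of n m k l] le[of m n l k] nat_le_linear[of n m] by (metis (no_types) Int_commute)
      show "Int_stable ?E"
        unfolding Int_stable_def
      proof (intro ballI)
        fix A B assume "A \<in> ?E" "B \<in> ?E"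
        then obtain n k m l where "A = residue_class n k" "B = residue_class m l" by force
        then show "A \<inter> B \<in> ?E" by (simp only: Int)
      qed
      show "emeasure (distr \<mu> borel (\<lambda>x. a + x)) X = emeasure \<mu> X" if "X \<in> ?E" for X
      proof (cases "X = {}")
        case False
        obtain z where "X = (case z of (n, k) \<Rightarrow> residue_class n k)" using \<open>X \<in> ?E\<close> by (rule rangeE)
        then obtain n k where X: "X = residue_class n k" by (cases z) simp
        then have k: "0 \<le> k" "k < p ^ n" using False empty by blast+
        have "emeasure (distr \<mu> borel (\<lambda>x. a + x)) X
            = emeasure \<mu> (residue_class n ((k - res a n) mod p ^ n))"
          using emeasure_distr[OF shift class_meas[of n k]] pre[OF k]
          by (simp add: X sets_eq_imp_space_eq[OF sets_mu])
        then show ?thesis using p k by (simp add: X mu_class)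
      qed simp
      show "range (\<lambda>_::nat. residue_class 0 0) \<subseteq> ?E" by auto
      show "(\<Union>i::nat. residue_class 0 0) = (UNIV :: 'p padic_int set)"
        by (simp add: residue_class_def)
      interpret shifted: prob_space "distr \<mu> borel (\<lambda>x. a + x)"
        by (rule \<mu>.prob_space_distr[OF shift])
      show "emeasure (distr \<mu> borel (\<lambda>x. a + x)) (residue_class 0 0) \<noteq> \<infinity>"
        by simp
    qed (simp_all add: sets_eq sets_mu)
  qed
  then have "haar_prob \<mu>" unfolding haar_prob_def using sets_mu \<mu>.prob_space_axioms by simp
  then show ?thesis by blast
qed

end

theory Submission
  imports Defs
begin

text \<open>
  After rescaling, \<open>F\<close> is a set of integer points modulo \<open>N = p\<^sup>n\<close> and \<open>\<xi>\<^sub>r\<close> is the pairing with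
  \<open>(1, r, r\<^sup>2)\<close>, so its fibres are slabs whose Fourier transforms live on the line through that point of
  a quadratic cone. For each pair \<open>(w, r)\<close> violating the claimed bound consider the first scale at
  which the slab through \<open>w\<close> is too rich. Its parent is not too rich, so, as \<open>\<alpha> < 1\<close>, the high
  frequencies carry a fixed proportion of the incidences between \<open>F\<close> and the rich slabs.
  The high-frequency part \<open>G\<close> of the sum of the indicators of the rich slabs is bounded in \<open>L\<^sup>4\<close>, and the
  hypothesis on \<open>F\<close> converts this into a bound for the average of \<open>G\<close> over \<open>F\<close>: the proportion of bad
  pairs at scale \<open>n\<close> decays geometrically in \<open>n\<close>, and Markov's inequality finishes the proof.

  The \<open>L\<^sup>4\<close> estimate is proved by induction on the scale. The frequency \<open>v\<close> of \<open>|G|\<^sup>2\<close> is a difference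
  of two points of the cone with parameters \<open>r, q\<close>, and \<open>v\<^sub>1 v\<^sub>3 - v\<^sub>2\<^sup>2\<close> determines the valuation of
  \<open>r - q\<close>. If it is nonzero modulo \<open>N\<close>, then at most two sectors of the corresponding width contribute
  to \<open>v\<close>, which leads to fourth moments of narrower sectors. Otherwise \<open>v\<close> is orthogonal to a
  plank along a light ray, and averaging over the plank decouples the sector by plain orthogonality.
\<close>

section \<open>Exponential sums modulo N\<close>

text \<open>The obstacle is that the cone is flat along its rays: the two-pairings argument for a
  parabola works only after the height has been frozen, and over \<open>m\<close> scales at a time.
  Iterating it costs a constant per step that does not depend on \<open>m\<close>; for large
  \<open>m\<close> this constant is below the permitted loss \<open>\<theta> ^ (2 * m)\<close>.
  Losses that do depend on \<open>m\<close>, such as the number of height classes modulo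
  \<open>p ^ (2 * m)\<close>, are paid once.

  Exponents: a cell of scale \<open>n\<close> holds about the proportion
  \<open>p ^ (-n \<alpha>)\<close> of \<open>F\<close>, a slab is rich from the proportion
  \<open>p ^ (-n (\<alpha> - \<epsilon>))\<close> on, and the fourth power of the proportion of rich
  incidences is at most the quotient of the two times \<open>\<theta> ^ (2 * n)\<close>, up to a
  constant. With \<open>\<theta> = p ^ (\<epsilon> / 4)\<close> this is
  \<open>p ^ (-n \<epsilon> / 2)\<close>, whose fourth root is summable over the scales. The tail of
  the sum is small only beyond some scale \<open>n0\<close>; the constant \<open>p ^ n0\<close>
  makes the claim trivial up to there. The tail has to be small compared with
  \<open>measure \<mu> J\<close>, which is how this measure enters the constant.\<close>

definition e_mod :: "int \<Rightarrow> int \<Rightarrow> complex" where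
  "e_mod N k = cis (2 * pi * real_of_int k / real_of_int N)"

lemma e_mod_0 [simp]: "e_mod N 0 = 1"
  by (simp add: e_mod_def)

lemma norm_e_mod [simp]: "norm (e_mod N k) = 1"
  by (simp add: e_mod_def)

lemma e_mod_add: "e_mod N (j + k) = e_mod N j * e_mod N k"
  by (simp add: e_mod_def cis_mult add_divide_distrib distrib_left)

lemma e_mod_minus: "e_mod N (- k) = cnj (e_mod N k)"
  by (simp add: e_mod_def cis_cnj)

lemma e_mod_diff: "e_mod N (j - k) = e_mod N j * cnj (e_mod N k)"
  using e_mod_add[of N j "- k"] by (simp add: e_mod_minus)

lemma e_mod_dvd: "N dvd k \<Longrightarrow> e_mod N k = 1"
proof -
  assume "N dvd k"
  then obtain q where q: "k = N * q" ..
  show ?thesis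
  proof (cases "N = 0")
    case False
    then have "2 * pi * real_of_int k / real_of_int N = 2 * pi * real_of_int q"
      by (simp add: q)
    then show ?thesis unfolding e_mod_def by (simp only:) (rule cis_multiple_2pi, simp)
  qed (simp add: q)
qed

lemma e_mod_cong: "N dvd j - k \<Longrightarrow> e_mod N j = e_mod N k"
  using e_mod_add[of N "j - k" k] by (simp add: e_mod_dvd)

lemma e_mod_eq_1_iff: "N > 0 \<Longrightarrow> e_mod N k = 1 \<longleftrightarrow> N dvd k"
proof
  assume N: "N > 0" and "e_mod N k = 1"
  then obtain q :: int where q: "2 * pi * real_of_int k / real_of_int N = 2 * pi * real_of_int q"
    by (auto simp: e_mod_def complex_eq_iff cos_one_2pi_int mult.commute)
  then have "real_of_int k = real_of_int (q * N)"
    using N by (simp add: field_simps)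
  then show "N dvd k" by (simp only: of_int_eq_iff) simp
qed (simp add: e_mod_dvd)

lemma sum_e_mod:
  assumes "N > 0"
  shows "(\<Sum>t\<in>{0..<N}. e_mod N (k * t)) = (if N dvd k then of_int N else 0)"
proof (cases "N dvd k")
  case True
  then show ?thesis using assms by (simp add: e_mod_dvd)
next
  case False
  have pow: "e_mod N (k * int t) = e_mod N k ^ t" for t
    by (induction t) (simp_all add: distrib_left e_mod_add)
  have "{0..<N} = int ` {..<nat N}"
    using assms by (auto simp: image_iff intro!: bexI[of _ "nat _"])
  then have "(\<Sum>t\<in>{0..<N}. e_mod N (k * t)) = (\<Sum>t<nat N. e_mod N k ^ t)"
    by (simp add: sum.reindex pow)
  also have "\<dots> = (e_mod N k ^ nat N - 1) / (e_mod N k - 1)"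
    using False assms by (intro geometric_sum) (simp add: e_mod_eq_1_iff)
  also have "e_mod N k ^ nat N = 1"
    using assms by (simp add: pow[symmetric] e_mod_dvd)
  finally show ?thesis using False by simp
qed

section \<open>Fourier analysis on the cube of residues modulo \<open>N\<close>\<close>

type_synonym int3 = "int \<times> int \<times> int"

fun dot3 :: "int3 \<Rightarrow> int3 \<Rightarrow> int" where
  "dot3 (v1, v2, v3) (w1, w2, w3) = v1 * w1 + v2 * w2 + v3 * w3"

fun dvd3 :: "int \<Rightarrow> int3 \<Rightarrow> bool" where
  "dvd3 N (v1, v2, v3) \<longleftrightarrow> N dvd v1 \<and> N dvd v2 \<and> N dvd v3"

definition cube :: "int \<Rightarrow> int3 set" where
  "cube N = {0..<N} \<times> {0..<N} \<times> {0..<N}"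

lemma finite_cube [simp]: "finite (cube N)"
  by (simp add: cube_def)

lemma dot3_add: "dot3 (u + v) w = dot3 u w + dot3 v w"
  by (cases u; cases v; cases w) (simp add: algebra_simps)

lemma dot3_diff: "dot3 (u - v) w = dot3 u w - dot3 v w"
  by (cases u; cases v; cases w) (simp add: algebra_simps)

lemma dot3_add_right: "dot3 v (u + w) = dot3 v u + dot3 v w"
  by (cases u; cases v; cases w) (simp add: algebra_simps)

lemma dvd3_dot3: "dvd3 N v \<Longrightarrow> N dvd dot3 v w"
  by (cases v; cases w) simp

lemma dvd3_diff: "dvd3 N u \<Longrightarrow> dvd3 N v \<Longrightarrow> dvd3 N (u - v)"
  by (cases u; cases v) simp

lemma sum_cube: "(\<Sum>w\<in>cube N. f w) = (\<Sum>w1\<in>{0..<N}. \<Sum>w2\<in>{0..<N}. \<Sum>w3\<in>{0..<N}. f (w1, w2, w3))"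
  by (simp add: cube_def sum.cartesian_product)

lemma sum_cube_e_mod:
  assumes "N > 0"
  shows "(\<Sum>w\<in>cube N. e_mod N (dot3 v w)) = (if dvd3 N v then of_int N ^ 3 else 0)"
proof (cases v)
  case (fields v1 v2 v3)
  have "(\<Sum>w\<in>cube N. e_mod N (dot3 v w)) =
      (\<Sum>w1\<in>{0..<N}. e_mod N (v1 * w1)) * (\<Sum>w2\<in>{0..<N}. e_mod N (v2 * w2)) *
      (\<Sum>w3\<in>{0..<N}. e_mod N (v3 * w3))"
    unfolding sum_cube fields
    by (simp add: e_mod_add flip: sum_distrib_left sum_distrib_right)
  then show ?thesis
    using assms by (auto simp: sum_e_mod fields power3_eq_cube)
qed

fun mod3 :: "int3 \<Rightarrow> int \<Rightarrow> int3" where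
  "mod3 (v1, v2, v3) N = (v1 mod N, v2 mod N, v3 mod N)"

lemma mod3_in_cube: "N > 0 \<Longrightarrow> mod3 v N \<in> cube N"
  by (cases v) (simp add: cube_def)

lemma dvd3_diff_iff_mod3: "v \<in> cube N \<Longrightarrow> dvd3 N (u - v) \<longleftrightarrow> v = mod3 u N"
  by (cases u; cases v) (auto simp: cube_def mod_eq_dvd_iff[symmetric])

lemma parseval_cube:
  assumes "N > 0"
  shows "(\<Sum>w\<in>cube N. (\<Sum>v\<in>cube N. c v * e_mod N (dot3 v w)) * cnj (\<Sum>v\<in>cube N. d v * e_mod N (dot3 v w)))
    = of_int N ^ 3 * (\<Sum>v\<in>cube N. c v * cnj (d v))"
proof -
  have eq: "u \<in> cube N \<Longrightarrow> v \<in> cube N \<Longrightarrow> dvd3 N (u - v) \<longleftrightarrow> u = v" for u v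
    by (cases u; cases v) (auto simp: cube_def mod_eq_dvd_iff[symmetric])
  have "(\<Sum>w\<in>cube N. (\<Sum>v\<in>cube N. c v * e_mod N (dot3 v w)) * cnj (\<Sum>v\<in>cube N. d v * e_mod N (dot3 v w)))
    = (\<Sum>w\<in>cube N. \<Sum>u\<in>cube N. \<Sum>v\<in>cube N. c u * cnj (d v) * e_mod N (dot3 (u - v) w))"
    by (simp add: sum_product dot3_diff e_mod_diff mult.assoc mult.left_commute)
  also have "\<dots> = (\<Sum>u\<in>cube N. \<Sum>v\<in>cube N. c u * cnj (d v) * (\<Sum>w\<in>cube N. e_mod N (dot3 (u - v) w)))"
    unfolding sum_distrib_left by (subst sum.swap, rule sum.cong[OF refl], rule sum.swap)
  also have "\<dots> = (\<Sum>u\<in>cube N. \<Sum>v\<in>cube N. if u = v then c u * cnj (d v) * of_int N ^ 3 else 0)"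
    by (intro sum.cong refl) (simp add: sum_cube_e_mod[OF assms] eq)
  also have "\<dots> = of_int N ^ 3 * (\<Sum>v\<in>cube N. c v * cnj (d v))"
    by (simp add: sum_distrib_left mult.commute)
  finally show ?thesis .
qed

section \<open>Exponential sums over points of the cone\<close>

fun cone_pt :: "int \<times> int \<Rightarrow> int3" where
  "cone_pt (s, r) = (s, s * r, s * r\<^sup>2)"

definition exp_sum :: "int \<Rightarrow> (int \<times> int \<Rightarrow> complex) \<Rightarrow> (int \<times> int) set \<Rightarrow> int3 \<Rightarrow> complex" where
  "exp_sum N a I w = (\<Sum>x\<in>I. a x * e_mod N (dot3 (cone_pt x) w))"

text \<open>The Fourier coefficient at \<open>v\<close> of the squared modulus of
  \<open>exp_sum N a I\<close>, see \<open>exp_sum_sq_expand\<close>. Differences are compared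
  modulo \<open>N\<close> because the characters see only residues.\<close>

definition acorr :: "int \<Rightarrow> (int \<times> int \<Rightarrow> complex) \<Rightarrow> (int \<times> int) set \<Rightarrow> int3 \<Rightarrow> complex" where
  "acorr N a I v = (\<Sum>(x, y)\<in>I \<times> I. if dvd3 N (cone_pt x - cone_pt y - v) then a x * cnj (a y) else 0)"

lemma exp_sum_mult_cnj:
  "exp_sum N a I w * cnj (exp_sum N a J w)
    = (\<Sum>(x, y)\<in>I \<times> J. a x * cnj (a y) * e_mod N (dot3 (cone_pt x - cone_pt y) w))"
  by (simp add: exp_sum_def sum_product sum.cartesian_product dot3_diff e_mod_diff mult_ac)

lemma exp_sum_sq_expand:
  assumes "N > 0"
  shows "complex_of_real ((cmod (exp_sum N a I w))\<^sup>2) = (\<Sum>v\<in>cube N. acorr N a I v * e_mod N (dot3 v w))"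
proof -
  have "(\<Sum>v\<in>cube N. acorr N a I v * e_mod N (dot3 v w))
    = (\<Sum>v\<in>cube N. \<Sum>(x, y)\<in>I \<times> I. if v = mod3 (cone_pt x - cone_pt y) N
        then a x * cnj (a y) * e_mod N (dot3 v w) else 0)"
    unfolding acorr_def sum_distrib_right
    by (intro sum.cong refl) (auto simp: dvd3_diff_iff_mod3 split_def)
  also have "\<dots> = (\<Sum>(x, y)\<in>I \<times> I. a x * cnj (a y) * e_mod N (dot3 (mod3 (cone_pt x - cone_pt y) N) w))"
    unfolding split_def by (subst sum.swap) (simp add: mod3_in_cube[OF assms])
  also have "\<dots> = (\<Sum>(x, y)\<in>I \<times> I. a x * cnj (a y) * e_mod N (dot3 (cone_pt x - cone_pt y) w))"
  proof -
    have "e_mod N (dot3 (mod3 u N) w) = e_mod N (dot3 u w)" for u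
    proof (rule e_mod_cong)
      have "dvd3 N (u - mod3 u N)"
        using dvd3_diff_iff_mod3[OF mod3_in_cube[OF assms]] by blast
      then show "N dvd dot3 (mod3 u N) w - dot3 u w"
        using dvd3_dot3[of N "u - mod3 u N" w] by (simp add: dot3_diff dvd_diff_commute)
    qed
    then show ?thesis by simp
  qed
  finally show ?thesis
    by (simp only: complex_norm_square exp_sum_mult_cnj)
qed

lemma moment22:
  assumes "N > 0"
  shows "complex_of_real (\<Sum>w\<in>cube N. (cmod (exp_sum N a I w))\<^sup>2 * (cmod (exp_sum N a J w))\<^sup>2)
    = of_int N ^ 3 * (\<Sum>v\<in>cube N. acorr N a I v * cnj (acorr N a J v))"
proof -
  have "complex_of_real (\<Sum>w\<in>cube N. (cmod (exp_sum N a I w))\<^sup>2 * (cmod (exp_sum N a J w))\<^sup>2)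
    = (\<Sum>w\<in>cube N. complex_of_real ((cmod (exp_sum N a I w))\<^sup>2)
        * cnj (complex_of_real ((cmod (exp_sum N a J w))\<^sup>2)))"
    by simp
  then show ?thesis
    by (simp only: exp_sum_sq_expand[OF assms] parseval_cube[OF assms])
qed

lemma moment4:
  assumes "N > 0"
  shows "(\<Sum>w\<in>cube N. cmod (exp_sum N a I w) ^ 4) = of_int N ^ 3 * (\<Sum>v\<in>cube N. (cmod (acorr N a I v))\<^sup>2)"
proof -
  have "complex_of_real (\<Sum>w\<in>cube N. cmod (exp_sum N a I w) ^ 4)
      = complex_of_real (of_int N ^ 3 * (\<Sum>v\<in>cube N. (cmod (acorr N a I v))\<^sup>2))"
    using moment22[OF assms, of a I I]
    by (simp add: complex_norm_square[symmetric] flip: power_add)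
  then show ?thesis by (simp only: of_real_eq_iff)
qed

text \<open>By Parseval the two sums interact only through frequencies \<open>v\<close> that are
  differences of points within \<open>I\<close> and also within \<open>J\<close>. Fourth moments are
  later bounded by asking, for each \<open>v\<close>, which sectors share it.\<close>

lemma moment22_le:
  assumes "N > 0"
  shows "(\<Sum>w\<in>cube N. (cmod (exp_sum N a I w))\<^sup>2 * (cmod (exp_sum N a J w))\<^sup>2)
    \<le> of_int N ^ 3 * (\<Sum>v\<in>cube N. cmod (acorr N a I v) * cmod (acorr N a J v))"
proof -
  let ?S = "\<Sum>w\<in>cube N. (cmod (exp_sum N a I w))\<^sup>2 * (cmod (exp_sum N a J w))\<^sup>2"
  have "?S \<le> cmod (complex_of_real ?S)" by (simp only: norm_of_real abs_ge_self)
  also have "\<dots> = of_int N ^ 3 * cmod (\<Sum>v\<in>cube N. acorr N a I v * cnj (acorr N a J v))"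
    unfolding moment22[OF assms] using assms by (simp add: norm_mult norm_power)
  also have "\<dots> \<le> of_int N ^ 3 * (\<Sum>v\<in>cube N. cmod (acorr N a I v) * cmod (acorr N a J v))"
    using assms by (intro mult_left_mono order_trans[OF norm_sum]) (simp_all add: norm_mult)
  finally show ?thesis .
qed

text \<open>Orthogonality: without an additive relation between the four index sets every character
  in the expansion sums to 0. This removes the unpaired quadruples in
  \<open>parabola_step_sector\<close>.\<close>

lemma exp_sum_four_eq_0:
  assumes "N > 0"
  and "\<And>x1 x2 x3 x4. x1 \<in> I1 \<Longrightarrow> x2 \<in> I2 \<Longrightarrow> x3 \<in> I3 \<Longrightarrow> x4 \<in> I4
    \<Longrightarrow> \<not> dvd3 N (cone_pt x1 + cone_pt x2 - (cone_pt x3 + cone_pt x4))"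
  shows "(\<Sum>w\<in>cube N. exp_sum N a I1 w * exp_sum N a I2 w * cnj (exp_sum N a I3 w * exp_sum N a I4 w)) = 0"
proof -
  have "exp_sum N a I1 w * exp_sum N a I2 w * cnj (exp_sum N a I3 w * exp_sum N a I4 w)
    = (\<Sum>x\<in>(I1 \<times> I2) \<times> (I3 \<times> I4). a (fst (fst x)) * a (snd (fst x)) * cnj (a (fst (snd x)) * a (snd (snd x)))
        * e_mod N (dot3 (cone_pt (fst (fst x)) + cone_pt (snd (fst x)) - (cone_pt (fst (snd x)) + cone_pt (snd (snd x)))) w))" for w
    by (simp add: exp_sum_def sum_product sum.cartesian_product split_def dot3_diff dot3_add e_mod_diff e_mod_add mult_ac)
  then have "(\<Sum>w\<in>cube N. exp_sum N a I1 w * exp_sum N a I2 w * cnj (exp_sum N a I3 w * exp_sum N a I4 w))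
    = (\<Sum>x\<in>(I1 \<times> I2) \<times> (I3 \<times> I4). a (fst (fst x)) * a (snd (fst x)) * cnj (a (fst (snd x)) * a (snd (snd x)))
        * (\<Sum>w\<in>cube N. e_mod N (dot3 (cone_pt (fst (fst x)) + cone_pt (snd (fst x)) - (cone_pt (fst (snd x)) + cone_pt (snd (snd x)))) w)))"
    unfolding sum_distrib_left by (simp only:) (rule sum.swap)
  also have "\<dots> = 0"
    using assms(2) by (intro sum.neutral ballI) (auto simp: sum_cube_e_mod[OF assms(1)])
  finally show ?thesis .
qed

lemma sum_sq_le_2:
  fixes f :: "'a \<Rightarrow> real"
  assumes "finite S" "card {x\<in>S. f x \<noteq> 0} \<le> 2"
  shows "(\<Sum>x\<in>S. f x)\<^sup>2 \<le> 2 * (\<Sum>x\<in>S. (f x)\<^sup>2)"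
proof -
  let ?T = "{x\<in>S. f x \<noteq> 0}"
  have "(\<Sum>x\<in>S. f x) = (\<Sum>x\<in>?T. f x)" "(\<Sum>x\<in>S. (f x)\<^sup>2) = (\<Sum>x\<in>?T. (f x)\<^sup>2)"
    using assms(1) by (intro sum.mono_neutral_right; auto)+
  moreover have "(\<Sum>x\<in>?T. f x)\<^sup>2 \<le> of_nat (card ?T) * (\<Sum>x\<in>?T. (f x)\<^sup>2)"
    using sum_squared_le_sum_of_squares[of f ?T] by (simp add: mult.commute)
  moreover have "of_nat (card ?T) * (\<Sum>x\<in>?T. (f x)\<^sup>2) \<le> 2 * (\<Sum>x\<in>?T. (f x)\<^sup>2)"
    using assms(2) by (intro mult_right_mono sum_nonneg) auto
  ultimately show ?thesis by simp
qed

section \<open>Additive relations on the cone\<close>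

lemma prime_pow_dvd_cancel:
  fixes p :: int
  assumes "prime p" "\<not> p dvd u" "p ^ n dvd z * u"
  shows "p ^ n dvd z"
  using assms by (meson coprime_dvd_mult_left_iff coprime_power_left_iff prime_imp_coprime)

lemma prime_pow_decompose:
  fixes p x :: int
  assumes "prime p" "\<not> p ^ l dvd x"
  obtains e u where "x = p ^ e * u" "\<not> p dvd u" "e < l"
proof -
  have "x \<noteq> 0" using assms(2) by auto
  moreover have "\<not> is_unit p" using assms(1) by auto
  ultimately obtain u where u: "x = p ^ multiplicity p x * u" "\<not> p dvd u"
    using multiplicity_decompose'[of x p] by metis
  have "multiplicity p x < l"
    using assms(2) u(1) by (metis dvd_triv_left le_imp_power_dvd dvd_trans not_le)
  with u that show ?thesis by blast
qed

lemma prime_pow_dvd_iff: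
  fixes p u :: int
  assumes "prime p" "\<not> p dvd u"
  shows "p ^ n dvd p ^ e * u \<longleftrightarrow> n \<le> e"
proof
  assume "p ^ n dvd p ^ e * u"
  then have "p ^ n dvd p ^ e" by (rule prime_pow_dvd_cancel[OF assms])
  then show "n \<le> e"
    using prime_gt_1_int[OF assms(1)] by (simp add: dvd_power_iff)
qed (simp add: le_imp_power_dvd dvd_mult2)

lemma prime_pow_dvd_mult_cancel:
  fixes p z :: int
  assumes "prime p" "p ^ n dvd p ^ e * z"
  shows "p ^ (n - e) dvd z"
proof (cases "e \<le> n")
  case True
  then have "p ^ e * p ^ (n - e) dvd p ^ e * z"
    using assms(2) by (simp flip: power_add)
  then show ?thesis using assms(1) by (auto simp: dvd_mult_cancel_left)
qed simp

lemma prime_pow_dvd_prod: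
  fixes p x y :: int
  assumes "prime p" "p ^ (2 * m) dvd x * y"
  shows "p ^ m dvd x \<or> p ^ m dvd y"
proof (rule ccontr)
  assume "\<not> ?thesis"
  then obtain e u f w where x: "x = p ^ e * u" "\<not> p dvd u" "e < m"
      and y: "y = p ^ f * w" "\<not> p dvd w" "f < m"
    using prime_pow_decompose[OF assms(1)] by metis
  have "x * y = p ^ (e + f) * (u * w)" by (simp add: x y power_add)
  moreover have "\<not> p dvd u * w" using x(2) y(2) assms(1) by (simp add: prime_dvd_mult_iff)
  ultimately have "2 * m \<le> e + f"
    using assms(2) by (simp only: prime_pow_dvd_iff[OF assms(1)] not_False_eq_True)
  with x(3) y(3) show False by simp
qed

text \<open>Pairing with the light direction at \<open>r\<close>, and half its derivative in
  \<open>r\<close>, vanish on the point \<open>(s, r)\<close>, so only \<open>(t, q)\<close>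
  contributes. The quadratic form vanishes at both points, which leaves its mixed term. The numbers
  \<open>k1, k2, k3\<close> carry the errors modulo \<open>N\<close>.\<close>

lemma cone_diff_facts:
  assumes "dvd3 N (cone_pt (s, r) - cone_pt (t, q) - (v1, v2, v3))"
  shows "N dvd (v3 - 2 * r * v2 + r\<^sup>2 * v1) + t * (r - q)\<^sup>2"
    and "N dvd (v1 * r - v2) + t * (r - q)"
    and "N dvd (v1 * v3 - v2\<^sup>2) + s * t * (r - q)\<^sup>2"
proof -
  obtain k1 k2 k3 where "s - t - v1 = N * k1" "s * r - t * q - v2 = N * k2" "s * r\<^sup>2 - t * q\<^sup>2 - v3 = N * k3"
    using assms by (auto elim!: dvdE)
  then have v: "v1 = s - t - N * k1" "v2 = s * r - t * q - N * k2" "v3 = s * r\<^sup>2 - t * q\<^sup>2 - N * k3"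
    by simp_all
  have "(v3 - 2 * r * v2 + r\<^sup>2 * v1) + t * (r - q)\<^sup>2 = N * (2 * r * k2 - k3 - r\<^sup>2 * k1)"
    unfolding v by algebra
  then show "N dvd (v3 - 2 * r * v2 + r\<^sup>2 * v1) + t * (r - q)\<^sup>2" by simp
  have "(v1 * r - v2) + t * (r - q) = N * (k2 - k1 * r)"
    unfolding v by algebra
  then show "N dvd (v1 * r - v2) + t * (r - q)" by simp
  have "(v1 * v3 - v2\<^sup>2) + s * t * (r - q)\<^sup>2
      = N * (N * k1 * k3 - k1 * (s * r\<^sup>2 - t * q\<^sup>2) - k3 * (s - t) + 2 * k2 * (s * r - t * q) - N * k2\<^sup>2)"
    unfolding v by algebra
  then show "N dvd (v1 * v3 - v2\<^sup>2) + s * t * (r - q)\<^sup>2" by simp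
qed

text \<open>
  \<open>quad v r\<close> is the pairing of \<open>v\<close> with the light direction \<open>(1, r, r\<^sup>2)\<close> under the quadratic form
  \<open>v\<^sub>1 v\<^sub>3 - v\<^sub>2\<^sup>2\<close> of the cone, so that its roots are the directions of the two planes through \<open>v\<close>
  tangent to the cone. If \<open>v\<close> is a difference of two points of the cone, these points lie near the roots.
\<close>

abbreviation quad :: "int3 \<Rightarrow> int \<Rightarrow> int" where
  "quad v r \<equiv> (case v of (v1, v2, v3) \<Rightarrow> v3 - 2 * r * v2 + r\<^sup>2 * v1)"

lemma quad_diff: "quad (v1, v2, v3) r' - quad (v1, v2, v3) r = (r' - r) * (2 * (v1 * r - v2) + v1 * (r' - r))"
  by (simp add: power2_eq_square algebra_simps)

text \<open>A quadratic has at most two roots, in quantitative form. For a root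
  \<open>\<rho>\<close> with \<open>\<rho> - r\<close> of valuation \<open>e < l\<close>,
  \<open>quad_diff\<close> makes \<open>2 * (v1 * r - v2) + v1 * (\<rho> - r)\<close> divisible by
  \<open>p ^ (2 * l - e)\<close>, hence by \<open>p ^ Suc l\<close>; so
  \<open>v1 * (\<rho> - r)\<close> has valuation exactly \<open>l\<close>, like the half derivative
  at \<open>r\<close>. Thus \<open>e\<close> is determined by \<open>v1\<close>, and subtracting the
  relations for \<open>r'\<close> and \<open>r''\<close> gives the claim.\<close>

lemma quad_roots_congruent:
  fixes p :: int
  assumes p: "prime p" "p > 2"
    and q: "p ^ (2 * l) dvd quad (v1, v2, v3) r" "p ^ (2 * l) dvd quad (v1, v2, v3) r'" "p ^ (2 * l) dvd quad (v1, v2, v3) r''"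
    and T: "p ^ l dvd v1 * r - v2" "\<not> p ^ Suc l dvd v1 * r - v2"
    and ne: "\<not> p ^ l dvd r' - r" "\<not> p ^ l dvd r'' - r"
  shows "p ^ l dvd r' - r''"
proof -
  let ?T = "v1 * r - v2"
  have p2: "\<not> p dvd 2" using p by (auto dest: zdvd_imp_le)
  have key: "\<exists>e u. \<rho> - r = p ^ e * u \<and> \<not> p dvd u \<and> e < l \<and> p ^ (2 * l - e) dvd 2 * ?T + v1 * (\<rho> - r)
      \<and> p ^ l dvd v1 * p ^ e \<and> \<not> p ^ Suc l dvd v1 * p ^ e"
    if q': "p ^ (2 * l) dvd quad (v1, v2, v3) \<rho>" and ne': "\<not> p ^ l dvd \<rho> - r" for \<rho>
  proof -
    obtain e u where e: "\<rho> - r = p ^ e * u" "\<not> p dvd u" "e < l"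
      using prime_pow_decompose[OF p(1) ne'] .
    let ?Y = "2 * ?T + v1 * (\<rho> - r)"
    have "p ^ (2 * l) dvd (\<rho> - r) * ?Y"
      using dvd_diff[OF q' q(1)] unfolding quad_diff .
    then have "p ^ (2 * l) dvd (p ^ e * ?Y) * u" by (simp add: e mult_ac)
    then have Y: "p ^ (2 * l - e) dvd ?Y"
      using prime_pow_dvd_cancel[OF p(1) e(2)] prime_pow_dvd_mult_cancel[OF p(1)] by blast
    have Y': "p ^ Suc l dvd ?Y"
      by (rule dvd_trans[OF le_imp_power_dvd Y]) (use e in simp)
    have "p ^ l dvd ?Y - 2 * ?T"
      by (rule dvd_diff[OF dvd_trans[OF le_imp_power_dvd Y'] dvd_mult[OF T(1)]]) simp
    then have "p ^ l dvd (v1 * p ^ e) * u" by (simp add: e mult_ac)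
    then have 1: "p ^ l dvd v1 * p ^ e" by (rule prime_pow_dvd_cancel[OF p(1) e(2)])
    have "\<not> p ^ Suc l dvd v1 * p ^ e"
    proof
      assume "p ^ Suc l dvd v1 * p ^ e"
      then have "p ^ Suc l dvd ?Y - (v1 * p ^ e) * u" by (rule dvd_diff[OF Y' dvd_mult2])
      then have "p ^ Suc l dvd ?T * 2" by (simp add: e mult_ac)
      then show False using prime_pow_dvd_cancel[OF p(1) p2] T(2) by blast
    qed
    with e Y 1 show ?thesis by blast
  qed
  obtain e u where e: "r' - r = p ^ e * u" "\<not> p dvd u" "e < l"
      "p ^ (2 * l - e) dvd 2 * ?T + v1 * (r' - r)" "p ^ l dvd v1 * p ^ e" "\<not> p ^ Suc l dvd v1 * p ^ e"
    using key[OF q(2) ne(1)] by blast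
  obtain f w where f: "r'' - r = p ^ f * w" "\<not> p dvd w" "f < l"
      "p ^ (2 * l - f) dvd 2 * ?T + v1 * (r'' - r)" "p ^ l dvd v1 * p ^ f" "\<not> p ^ Suc l dvd v1 * p ^ f"
    using key[OF q(3) ne(2)] by blast
  have "\<not> p ^ Suc l dvd v1" using e(6) by (meson dvd_mult2)
  then obtain g y where g: "v1 = p ^ g * y" "\<not> p dvd y"
    using prime_pow_decompose[OF p(1)] by metis
  have val: "p ^ i dvd v1 * p ^ j \<longleftrightarrow> i \<le> g + j" for i j
    using prime_pow_dvd_iff[OF p(1) g(2), of i "g + j"] by (simp add: g power_add mult_ac)
  have le: "g + e = l" "g + f = l" using e(5,6) f(5,6) by (simp_all only: val)
  then have [simp]: "f = e" by simp
  have "p ^ (2 * l - e) dvd (2 * ?T + v1 * (r' - r)) - (2 * ?T + v1 * (r'' - r))"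
    using e(4) f(4) by (intro dvd_diff) simp_all
  also have "\<dots> = p ^ l * ((u - w) * y)"
    by (simp add: e(1) f(1) g le(1)[symmetric] power_add algebra_simps)
  finally have "p ^ (2 * l - e - l) dvd (u - w) * y"
    by (rule prime_pow_dvd_mult_cancel[OF p(1)])
  moreover have "2 * l - e - l = g" using le by linarith
  ultimately have "p ^ g dvd (u - w) * y" by (simp only:)
  then have "p ^ g dvd u - w" by (rule prime_pow_dvd_cancel[OF p(1) g(2)])
  then have "p ^ e * p ^ g dvd p ^ e * (u - w)" by (rule mult_dvd_mono[OF dvd_refl])
  also have "p ^ e * (u - w) = r' - r''" using e(1) f(1) unfolding \<open>f = e\<close> right_diff_distrib by linarith
  also have "p ^ e * p ^ g = p ^ l" using le(1) by (metis add.commute power_add)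
  finally show ?thesis .
qed

text \<open>Three roots modulo \<open>p ^ n\<close>, two of them at distance exactly
  \<open>p ^ (-b)\<close> and the third further away, force the quadratic to degenerate: the divided
  differences eliminate \<open>v1 * r - v2\<close> and leave \<open>v1\<close> times a power of
  \<open>p\<close>. The conclusion is the orthogonality to a plank at scale \<open>b\<close> that
  \<open>plank_dual\<close> expresses, centred at \<open>r\<close>.\<close>

lemma quad_roots_dual:
  fixes p :: int
  assumes p: "prime p" "p > 2"
    and q: "p ^ n dvd quad (v1, v2, v3) r" "p ^ n dvd quad (v1, v2, v3) r'" "p ^ n dvd quad (v1, v2, v3) r''"
    and r': "p ^ b dvd r' - r" "\<not> p ^ Suc b dvd r' - r" and r'': "\<not> p ^ b dvd r'' - r"
  shows "p ^ n dvd v1 * p ^ (2 * b)" "p ^ n dvd (v1 * r - v2) * p ^ b"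
proof -
  let ?T = "v1 * r - v2"
  have p2: "\<not> p dvd 2" using p by (auto dest: zdvd_imp_le)
  obtain e u where e: "r' - r = p ^ e * u" "\<not> p dvd u" "e < Suc b"
    using prime_pow_decompose[OF p(1) r'(2)] .
  then have [simp]: "e = b" using r'(1) prime_pow_dvd_iff[OF p(1) e(2), of b e] by simp
  obtain d w where d: "r'' - r = p ^ d * w" "\<not> p dvd w" "d < b"
    using prime_pow_decompose[OF p(1) r''] .
  have "p ^ n dvd (r' - r) * (2 * ?T + v1 * (r' - r))"
    using dvd_diff[OF q(2) q(1)] unfolding quad_diff .
  then have "p ^ n dvd (p ^ b * (2 * ?T + v1 * (r' - r))) * u" by (simp add: e mult_ac)
  then have 1: "p ^ n dvd p ^ b * (2 * ?T + v1 * (r' - r))"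
    by (rule prime_pow_dvd_cancel[OF p(1) e(2)])
  have "p ^ n dvd (r'' - r) * (2 * ?T + v1 * (r'' - r))"
    using dvd_diff[OF q(3) q(1)] unfolding quad_diff .
  then have "p ^ n dvd (p ^ d * (2 * ?T + v1 * (r'' - r))) * w" by (simp add: d mult_ac)
  then have "p ^ n dvd p ^ d * (2 * ?T + v1 * (r'' - r))"
    by (rule prime_pow_dvd_cancel[OF p(1) d(2)])
  then have "p ^ n dvd p ^ (b - d) * (p ^ d * (2 * ?T + v1 * (r'' - r)))" by (rule dvd_mult)
  then have 2: "p ^ n dvd p ^ b * (2 * ?T + v1 * (r'' - r))"
    using d(3) by (simp add: mult.assoc[symmetric] flip: power_add)
  have bd: "p ^ b = p ^ d * p ^ (b - d)" using d(3) by (simp flip: power_add)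
  have "p ^ n dvd p ^ b * (2 * ?T + v1 * (r' - r)) - p ^ b * (2 * ?T + v1 * (r'' - r))"
    using 1 2 by (rule dvd_diff)
  also have "\<dots> = (v1 * p ^ (b + d)) * (p ^ (b - d) * u - w)"
    unfolding e(1) d(1) \<open>e = b\<close> power_add
    by (simp add: bd algebra_simps)
  finally have "p ^ n dvd (v1 * p ^ (b + d)) * (p ^ (b - d) * u - w)" .
  moreover have "\<not> p dvd p ^ (b - d) * u - w"
  proof
    assume "p dvd p ^ (b - d) * u - w"
    moreover have "p dvd p ^ (b - d) * u" using d(3) by (simp add: dvd_power)
    ultimately have "p dvd p ^ (b - d) * u - (p ^ (b - d) * u - w)" by (rule dvd_diff[rotated])
    then show False using d(2) by simp
  qed
  ultimately have "p ^ n dvd v1 * p ^ (b + d)" by (rule prime_pow_dvd_cancel[OF p(1), rotated])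
  then have "p ^ n dvd v1 * p ^ (b + d) * p ^ (b - d)" by (rule dvd_mult2)
  then show v1: "p ^ n dvd v1 * p ^ (2 * b)"
    using d(3) by (simp add: mult.assoc mult_2 flip: power_add)
  have "p ^ n dvd p ^ b * (2 * ?T + v1 * (r' - r)) - v1 * p ^ (2 * b) * u"
    by (rule dvd_diff[OF 1 dvd_mult2[OF v1]])
  also have "\<dots> = (?T * p ^ b) * 2"
    unfolding e(1) \<open>e = b\<close> power_even_eq by algebra
  finally show "p ^ n dvd ?T * p ^ b" by (rule prime_pow_dvd_cancel[OF p(1) p2])
qed

text \<open>Translate \<open>r1\<close> to 0, divide the parameters by \<open>p ^ k\<close> and
  replace all heights by \<open>s1\<close>, an error modulo \<open>p ^ (2 * m)\<close>. What remains
  is \<open>b2 = b3 + b4\<close> and \<open>b2\<^sup>2 = b3\<^sup>2 + b4\<^sup>2\<close> modulo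
  \<open>p ^ (2 * m)\<close>, so \<open>2 * b3 * b4\<close> vanishes there and \<open>p ^ m\<close>
  divides \<open>b3\<close> or \<open>b4\<close>. Dividing the quadratic relation by
  \<open>p ^ (2 * k)\<close> leaves the precision \<open>n - 2 * k\<close>, whence the assumption on
  \<open>n\<close>.\<close>

lemma parabola_pairs:
  fixes p :: int
  assumes p: "prime p" "p > 2"
    and sum0: "dvd3 (p ^ n) (cone_pt (s1, r1) + cone_pt (s2, r2) - (cone_pt (s3, r3) + cone_pt (s4, r4)))"
    and s1: "\<not> p dvd s1"
    and s: "p ^ (2 * m) dvd s2 - s1" "p ^ (2 * m) dvd s3 - s1" "p ^ (2 * m) dvd s4 - s1"
    and r: "p ^ k dvd r2 - r1" "p ^ k dvd r3 - r1" "p ^ k dvd r4 - r1"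
    and n: "2 * (k + m) \<le> n"
  shows "p ^ (k + m) dvd r1 - r3 \<and> p ^ (k + m) dvd r2 - r4 \<or> p ^ (k + m) dvd r1 - r4 \<and> p ^ (k + m) dvd r2 - r3"
proof -
  have p2: "\<not> p dvd 2" using p by (auto dest: zdvd_imp_le)
  obtain a2 a3 a4 where a: "s2 = s1 + p ^ (2 * m) * a2" "s3 = s1 + p ^ (2 * m) * a3" "s4 = s1 + p ^ (2 * m) * a4"
    using s by (metis dvdE diff_eq_eq add.commute)
  obtain b2 b3 b4 where b: "r2 = r1 + p ^ k * b2" "r3 = r1 + p ^ k * b3" "r4 = r1 + p ^ k * b4"
    using r by (metis dvdE diff_eq_eq add.commute)
  have E: "p ^ n dvd s1 + s2 - (s3 + s4)" "p ^ n dvd s1 * r1 + s2 * r2 - (s3 * r3 + s4 * r4)"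
      "p ^ n dvd s1 * r1\<^sup>2 + s2 * r2\<^sup>2 - (s3 * r3\<^sup>2 + s4 * r4\<^sup>2)"
    using sum0 by auto
  have "p ^ n dvd (s1 * r1 + s2 * r2 - (s3 * r3 + s4 * r4)) - r1 * (s1 + s2 - (s3 + s4))"
    using dvd_diff[OF E(2) dvd_mult[OF E(1)]] .
  also have "\<dots> = p ^ k * (s2 * b2 - s3 * b3 - s4 * b4)"
    unfolding b by (simp add: algebra_simps)
  finally have "p ^ (n - k) dvd s2 * b2 - s3 * b3 - s4 * b4"
    by (rule prime_pow_dvd_mult_cancel[OF p(1)])
  then have F1: "p ^ (2 * m) dvd s2 * b2 - s3 * b3 - s4 * b4"
    by (rule dvd_trans[OF le_imp_power_dvd, rotated]) (use n in simp)
  have "p ^ n dvd (s1 * r1\<^sup>2 + s2 * r2\<^sup>2 - (s3 * r3\<^sup>2 + s4 * r4\<^sup>2))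
      - 2 * r1 * (s1 * r1 + s2 * r2 - (s3 * r3 + s4 * r4)) + r1\<^sup>2 * (s1 + s2 - (s3 + s4))"
    using dvd_add[OF dvd_diff[OF E(3) dvd_mult[OF E(2)]] dvd_mult[OF E(1)]] .
  also have "\<dots> = p ^ (2 * k) * (s2 * b2\<^sup>2 - s3 * b3\<^sup>2 - s4 * b4\<^sup>2)"
    unfolding b power_even_eq by algebra
  finally have "p ^ (n - 2 * k) dvd s2 * b2\<^sup>2 - s3 * b3\<^sup>2 - s4 * b4\<^sup>2"
    by (rule prime_pow_dvd_mult_cancel[OF p(1)])
  then have F2: "p ^ (2 * m) dvd s2 * b2\<^sup>2 - s3 * b3\<^sup>2 - s4 * b4\<^sup>2"
    by (rule dvd_trans[OF le_imp_power_dvd, rotated]) (use n in simp)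
  have "p ^ (2 * m) dvd (s2 * b2 - s3 * b3 - s4 * b4) - p ^ (2 * m) * (a2 * b2 - a3 * b3 - a4 * b4)"
    by (rule dvd_diff[OF F1]) simp
  also have "\<dots> = (b2 - b3 - b4) * s1" unfolding a by (simp add: algebra_simps)
  finally have S: "p ^ (2 * m) dvd b2 - b3 - b4" by (rule prime_pow_dvd_cancel[OF p(1) s1])
  have "p ^ (2 * m) dvd (s2 * b2\<^sup>2 - s3 * b3\<^sup>2 - s4 * b4\<^sup>2) - p ^ (2 * m) * (a2 * b2\<^sup>2 - a3 * b3\<^sup>2 - a4 * b4\<^sup>2)"
    by (rule dvd_diff[OF F2]) simp
  also have "\<dots> = (b2\<^sup>2 - b3\<^sup>2 - b4\<^sup>2) * s1" unfolding a by (simp add: algebra_simps)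
  finally have S2: "p ^ (2 * m) dvd b2\<^sup>2 - b3\<^sup>2 - b4\<^sup>2" by (rule prime_pow_dvd_cancel[OF p(1) s1])
  have "p ^ (2 * m) dvd (b2\<^sup>2 - b3\<^sup>2 - b4\<^sup>2) - (b2 - b3 - b4) * (b2 + b3 + b4)"
    by (rule dvd_diff[OF S2 dvd_mult2[OF S]])
  also have "\<dots> = (b3 * b4) * 2" by (simp add: algebra_simps power2_eq_square)
  finally have "p ^ (2 * m) dvd b3 * b4" by (rule prime_pow_dvd_cancel[OF p(1) p2])
  then have "p ^ m dvd b3 \<or> p ^ m dvd b4" by (rule prime_pow_dvd_prod[OF p(1)])
  moreover have S': "p ^ m dvd b2 - b3 - b4" by (rule dvd_trans[OF le_imp_power_dvd S]) simp
  have *: "p ^ (k + m) dvd p ^ k * z" if "p ^ m dvd z" for z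
    using that by (simp add: power_add)
  have "p ^ (k + m) dvd r1 - r3 \<and> p ^ (k + m) dvd r2 - r4" if "p ^ m dvd b3"
  proof -
    have "p ^ m dvd b2 - b4" using dvd_add[OF S' that] by simp
    then show ?thesis using *[of "- b3"] *[of "b2 - b4"] that by (simp add: b right_diff_distrib)
  qed
  moreover have "p ^ (k + m) dvd r1 - r4 \<and> p ^ (k + m) dvd r2 - r3" if "p ^ m dvd b4"
  proof -
    have "p ^ m dvd b2 - b3" using dvd_add[OF S' that] by simp
    then show ?thesis using *[of "- b4"] *[of "b2 - b3"] that by (simp add: b right_diff_distrib)
  qed
  ultimately show ?thesis by blast
qed

section \<open>The fourth moment of exponential sums on the cone\<close>

lemma card_residues:
  fixes p c :: int
  assumes "p > 0" "k \<le> n" "0 \<le> c" "c < p ^ k"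
  shows "real (card {r\<in>{0..<p ^ n}. r mod p ^ k = c}) = of_int p ^ (n - k)"
proof -
  have pk: "p ^ k > 0" using assms by simp
  have pn: "p ^ n = p ^ k * p ^ (n - k)" using assms(2) by (simp flip: power_add)
  have "{r\<in>{0..<p ^ n}. r mod p ^ k = c} = (\<lambda>t. c + p ^ k * t) ` {0..<p ^ (n - k)}"
  proof (intro equalityI subsetI)
    fix r assume "r \<in> {r\<in>{0..<p ^ n}. r mod p ^ k = c}"
    then have r: "0 \<le> r" "r < p ^ n" "r mod p ^ k = c" by auto
    have "r = c + p ^ k * (r div p ^ k)" using r(3) by (metis add.commute mult_div_mod_eq)
    moreover have "0 \<le> r div p ^ k" using r pk by (simp add: pos_imp_zdiv_nonneg_iff)
    moreover have "r div p ^ k < p ^ (n - k)"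
    proof -
      have "p ^ k * (r div p ^ k) \<le> r" using pk by (simp add: minus_mod_eq_mult_div[symmetric])
      also have "r < p ^ k * p ^ (n - k)" using r(2) by (simp only: pn)
      finally show ?thesis using pk by simp
    qed
    ultimately show "r \<in> (\<lambda>t. c + p ^ k * t) ` {0..<p ^ (n - k)}" by auto
  next
    fix r assume "r \<in> (\<lambda>t. c + p ^ k * t) ` {0..<p ^ (n - k)}"
    then obtain t where "r = c + p ^ k * t" "t \<in> {0..<p ^ (n - k)}" by (rule imageE)
    then have t: "r = c + p ^ k * t" "0 \<le> t" "t < p ^ (n - k)" by simp_all
    have "p ^ k * (t + 1) \<le> p ^ n" unfolding pn using t(3) pk by (intro mult_left_mono) auto
    then have "r < p ^ n" using t(1) assms(4) by (simp add: distrib_left)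
    then show "r \<in> {r\<in>{0..<p ^ n}. r mod p ^ k = c}" using t assms by simp
  qed
  moreover have "inj_on (\<lambda>t. c + p ^ k * t) {0..<p ^ (n - k)}"
    using assms(1) by (auto simp: inj_on_def)
  ultimately show ?thesis using assms(1) by (simp add: card_image)
qed

lemma sum_residue_classes:
  fixes p :: int
  assumes "p > 0" "j \<le> l"
  shows "(\<Sum>c\<in>{0..<p ^ j}. \<Sum>c'\<in>{c'\<in>{0..<p ^ l}. c' mod p ^ j = c}. f c') = (\<Sum>c'\<in>{0..<p ^ l}. f c')"
  using assms by (intro sum.group) auto

lemma mod_prime_pow_mod [simp]:
  fixes x p :: int
  assumes "k \<le> l"
  shows "x mod p ^ l mod p ^ k = x mod p ^ k"
  using assms by (simp add: mod_mod_cancel le_imp_power_dvd)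

text \<open>
  Freezing the height \<open>s\<close> modulo \<open>p\<^sup>2\<^sup>m\<close> makes the cone look like a parabola times a line over \<open>m\<close> scales
  of \<open>r\<close>; there the \<open>L\<^sup>4\<close> square function estimate is the elementary \<open>parabola_pairs\<close>.
\<close>

locale cone_sum =
  fixes p :: int and n m :: nat and X :: "(int \<times> int) set" and a :: "int \<times> int \<Rightarrow> complex"
  assumes prime_p: "prime p" and p_gt_2: "p > 2"
    and finite_X: "finite X"
    and unit: "x \<in> X \<Longrightarrow> \<not> p dvd fst x"
    and same_class: "x \<in> X \<Longrightarrow> y \<in> X \<Longrightarrow> p ^ (2 * m) dvd fst x - fst y"
    and in_range: "x \<in> X \<Longrightarrow> 0 \<le> fst x \<and> fst x < p ^ n \<and> 0 \<le> snd x \<and> snd x < p ^ n"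
    and ray_bound: "cmod (exp_sum (p ^ n) a {x\<in>X. snd x = r} w) \<le> 1"
begin

abbreviation N :: int where "N \<equiv> p ^ n"
abbreviation G :: "(int \<times> int) set \<Rightarrow> int3 \<Rightarrow> complex" where "G \<equiv> exp_sum N a"
abbreviation A :: "(int \<times> int) set \<Rightarrow> int3 \<Rightarrow> complex" where "A \<equiv> acorr N a"
abbreviation rep :: "int3 \<Rightarrow> int \<times> int \<Rightarrow> int \<times> int \<Rightarrow> bool" where
  "rep v x y \<equiv> dvd3 N (cone_pt x - cone_pt y - v)"

definition sector :: "nat \<Rightarrow> int \<Rightarrow> (int \<times> int) set" where
  "sector k c = {x\<in>X. snd x mod p ^ k = c}"

definition subsectors :: "nat \<Rightarrow> nat \<Rightarrow> int \<Rightarrow> int set" where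
  "subsectors l k c = {c'\<in>{0..<p ^ l}. c' mod p ^ k = c}"

definition mass :: "(int \<times> int) set \<Rightarrow> real" where
  "mass I = (\<Sum>x\<in>I. (cmod (a x))\<^sup>2)"

lemma p_pos: "p > 0" and N_pos: "N > 0" and pow_pos: "p ^ k > 0"
  using p_gt_2 by auto

lemma real_p_ge_1: "real_of_int p \<ge> 1"
  using p_gt_2 by simp

lemma finite_sector [simp]: "finite (sector k c)" and finite_subsectors [simp]: "finite (subsectors l k c)"
  using finite_X by (auto simp: sector_def subsectors_def intro: finite_subset[of _ "{0..<p ^ l}"])

lemma sector_subset: "sector k c \<subseteq> X"
  by (auto simp: sector_def)

lemma sector_0: "sector 0 0 = X"
  by (auto simp: sector_def)

lemma sector_split:
  assumes "k \<le> l"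
  shows "sector k c = (\<Union>c'\<in>subsectors l k c. sector l c')"
proof (intro equalityI subsetI)
  fix x assume x: "x \<in> sector k c"
  then have "snd x mod p ^ l \<in> subsectors l k c"
    using assms pow_pos[of l] by (auto simp: subsectors_def sector_def)
  then show "x \<in> (\<Union>c'\<in>subsectors l k c. sector l c')" using x by (auto simp: sector_def)
next
  fix x assume "x \<in> (\<Union>c'\<in>subsectors l k c. sector l c')"
  then show "x \<in> sector k c" using assms by (auto simp: sector_def subsectors_def)
qed

lemma sum_sector_split:
  assumes "k \<le> l"
  shows "(\<Sum>x\<in>sector k c. f x) = (\<Sum>c'\<in>subsectors l k c. \<Sum>x\<in>sector l c'. f x)"
  unfolding sector_split[OF assms] by (intro sum.UNION_disjoint) (auto simp: sector_def finite_X)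

lemma sum_sector_pairs_split:
  fixes h :: "int \<times> int \<Rightarrow> int \<times> int \<Rightarrow> complex"
  assumes "k \<le> l"
    and "\<And>x y. x \<in> sector k c \<Longrightarrow> y \<in> sector k c \<Longrightarrow> h x y \<noteq> 0 \<Longrightarrow> p ^ l dvd snd x - snd y"
  shows "(\<Sum>(x, y)\<in>sector k c \<times> sector k c. h x y) = (\<Sum>c'\<in>subsectors l k c. \<Sum>(x, y)\<in>sector l c' \<times> sector l c'. h x y)"
proof -
  have "(\<Sum>(x, y)\<in>sector k c \<times> sector k c. h x y)
      = (\<Sum>c'\<in>subsectors l k c. \<Sum>x\<in>sector l c'. \<Sum>y\<in>sector k c. h x y)"
    by (simp add: sum.cartesian_product[symmetric] sum_sector_split[OF assms(1), where c = c, symmetric])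
  also have "\<dots> = (\<Sum>c'\<in>subsectors l k c. \<Sum>x\<in>sector l c'. \<Sum>y\<in>sector l c'. h x y)"
  proof (rule sum.cong[OF refl], rule sum.cong[OF refl], rule sum.mono_neutral_right)
    fix c' x assume c': "c' \<in> subsectors l k c" and x: "x \<in> sector l c'"
    show sub: "sector l c' \<subseteq> sector k c" using c' by (auto simp: sector_split[OF assms(1), of c])
    show "\<forall>y\<in>sector k c - sector l c'. h x y = 0"
    proof (intro ballI, rule ccontr)
      fix y assume y: "y \<in> sector k c - sector l c'"
      assume "h x y \<noteq> 0"
      then have "p ^ l dvd snd x - snd y" using assms(2) x y sub by blast
      then show False using x y by (auto simp: sector_def mod_eq_dvd_iff[symmetric])
    qed
  qed simp
  finally show ?thesis by (simp add: sum.cartesian_product)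
qed

lemma G_sector_split: "k \<le> l \<Longrightarrow> G (sector k c) w = (\<Sum>c'\<in>subsectors l k c. G (sector l c') w)"
  unfolding exp_sum_def by (rule sum_sector_split)

lemma mass_sector_sum: "(\<Sum>c\<in>{0..<p ^ k}. mass (sector k c)) = mass X"
proof -
  have "(\<Sum>c'\<in>subsectors k 0 0. mass (sector k c')) = mass (sector 0 0)"
    unfolding mass_def by (rule sum_sector_split[symmetric]) simp
  moreover have "subsectors k 0 0 = {0..<p ^ k}" by (auto simp: subsectors_def)
  ultimately show ?thesis by (simp add: sector_0)
qed

lemma mass_nonneg: "mass I \<ge> 0"
  unfolding mass_def by (intro sum_nonneg) simp

lemma card_subsectors: "k \<le> l \<Longrightarrow> 0 \<le> c \<Longrightarrow> c < p ^ k \<Longrightarrow> real (card (subsectors l k c)) = of_int p ^ (l - k)"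
  unfolding subsectors_def by (rule card_residues[OF p_pos])

lemma G_sector_bound:
  assumes "k \<le> n" "0 \<le> c" "c < p ^ k"
  shows "cmod (G (sector k c) w) \<le> of_int p ^ (n - k)"
proof -
  have "sector n c' = {x\<in>X. snd x = c'}" for c'
    using in_range by (auto simp: sector_def)
  then have "cmod (G (sector k c) w) \<le> (\<Sum>c'\<in>subsectors n k c. 1)"
    unfolding G_sector_split[OF assms(1)] by (intro sum_norm_le) (simp add: ray_bound)
  then show ?thesis by (simp add: card_subsectors[OF assms])
qed

lemma cone_pt_inj:
  assumes "x \<in> X" "y \<in> X" "dvd3 N (cone_pt x - cone_pt y)"
  shows "x = y"
proof -
  obtain s r t q where x: "x = (s, r)" "y = (t, q)" by (metis surj_pair)
  have "N dvd s - t" using assms(3) x by simp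
  then have st: "s = t" using in_range[OF assms(1)] in_range[OF assms(2)] x
    by (simp add: mod_eq_dvd_iff[symmetric])
  have "N dvd (r - q) * s" using assms(3) x st by (simp add: algebra_simps)
  moreover have "\<not> p dvd s" using unit[OF assms(1)] x by simp
  ultimately have "N dvd r - q" by (rule prime_pow_dvd_cancel[OF prime_p, rotated])
  then have "r = q" using in_range[OF assms(1)] in_range[OF assms(2)] x
    by (simp add: mod_eq_dvd_iff[symmetric])
  with st x show ?thesis by simp
qed

lemma moment2:
  assumes "I \<subseteq> X"
  shows "(\<Sum>w\<in>cube N. (cmod (G I w))\<^sup>2) = of_int N ^ 3 * mass I"
proof -
  have fin: "finite I" using assms finite_X finite_subset by blast
  have "complex_of_real (\<Sum>w\<in>cube N. (cmod (G I w))\<^sup>2)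
    = (\<Sum>w\<in>cube N. \<Sum>(x, y)\<in>I \<times> I. a x * cnj (a y) * e_mod N (dot3 (cone_pt x - cone_pt y) w))"
    by (simp only: of_real_sum complex_norm_square exp_sum_mult_cnj)
  also have "\<dots> = (\<Sum>(x, y)\<in>I \<times> I. a x * cnj (a y) * (\<Sum>w\<in>cube N. e_mod N (dot3 (cone_pt x - cone_pt y) w)))"
    unfolding split_def sum_distrib_left by (rule sum.swap)
  also have "\<dots> = (\<Sum>(x, y)\<in>I \<times> I. if x = y then a x * cnj (a y) * of_int N ^ 3 else 0)"
  proof (intro sum.cong refl)
    fix z assume "z \<in> I \<times> I"
    then obtain x y where "z = (x, y)" "x \<in> X" "y \<in> X" using assms by blast
    then show "(case z of (x, y) \<Rightarrow> a x * cnj (a y) * (\<Sum>w\<in>cube N. e_mod N (dot3 (cone_pt x - cone_pt y) w)))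
      = (case z of (x, y) \<Rightarrow> if x = y then a x * cnj (a y) * of_int N ^ 3 else 0)"
      using cone_pt_inj[of x y] by (auto simp: sum_cube_e_mod[OF N_pos] zero_prod_def)
  qed
  also have "\<dots> = (\<Sum>x\<in>I. a x * cnj (a x) * of_int N ^ 3)"
    using fin by (simp add: sum.cartesian_product[symmetric])
  also have "\<dots> = complex_of_real (of_int N ^ 3 * mass I)"
  proof -
    have "complex_of_real (mass I) = (\<Sum>x\<in>I. a x * cnj (a x))"
      by (simp only: mass_def of_real_sum complex_norm_square)
    then show ?thesis by (simp add: sum_distrib_right[symmetric] mult.commute)
  qed
  finally show ?thesis by (simp only: of_real_eq_iff)
qed

definition fourth :: "nat \<Rightarrow> real" where
  "fourth k = (\<Sum>c\<in>{0..<p ^ k}. \<Sum>w\<in>cube N. cmod (G (sector k c) w) ^ 4)"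

lemma fourth_acorr: "fourth k = of_int N ^ 3 * (\<Sum>v\<in>cube N. \<Sum>c\<in>{0..<p ^ k}. (cmod (A (sector k c) v))\<^sup>2)"
  unfolding fourth_def moment4[OF N_pos] sum_distrib_left by (rule sum.swap)

text \<open>Two of the four factors are estimated by the supremum, the other two by Parseval. This
  starts the induction, at the scales with \<open>2 * (k + m) > n\<close>.\<close>

lemma fourth_trivial:
  assumes "k \<le> n"
  shows "fourth k \<le> of_int p ^ (2 * (n - k)) * (of_int N ^ 3 * mass X)"
proof -
  have "fourth k \<le> (\<Sum>c\<in>{0..<p ^ k}. \<Sum>w\<in>cube N. of_int p ^ (2 * (n - k)) * (cmod (G (sector k c) w))\<^sup>2)"
    unfolding fourth_def
  proof (intro sum_mono)
    fix c w assume "c \<in> {0..<p ^ k}"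
    then have "(cmod (G (sector k c) w))\<^sup>2 \<le> (of_int p ^ (n - k))\<^sup>2"
      using G_sector_bound[OF assms] by (intro power_mono) auto
    then have "(cmod (G (sector k c) w))\<^sup>2 * (cmod (G (sector k c) w))\<^sup>2
        \<le> (of_int p ^ (n - k))\<^sup>2 * (cmod (G (sector k c) w))\<^sup>2"
      by (intro mult_right_mono) auto
    then show "cmod (G (sector k c) w) ^ 4 \<le> of_int p ^ (2 * (n - k)) * (cmod (G (sector k c) w))\<^sup>2"
      unfolding power_even_eq using power_add[of "cmod (G (sector k c) w)" 2 2] by simp
  qed
  also have "\<dots> = (\<Sum>c\<in>{0..<p ^ k}. of_int p ^ (2 * (n - k)) * (of_int N ^ 3 * mass (sector k c)))"
    by (simp only: sum_distrib_left[symmetric] moment2[OF sector_subset])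
  also have "\<dots> = of_int p ^ (2 * (n - k)) * (of_int N ^ 3 * mass X)"
    by (simp only: sum_distrib_left[symmetric] mass_sector_sum)
  finally show ?thesis .
qed

text \<open>Expand the fourth power over quadruples of subsectors. By \<open>parabola_pairs\<close>
  only those with \<open>(c3, c4)\<close> equal to \<open>(c1, c2)\<close> or
  \<open>(c2, c1)\<close> survive; the two pairings give the factor 2.\<close>

lemma parabola_step_sector:
  assumes "2 * (k + m) \<le> n"
  defines "j \<equiv> k + m"
  shows "(\<Sum>w\<in>cube N. cmod (G (sector k c) w) ^ 4)
    \<le> 2 * (\<Sum>c1\<in>subsectors j k c. \<Sum>c2\<in>subsectors j k c.
        \<Sum>w\<in>cube N. (cmod (G (sector j c1) w))\<^sup>2 * (cmod (G (sector j c2) w))\<^sup>2)"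
proof -
  let ?K = "subsectors j k c" and ?g = "\<lambda>c. G (sector j c)"
  define T where "T c1 c2 c3 c4 = (\<Sum>w\<in>cube N. ?g c1 w * ?g c2 w * cnj (?g c3 w * ?g c4 w))" for c1 c2 c3 c4
  define S where "S c1 c2 = (\<Sum>w\<in>cube N. (cmod (?g c1 w))\<^sup>2 * (cmod (?g c2 w))\<^sup>2)" for c1 c2
  have kj: "k \<le> j" by (simp add: j_def)
  have "complex_of_real (\<Sum>w\<in>cube N. cmod (G (sector k c) w) ^ 4)
      = (\<Sum>w\<in>cube N. G (sector k c) w * G (sector k c) w * cnj (G (sector k c) w * G (sector k c) w))"
  proof -
    have "complex_of_real (cmod z ^ 4) = z * z * cnj (z * z)" for z
      using complex_norm_square[of "z * z"] by (simp add: norm_mult power_mult_distrib flip: power_add)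
    then show ?thesis by simp
  qed
  also have "\<dots> = (\<Sum>w\<in>cube N. \<Sum>c1\<in>?K. \<Sum>c2\<in>?K. \<Sum>c3\<in>?K. \<Sum>c4\<in>?K.
      ?g c1 w * ?g c2 w * cnj (?g c3 w * ?g c4 w))"
  proof -
    have "(\<Sum>c\<in>?K. f c) * (\<Sum>c\<in>?K. f c) * cnj ((\<Sum>c\<in>?K. f c) * (\<Sum>c\<in>?K. f c))
        = (\<Sum>c1\<in>?K. \<Sum>c2\<in>?K. \<Sum>c3\<in>?K. \<Sum>c4\<in>?K. f c1 * f c2 * cnj (f c3 * f c4))" for f
    proof -
      have 1: "(\<Sum>c\<in>?K. f c) * (\<Sum>c\<in>?K. f c) * z = (\<Sum>c1\<in>?K. \<Sum>c2\<in>?K. f c1 * f c2 * z)" for z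
        unfolding sum_product unfolding sum_distrib_right ..
      have 2: "z * cnj ((\<Sum>c\<in>?K. f c) * (\<Sum>c\<in>?K. f c)) = (\<Sum>c3\<in>?K. \<Sum>c4\<in>?K. z * cnj (f c3 * f c4))" for z
        unfolding sum_product unfolding cnj_sum sum_distrib_left ..
      show ?thesis by (subst 1) (simp only: 2)
    qed
    then show ?thesis by (simp only: G_sector_split[OF kj, of c])
  qed
  also have "\<dots> = (\<Sum>c1\<in>?K. \<Sum>c2\<in>?K. \<Sum>c3\<in>?K. \<Sum>c4\<in>?K. T c1 c2 c3 c4)"
    unfolding T_def
    by (subst sum.swap, rule sum.cong[OF refl], subst sum.swap, rule sum.cong[OF refl],
        subst sum.swap, rule sum.cong[OF refl], rule sum.swap)
  finally have "(\<Sum>w\<in>cube N. cmod (G (sector k c) w) ^ 4)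
      = cmod (\<Sum>c1\<in>?K. \<Sum>c2\<in>?K. \<Sum>c3\<in>?K. \<Sum>c4\<in>?K. T c1 c2 c3 c4)"
    using norm_of_real[where 'a = complex, of "\<Sum>w\<in>cube N. cmod (G (sector k c) w) ^ 4"]
    by (simp only:) (simp add: sum_nonneg)
  \<comment> \<open>One summand per pairing; for \<open>c1 = c2\<close> both are present, which only
    enlarges the bound. The nested conditions let the sums over \<open>c4\<close> and
    \<open>c3\<close> collapse.\<close>
  also have "\<dots> \<le> (\<Sum>c1\<in>?K. \<Sum>c2\<in>?K. \<Sum>c3\<in>?K. \<Sum>c4\<in>?K.
      (if c4 = c2 then if c3 = c1 then S c1 c2 else 0 else 0) + (if c4 = c1 then if c3 = c2 then S c1 c2 else 0 else 0))"
  proof (intro sum_norm_le)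
    fix c1 c2 c3 c4 assume K: "c1 \<in> ?K" "c2 \<in> ?K" "c3 \<in> ?K" "c4 \<in> ?K"
    have S0: "S c1 c2 \<ge> 0" unfolding S_def by (intro sum_nonneg) simp
    show "cmod (T c1 c2 c3 c4) \<le> (if c4 = c2 then if c3 = c1 then S c1 c2 else 0 else 0)
        + (if c4 = c1 then if c3 = c2 then S c1 c2 else 0 else 0)"
    proof (cases "c3 = c1 \<and> c4 = c2 \<or> c4 = c1 \<and> c3 = c2")
      case True
      then have "cmod (T c1 c2 c3 c4) \<le> S c1 c2"
        unfolding T_def S_def
        by (intro sum_norm_le) (auto simp: norm_mult power2_eq_square)
      then show ?thesis using True S0 by auto
    next
      case False
      have "T c1 c2 c3 c4 = 0"
        unfolding T_def
      proof (rule exp_sum_four_eq_0[OF N_pos], rule notI)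
        fix x1 x2 x3 x4
        assume x: "x1 \<in> sector j c1" "x2 \<in> sector j c2" "x3 \<in> sector j c3" "x4 \<in> sector j c4"
          and eq: "dvd3 N (cone_pt x1 + cone_pt x2 - (cone_pt x3 + cone_pt x4))"
        have X: "x1 \<in> X" "x2 \<in> X" "x3 \<in> X" "x4 \<in> X" using x by (auto simp: sector_def)
        have "x1 \<in> sector k c" "x2 \<in> sector k c" "x3 \<in> sector k c" "x4 \<in> sector k c"
          using x K by (auto simp: sector_split[OF kj, of c])
        then have r: "p ^ k dvd snd x2 - snd x1" "p ^ k dvd snd x3 - snd x1" "p ^ k dvd snd x4 - snd x1"
          by (auto simp: sector_def mod_eq_dvd_iff[symmetric])
        have "p ^ (k + m) dvd snd x1 - snd x3 \<and> p ^ (k + m) dvd snd x2 - snd x4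
            \<or> p ^ (k + m) dvd snd x1 - snd x4 \<and> p ^ (k + m) dvd snd x2 - snd x3"
          by (rule parabola_pairs[OF prime_p p_gt_2 _ unit[OF X(1)] same_class[OF X(2,1)]
                same_class[OF X(3,1)] same_class[OF X(4,1)] r assms(1)]) (simp add: eq)
        then show False using False x by (auto simp: sector_def j_def mod_eq_dvd_iff[symmetric])
      qed
      then show ?thesis using S0 by simp
    qed
  qed
  also have "\<dots> = 2 * (\<Sum>c1\<in>?K. \<Sum>c2\<in>?K. S c1 c2)"
    by (simp add: sum.distrib sum_distrib_left)
  finally show ?thesis unfolding S_def .
qed

end

text \<open>The valuation of a square is even, so an odd lower bound \<open>n\<close> improves to
  \<open>n + 1\<close>; hence \<open>Suc n\<close>.\<close>

lemma prime_pow_dvd_square: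
  fixes p z :: int
  assumes "prime p" "p ^ n dvd z\<^sup>2" "2 * l \<le> Suc n"
  shows "p ^ l dvd z"
proof (rule ccontr)
  assume "\<not> p ^ l dvd z"
  then obtain e u where e: "z = p ^ e * u" "\<not> p dvd u" "e < l"
    by (rule prime_pow_decompose[OF assms(1)])
  have "p ^ n dvd p ^ (2 * e) * u\<^sup>2"
    using assms(2) by (simp only: e(1) power_mult_distrib power_even_eq)
  moreover have "\<not> p dvd u\<^sup>2" using e(2) assms(1) prime_dvd_power by blast
  ultimately have "n \<le> 2 * e" using prime_pow_dvd_iff[OF assms(1)] by blast
  then show False using e(3) assms(3) by linarith
qed

lemma prime_pow_same_val:
  fixes p :: int
  assumes p: "prime p" and "\<not> p dvd \<alpha>" "\<not> p dvd \<beta>" "2 * l < n"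
    and dvd: "p ^ n dvd \<alpha> * p ^ (2 * l) - \<beta> * z\<^sup>2"
  shows "p ^ l dvd z" "\<not> p ^ Suc l dvd z"
proof -
  have "p ^ (2 * l) dvd \<alpha> * p ^ (2 * l) - (\<alpha> * p ^ (2 * l) - \<beta> * z\<^sup>2)"
    by (rule dvd_diff[OF _ dvd_trans[OF le_imp_power_dvd dvd]]) (use assms(4) in auto)
  then have "p ^ (2 * l) dvd z\<^sup>2 * \<beta>" by (simp add: mult.commute)
  then have "p ^ (2 * l) dvd z\<^sup>2" by (rule prime_pow_dvd_cancel[OF p assms(3)])
  then show "p ^ l dvd z" by (rule prime_pow_dvd_square[OF p]) simp
  show "\<not> p ^ Suc l dvd z"
  proof
    assume "p ^ Suc l dvd z"
    then have "(p ^ Suc l)\<^sup>2 dvd z\<^sup>2" by (rule dvd_power_same)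
    then have "p ^ Suc (2 * l) dvd z\<^sup>2"
      by (rule dvd_trans[rotated], subst power_even_eq[symmetric], intro le_imp_power_dvd) simp
    moreover have "p ^ Suc (2 * l) dvd \<alpha> * p ^ (2 * l) - \<beta> * z\<^sup>2"
      by (rule dvd_trans[OF le_imp_power_dvd dvd]) (use assms(4) in simp)
    ultimately have "p ^ Suc (2 * l) dvd (\<alpha> * p ^ (2 * l) - \<beta> * z\<^sup>2) + \<beta> * z\<^sup>2"
      by (intro dvd_add dvd_mult)
    then have "p ^ Suc (2 * l) dvd p ^ (2 * l) * \<alpha>" by (simp add: mult.commute)
    then have "Suc (2 * l) \<le> 2 * l" using prime_pow_dvd_iff[OF p assms(2)] by blast
    then show False by simp
  qed
qed

lemma card_le_2I:
  assumes "finite S" "\<And>x y z. x \<in> S \<Longrightarrow> y \<in> S \<Longrightarrow> z \<in> S \<Longrightarrow> x \<noteq> y \<Longrightarrow> x \<noteq> z \<Longrightarrow> y = z"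
  shows "card S \<le> 2"
proof (rule ccontr)
  assume "\<not> card S \<le> 2"
  then obtain T where "T \<subseteq> S" "card T = 3"
    using obtain_subset_with_card_n[of 3 S] by auto
  then obtain x y z where "{x, y, z} \<subseteq> S" "x \<noteq> y" "x \<noteq> z" "y \<noteq> z"
    unfolding card_3_iff by blast
  then show False using assms(2)[of x y z] by simp
qed

section \<open>Frequencies off and on the light cone\<close>

context cone_sum
begin

fun disc :: "int3 \<Rightarrow> int" where
  "disc (v1, v2, v3) = v1 * v3 - v2\<^sup>2"

lemma rep_facts:
  assumes "x \<in> X" "y \<in> X" "rep v x y"
  shows "N dvd quad v (snd x) + fst y * (snd x - snd y)\<^sup>2"
    and "N dvd (fst v * snd x - fst (snd v)) + fst y * (snd x - snd y)"
    and "N dvd disc v + fst x * fst y * (snd x - snd y)\<^sup>2"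
proof -
  obtain s r t q v1 v2 v3 where "x = (s, r)" "y = (t, q)" "v = (v1, v2, v3)" by (metis surj_pair)
  with assms(3) cone_diff_facts[of N s r t q v1 v2 v3]
  show "N dvd quad v (snd x) + fst y * (snd x - snd y)\<^sup>2"
    and "N dvd (fst v * snd x - fst (snd v)) + fst y * (snd x - snd y)"
    and "N dvd disc v + fst x * fst y * (snd x - snd y)\<^sup>2"
    by simp_all
qed

lemma acorr_nonzero_obtains:
  assumes "A I v \<noteq> 0"
  obtains x y where "x \<in> I" "y \<in> I" "rep v x y"
proof -
  have "\<exists>z\<in>I \<times> I. (case z of (x, y) \<Rightarrow> if rep v x y then a x * cnj (a y) else 0) \<noteq> 0"
    using assms unfolding acorr_def by (meson sum.neutral)
  then show ?thesis using that by (auto split: if_splits)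
qed

lemma acorr_split:
  assumes "k \<le> l"
    and "\<And>x y. x \<in> sector k c \<Longrightarrow> y \<in> sector k c \<Longrightarrow> rep v x y \<Longrightarrow> p ^ l dvd snd x - snd y"
  shows "A (sector k c) v = (\<Sum>c'\<in>subsectors l k c. A (sector l c') v)"
  unfolding acorr_def using assms by (intro sum_sector_pairs_split) (auto split: if_splits)

lemma sum_subsectors:
  "j \<le> l \<Longrightarrow> (\<Sum>c\<in>{0..<p ^ j}. \<Sum>c'\<in>subsectors l j c. f c') = (\<Sum>c'\<in>{0..<p ^ l}. f c')"
  unfolding subsectors_def by (rule sum_residue_classes[OF p_pos])

text \<open>All representations of \<open>v\<close> satisfy
  \<open>disc v + s * t * (r - q)\<^sup>2 = 0\<close> modulo \<open>N\<close> with \<open>s\<close>,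
  \<open>t\<close> prime to \<open>p\<close>. As \<open>disc v\<close> is nonzero there, the
  valuation \<open>l\<close> of \<open>r - q\<close> is the same for all of them and
  \<open>2 * l < n\<close>. So each \<open>A (sector j c) v\<close> splits over sectors of scale
  \<open>l\<close>, and at most two of these contribute, by \<open>quad_roots_congruent\<close>. As
  \<open>l\<close> depends on \<open>v\<close>, the bound sums over all candidates.\<close>

lemma sector_sum_spacelike:
  assumes v: "\<not> N dvd disc v"
  shows "(\<Sum>c\<in>{0..<p ^ j}. cmod (A (sector j c) v))\<^sup>2
    \<le> 2 * (\<Sum>l\<in>{l. j \<le> l \<and> 2 * l < n}. \<Sum>c\<in>{0..<p ^ l}. (cmod (A (sector l c) v))\<^sup>2)"
proof (cases "\<exists>c\<in>{0..<p ^ j}. A (sector j c) v \<noteq> 0")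
  case False
  then have "(\<Sum>c\<in>{0..<p ^ j}. cmod (A (sector j c) v)) = 0" by simp
  then show ?thesis by (simp add: sum_nonneg)
next
  case True
  then obtain c0 x0 y0 where x0: "x0 \<in> sector j c0" "y0 \<in> sector j c0" "rep v x0 y0"
    using acorr_nonzero_obtains by metis
  have X0: "x0 \<in> X" "y0 \<in> X" using x0 sector_subset by blast+
  have unit2: "\<not> p dvd fst x * fst y" if "x \<in> X" "y \<in> X" for x y
    using unit that prime_p by (simp add: prime_dvd_mult_iff)
  have "\<not> p ^ n dvd snd x0 - snd y0"
  proof
    assume "p ^ n dvd snd x0 - snd y0"
    then have "N dvd fst x0 * fst y0 * (snd x0 - snd y0)\<^sup>2" by (simp add: power2_eq_square dvd_mult)
    then have "N dvd disc v" using rep_facts(3)[OF X0 x0(3)] by (simp add: dvd_add_left_iff)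
    then show False using v by simp
  qed
  then obtain l u where l: "snd x0 - snd y0 = p ^ l * u" "\<not> p dvd u" "l < n"
    by (rule prime_pow_decompose[OF prime_p])
  have sq: "(snd x0 - snd y0)\<^sup>2 = p ^ (2 * l) * u\<^sup>2"
    by (simp only: l(1) power_mult_distrib power_even_eq)
  have ln: "2 * l < n"
  proof (rule ccontr)
    assume "\<not> 2 * l < n"
    then have "N dvd fst x0 * fst y0 * (snd x0 - snd y0)\<^sup>2"
      unfolding sq by (intro dvd_mult dvd_mult2 le_imp_power_dvd) simp
    then have "N dvd disc v" using rep_facts(3)[OF X0 x0(3)] by (simp add: dvd_add_left_iff)
    then show False using v by simp
  qed
  have "p ^ j dvd snd x0 - snd y0"
    using x0 by (auto simp: sector_def mod_eq_dvd_iff[symmetric])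
  then have "p ^ j dvd p ^ l * u" by (simp only: l(1))
  then have jl: "j \<le> l" using prime_pow_dvd_iff[OF prime_p l(2)] by simp
  have val: "p ^ l dvd snd x - snd y" "\<not> p ^ Suc l dvd snd x - snd y"
    if X: "x \<in> X" "y \<in> X" and r: "rep v x y" for x y
  proof -
    have "\<not> p dvd u\<^sup>2" using l(2) prime_p prime_dvd_power by blast
    then have "\<not> p dvd fst x0 * fst y0 * u\<^sup>2"
      using unit2[OF X0] prime_p by (simp add: prime_dvd_mult_iff)
    moreover have "p ^ n dvd (fst x0 * fst y0 * u\<^sup>2) * p ^ (2 * l) - (fst x * fst y) * (snd x - snd y)\<^sup>2"
      using dvd_diff[OF rep_facts(3)[OF X0 x0(3)] rep_facts(3)[OF X r]]
      unfolding sq by (simp add: mult_ac)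
    ultimately show "p ^ l dvd snd x - snd y" "\<not> p ^ Suc l dvd snd x - snd y"
      using prime_pow_same_val[OF prime_p _ unit2[OF X] ln] by blast+
  qed
  let ?f = "\<lambda>c. cmod (A (sector l c) v)"
  have roots: "p ^ (2 * l) dvd quad v (snd x)" "p ^ l dvd fst v * snd x - fst (snd v)"
    "\<not> p ^ Suc l dvd fst v * snd x - fst (snd v)"
    if X: "x \<in> X" "y \<in> X" and r: "rep v x y" for x y
  proof -
    have "p ^ (2 * l) dvd (snd x - snd y)\<^sup>2"
      using dvd_power_same[OF val(1)[OF X r], of 2] by (simp add: power_even_eq)
    moreover have "p ^ (2 * l) dvd quad v (snd x) + fst y * (snd x - snd y)\<^sup>2"
      by (rule dvd_trans[OF le_imp_power_dvd rep_facts(1)[OF X r]]) (use ln in simp)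
    ultimately show "p ^ (2 * l) dvd quad v (snd x)"
      by (metis dvd_add_left_iff dvd_mult)
    have T: "p ^ Suc l dvd (fst v * snd x - fst (snd v)) + fst y * (snd x - snd y)"
      by (rule dvd_trans[OF le_imp_power_dvd rep_facts(2)[OF X r]]) (use ln in simp)
    then have "p ^ l dvd (fst v * snd x - fst (snd v)) + fst y * (snd x - snd y)"
      by (rule dvd_trans[OF le_imp_power_dvd, rotated]) simp
    then show "p ^ l dvd fst v * snd x - fst (snd v)"
      using val(1)[OF X r] by (metis dvd_add_left_iff dvd_mult)
    show "\<not> p ^ Suc l dvd fst v * snd x - fst (snd v)"
    proof
      assume "p ^ Suc l dvd fst v * snd x - fst (snd v)"
      then have "p ^ Suc l dvd (snd x - snd y) * fst y"
        using T by (metis dvd_add_right_iff mult.commute)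
      then show False using val(2)[OF X r] prime_pow_dvd_cancel[OF prime_p unit[OF X(2)]] by blast
    qed
  qed
  have "card {c\<in>{0..<p ^ l}. ?f c \<noteq> 0} \<le> 2"
  proof (rule card_le_2I)
    fix c1 c2 c3 assume c: "c1 \<in> {c\<in>{0..<p ^ l}. ?f c \<noteq> 0}" "c2 \<in> {c\<in>{0..<p ^ l}. ?f c \<noteq> 0}"
      "c3 \<in> {c\<in>{0..<p ^ l}. ?f c \<noteq> 0}" and ne: "c1 \<noteq> c2" "c1 \<noteq> c3"
    have *: "\<exists>x y. x \<in> sector l c \<and> y \<in> X \<and> rep v x y" if "c \<in> {c\<in>{0..<p ^ l}. ?f c \<noteq> 0}" for c
    proof -
      have "A (sector l c) v \<noteq> 0" using that by simp
      then obtain x y where "x \<in> sector l c" "y \<in> sector l c" "rep v x y" by (rule acorr_nonzero_obtains)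
      then show ?thesis using sector_subset by blast
    qed
    obtain x1 y1 where 1: "x1 \<in> sector l c1" "y1 \<in> X" "rep v x1 y1" using *[OF c(1)] by blast
    obtain x2 y2 where 2: "x2 \<in> sector l c2" "y2 \<in> X" "rep v x2 y2" using *[OF c(2)] by blast
    obtain x3 y3 where 3: "x3 \<in> sector l c3" "y3 \<in> X" "rep v x3 y3" using *[OF c(3)] by blast
    have X: "x1 \<in> X" "x2 \<in> X" "x3 \<in> X" using 1 2 3 sector_subset by blast+
    obtain v1 v2 v3 where vv: "v = (v1, v2, v3)" by (metis surj_pair)
    have "p ^ l dvd snd x2 - snd x3"
    proof (rule quad_roots_congruent[OF prime_p p_gt_2])
      show "p ^ (2 * l) dvd quad (v1, v2, v3) (snd x1)" "p ^ (2 * l) dvd quad (v1, v2, v3) (snd x2)"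
        "p ^ (2 * l) dvd quad (v1, v2, v3) (snd x3)"
        using roots(1)[OF X(1) 1(2,3)] roots(1)[OF X(2) 2(2,3)] roots(1)[OF X(3) 3(2,3)]
        by (simp_all only: vv)
      show "p ^ l dvd v1 * snd x1 - v2" "\<not> p ^ Suc l dvd v1 * snd x1 - v2"
        using roots(2,3)[OF X(1) 1(2,3)] by (simp_all only: vv fst_conv snd_conv not_False_eq_True)
      show "\<not> p ^ l dvd snd x2 - snd x1" "\<not> p ^ l dvd snd x3 - snd x1"
        using 1 2 3 ne by (auto simp: sector_def mod_eq_dvd_iff[symmetric])
    qed
    then show "c2 = c3" using 2 3 by (auto simp: sector_def mod_eq_dvd_iff[symmetric])
  qed (auto intro: finite_subset[of _ "{0..<p ^ l}"])
  then have "(\<Sum>c\<in>{0..<p ^ l}. ?f c)\<^sup>2 \<le> 2 * (\<Sum>c\<in>{0..<p ^ l}. (?f c)\<^sup>2)"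
    by (intro sum_sq_le_2) auto
  moreover have "(\<Sum>c\<in>{0..<p ^ j}. cmod (A (sector j c) v)) \<le> (\<Sum>c\<in>{0..<p ^ l}. ?f c)"
  proof -
    have "(\<Sum>c\<in>{0..<p ^ j}. cmod (A (sector j c) v)) \<le> (\<Sum>c\<in>{0..<p ^ j}. \<Sum>c'\<in>subsectors l j c. ?f c')"
    proof (rule sum_mono)
      fix c
      have "A (sector j c) v = (\<Sum>c'\<in>subsectors l j c. A (sector l c') v)"
        using val sector_subset by (intro acorr_split[OF jl]) blast
      then show "cmod (A (sector j c) v) \<le> (\<Sum>c'\<in>subsectors l j c. ?f c')"
        by (simp only: norm_sum)
    qed
    then show ?thesis by (simp only: sum_subsectors[OF jl])
  qed
  then have "(\<Sum>c\<in>{0..<p ^ j}. cmod (A (sector j c) v))\<^sup>2 \<le> (\<Sum>c\<in>{0..<p ^ l}. ?f c)\<^sup>2"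
    by (intro power_mono sum_nonneg) auto
  moreover have "(\<Sum>c\<in>{0..<p ^ l}. (?f c)\<^sup>2)
      \<le> (\<Sum>l\<in>{l. j \<le> l \<and> 2 * l < n}. \<Sum>c\<in>{0..<p ^ l}. (cmod (A (sector l c) v))\<^sup>2)"
    using jl ln by (intro member_le_sum[where f = "\<lambda>l. \<Sum>c\<in>{0..<p ^ l}. (cmod (A (sector l c) v))\<^sup>2"])
      (auto intro: sum_nonneg finite_subset[of _ "{..n}"])
  ultimately show ?thesis by linarith
qed

text \<open>
  Frequencies orthogonal to a plank of dimensions \<open>p\<^sup>-\<^sup>2\<^sup>b \<times> p\<^sup>-\<^sup>b \<times> 1\<close> whose long side is the
  light ray in direction \<open>c\<close>; multiplying by powers of \<open>p\<close> avoids truncated exponents \<open>n - 2 b\<close>.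
\<close>

fun plank_dual :: "nat \<Rightarrow> int \<Rightarrow> int3 \<Rightarrow> bool" where
  "plank_dual b c (v1, v2, v3) \<longleftrightarrow> N dvd v1 * p ^ (2 * b) \<and> N dvd (v2 - c * v1) * p ^ b"

definition plank_energy :: "nat \<Rightarrow> int \<Rightarrow> int3 \<Rightarrow> real" where
  "plank_energy b c v = (if plank_dual b c v then (cmod (A (sector b c) v))\<^sup>2 else 0)"

text \<open>If \<open>disc v\<close> vanishes modulo \<open>N\<close>, the two points of a
  representation agree modulo \<open>p ^ K\<close> and the parameter of the first is a root of
  \<open>quad v\<close> modulo \<open>N\<close>. Let \<open>b\<close> be the finest scale up to
  \<open>K\<close> at which all representations inside \<open>sector j c\<close> share one
  subsector. Unless \<open>b = K\<close>, two of these roots are at distance exactly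
  \<open>p ^ (-b)\<close>, and the sector \<open>d\<close> supplies a third one further away, so
  \<open>quad_roots_dual\<close> applies. The sum over \<open>b\<close> is there because
  \<open>b\<close> depends on \<open>v\<close>.\<close>

lemma sector_acorr_lightlike:
  assumes v: "N dvd disc v" and j: "2 * j \<le> n"
    and ne: "A (sector j c) v \<noteq> 0" "A (sector j d) v \<noteq> 0" "c \<noteq> d"
  shows "(cmod (A (sector j c) v))\<^sup>2 \<le> (\<Sum>b\<in>{j..n}. \<Sum>c'\<in>subsectors b j c. plank_energy b c' v)"
proof -
  \<comment> \<open>Half of \<open>n\<close>, rounded up: \<open>N\<close> divides a square exactly
    if \<open>p ^ K\<close> divides its root.\<close>
  define K where "K = (n + 1) div 2"
  have K: "2 * K \<le> Suc n" "n \<le> 2 * K" "j \<le> K" "K \<le> n" using j unfolding K_def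
    by (linarith, linarith, linarith, cases n, auto)
  have close: "p ^ K dvd snd x - snd y" if "x \<in> X" "y \<in> X" "rep v x y" for x y
  proof -
    have "N dvd (disc v + fst x * fst y * (snd x - snd y)\<^sup>2) - disc v"
      using rep_facts(3)[OF that] v by (rule dvd_diff)
    then have "N dvd ((snd x - snd y)\<^sup>2 * fst y) * fst x" by (simp add: mult_ac)
    then have "N dvd (snd x - snd y)\<^sup>2"
      using unit that prime_pow_dvd_cancel[OF prime_p] by blast
    then show ?thesis by (rule prime_pow_dvd_square[OF prime_p _ K(1)])
  qed
  have root: "N dvd quad v (snd x)" if "x \<in> X" "y \<in> X" "rep v x y" for x y
  proof -
    have "p ^ (2 * K) dvd (snd x - snd y)\<^sup>2"
      using dvd_power_same[OF close[OF that], of 2] by (simp add: power_even_eq)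
    then have "N dvd fst y * (snd x - snd y)\<^sup>2"
      by (intro dvd_mult dvd_trans[OF le_imp_power_dvd[OF K(2)]])
    then show ?thesis using rep_facts(1)[OF that] by (simp only: dvd_add_left_iff)
  qed
  obtain x0 y0 where x0: "x0 \<in> sector j c" "y0 \<in> sector j c" "rep v x0 y0"
    using acorr_nonzero_obtains[OF ne(1)] .
  obtain x2 y2 where x2: "x2 \<in> sector j d" "y2 \<in> sector j d" "rep v x2 y2"
    using acorr_nonzero_obtains[OF ne(2)] .
  have X: "x0 \<in> X" "y0 \<in> X" "x2 \<in> X" "y2 \<in> X" using x0 x2 sector_subset by blast+
  \<comment> \<open>Stopping at \<open>K\<close> loses nothing: at \<open>b = K\<close> the dual
    condition follows from the closeness of the two points alone, as in the first case of
    \<open>T\<close>.\<close>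
  define P where "P b \<longleftrightarrow> b \<le> K \<and> (\<forall>x\<in>sector j c. \<forall>y\<in>sector j c. rep v x y \<longrightarrow> p ^ b dvd snd x - snd x0)" for b
  have Pj: "P j" unfolding P_def using K x0 by (auto simp: sector_def mod_eq_dvd_iff[symmetric])
  define b where "b = (GREATEST b. P b)"
  have Pb: "P b" unfolding b_def by (rule GreatestI_nat[where b = K]) (use Pj in \<open>auto simp: P_def\<close>)
  have jb: "j \<le> b" unfolding b_def by (rule Greatest_le_nat[where b = K]) (use Pj in \<open>auto simp: P_def\<close>)
  have bK: "b \<le> K" using Pb by (simp add: P_def)
  have notP: "\<not> P (Suc b)"
  proof
    assume "P (Suc b)"
    then have "Suc b \<le> b" unfolding b_def by (rule Greatest_le_nat[where b = K]) (auto simp: P_def)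
    then show False by simp
  qed
  define c' where "c' = snd x0 mod p ^ b"
  have c': "c' \<in> subsectors b j c"
    using x0(1) jb pow_pos[of b] by (auto simp: c'_def subsectors_def sector_def)
  have in_sub: "x \<in> sector b c' \<and> y \<in> sector b c'" if xy: "x \<in> sector j c" "y \<in> sector j c" "rep v x y" for x y
  proof -
    have Xxy: "x \<in> X" "y \<in> X" using xy sector_subset by blast+
    have 1: "p ^ b dvd snd x - snd x0" using Pb xy by (auto simp: P_def)
    have 2: "p ^ b dvd snd x - snd y"
      by (rule dvd_trans[OF le_imp_power_dvd[OF bK] close[OF Xxy xy(3)]])
    show ?thesis using 1 2 Xxy by (auto simp: sector_def c'_def mod_eq_dvd_iff[symmetric])
  qed
  have "A (sector j c) v = (\<Sum>c''\<in>subsectors b j c. A (sector b c'') v)"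
  proof (rule acorr_split[OF jb])
    fix x y assume "x \<in> sector j c" "y \<in> sector j c" "rep v x y"
    then have "x \<in> sector b c'" "y \<in> sector b c'" using in_sub by blast+
    then show "p ^ b dvd snd x - snd y" by (auto simp: sector_def mod_eq_dvd_iff[symmetric])
  qed
  also have "\<dots> = (\<Sum>c''\<in>subsectors b j c. if c'' = c' then A (sector b c') v else 0)"
  proof (rule sum.cong[OF refl])
    fix c'' assume c'': "c'' \<in> subsectors b j c"
    show "A (sector b c'') v = (if c'' = c' then A (sector b c') v else 0)"
    proof (cases "c'' = c'")
      case False
      have "A (sector b c'') v = 0"
      proof (rule ccontr)
        assume "A (sector b c'') v \<noteq> 0"
        then obtain x y where xy: "x \<in> sector b c''" "y \<in> sector b c''" "rep v x y"
          by (rule acorr_nonzero_obtains)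
        then have "x \<in> sector j c" "y \<in> sector j c" using c'' by (auto simp: sector_split[OF jb, of c])
        then have "x \<in> sector b c'" using in_sub xy(3) by blast
        then show False using xy(1) False by (auto simp: sector_def)
      qed
      then show ?thesis using False by simp
    qed simp
  qed
  also have "\<dots> = A (sector b c') v" using c' by simp
  finally have A_eq: "A (sector j c) v = A (sector b c') v" .
  have T: "N dvd fst v * p ^ (2 * b) \<and> N dvd (fst v * snd x0 - fst (snd v)) * p ^ b"
  proof (cases "b = K")
    case True
    have "N dvd p ^ (2 * b)" using K True by (simp add: le_imp_power_dvd)
    moreover have "N dvd p ^ b * (fst y0 * (snd x0 - snd y0))"
    proof -
      have "p ^ b * p ^ b dvd p ^ b * (snd x0 - snd y0)"
        using close[OF X(1,2) x0(3)] True by (simp add: mult_dvd_mono)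
      then have "N dvd p ^ b * (snd x0 - snd y0)"
        using \<open>N dvd p ^ (2 * b)\<close> by (metis dvd_trans mult_2 power_add)
      then show ?thesis by (metis dvd_mult mult.left_commute)
    qed
    moreover have "N dvd p ^ b * ((fst v * snd x0 - fst (snd v)) + fst y0 * (snd x0 - snd y0))"
      using rep_facts(2)[OF X(1,2) x0(3)] by (rule dvd_mult)
    ultimately show ?thesis
      by (metis distrib_left dvd_add_left_iff dvd_mult mult.commute)
  next
    case False
    then have "Suc b \<le> K" using bK by simp
    then obtain x1 y1 where x1: "x1 \<in> sector j c" "y1 \<in> sector j c" "rep v x1 y1" "\<not> p ^ Suc b dvd snd x1 - snd x0"
      using notP by (auto simp: P_def)
    have X1: "x1 \<in> X" "y1 \<in> X" using x1 sector_subset by blast+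
    have d1: "p ^ b dvd snd x1 - snd x0" using Pb x1 by (auto simp: P_def)
    have d2: "\<not> p ^ b dvd snd x2 - snd x0"
    proof
      assume "p ^ b dvd snd x2 - snd x0"
      then have "p ^ j dvd snd x2 - snd x0" by (rule dvd_trans[OF le_imp_power_dvd[OF jb]])
      then show False using x2 x0 ne(3) by (auto simp: sector_def mod_eq_dvd_iff[symmetric])
    qed
    obtain v1 v2 v3 where vv: "v = (v1, v2, v3)" by (metis surj_pair)
    show ?thesis
      using quad_roots_dual[OF prime_p p_gt_2, where n = n and ?v1.0 = v1 and ?v2.0 = v2 and ?v3.0 = v3
          and r = "snd x0" and r' = "snd x1" and r'' = "snd x2" and b = b]
        root[OF X(1,2) x0(3)] root[OF X1 x1(3)] root[OF X(3,4) x2(3)] d1 x1(4) d2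
      unfolding vv by simp
  qed
  obtain v1 v2 v3 where vv: "v = (v1, v2, v3)" by (metis surj_pair)
  have "plank_dual b c' v"
  proof -
    \<comment> \<open>Passing from the root \<open>snd x0\<close> to its residue \<open>c'\<close>
      changes the second condition by a multiple of \<open>v1 * p ^ (2 * b)\<close>, which the first
      one controls.\<close>
    obtain z where z: "snd x0 = c' + p ^ b * z"
      using mod_mult_div_eq[of "snd x0" "p ^ b"] unfolding c'_def by metis
    have "N dvd v1 * p ^ (2 * b) * z - (v1 * snd x0 - v2) * p ^ b"
      using T dvd_diff[OF dvd_mult2] unfolding vv fst_conv snd_conv by blast
    also have "v1 * p ^ (2 * b) * z - (v1 * snd x0 - v2) * p ^ b = (v2 - c' * v1) * p ^ b"
      unfolding z power_even_eq by algebra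
    finally show ?thesis using T unfolding vv by simp
  qed
  then have "(cmod (A (sector j c) v))\<^sup>2 = plank_energy b c' v" by (simp add: plank_energy_def A_eq)
  also have "\<dots> \<le> (\<Sum>c'\<in>subsectors b j c. plank_energy b c' v)"
    using c' by (intro member_le_sum) (auto simp: plank_energy_def)
  also have "\<dots> \<le> (\<Sum>b\<in>{j..n}. \<Sum>c'\<in>subsectors b j c. plank_energy b c' v)"
    using jb bK K(4) by (intro member_le_sum[where f = "\<lambda>b. \<Sum>c'\<in>subsectors b j c. plank_energy b c' v"])
      (auto simp: plank_energy_def intro!: sum_nonneg)
  finally show ?thesis .
qed

end

lemma sum_power2_le_power2_sum:
  fixes f :: "'a \<Rightarrow> real"
  assumes "\<And>x. x \<in> S \<Longrightarrow> f x \<ge> 0"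
  shows "(\<Sum>x\<in>S. (f x)\<^sup>2) \<le> (\<Sum>x\<in>S. f x)\<^sup>2"
proof (cases "finite S")
  case True
  have "(\<Sum>x\<in>S. f x * f x) \<le> (\<Sum>x\<in>S. f x * (\<Sum>x\<in>S. f x))"
    using assms True by (intro sum_mono mult_left_mono member_le_sum) auto
  then show ?thesis by (simp add: power2_eq_square sum_distrib_right)
qed simp

section \<open>Averaging over planks, and the recursion for the fourth moment\<close>

context cone_sum
begin

text \<open>The shifts run over the group generated by \<open>(p ^ (2 * b), 0, 0)\<close> and
  \<open>(- c * p ^ b, p ^ b, 0)\<close>; its annihilator among the frequencies is
  \<open>plank_dual b c\<close>, by \<open>sum_plank_shift\<close>.\<close>

definition plank_shift :: "nat \<Rightarrow> int \<Rightarrow> int \<times> int \<Rightarrow> int3" where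
  "plank_shift b c t = (p ^ (2 * b) * fst t - c * p ^ b * snd t, p ^ b * snd t, 0)"

abbreviation shifts :: "(int \<times> int) set" where
  "shifts \<equiv> {0..<N} \<times> {0..<N}"

lemma sum_plank_shift:
  "(\<Sum>t\<in>shifts. e_mod N (dot3 v (plank_shift b c t))) = (if plank_dual b c v then of_int N ^ 2 else 0)"
proof -
  obtain v1 v2 v3 where v: "v = (v1, v2, v3)" by (metis surj_pair)
  have "dot3 v (plank_shift b c (t1, t2)) = (v1 * p ^ (2 * b)) * t1 + ((v2 - c * v1) * p ^ b) * t2" for t1 t2
    unfolding v plank_shift_def by (simp add: algebra_simps)
  then have "(\<Sum>t\<in>shifts. e_mod N (dot3 v (plank_shift b c t)))
      = (\<Sum>t1\<in>{0..<N}. e_mod N ((v1 * p ^ (2 * b)) * t1)) * (\<Sum>t2\<in>{0..<N}. e_mod N (((v2 - c * v1) * p ^ b) * t2))"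
  proof -
    have "(\<Sum>t\<in>shifts. e_mod N (dot3 v (plank_shift b c t)))
        = (\<Sum>t1\<in>{0..<N}. \<Sum>t2\<in>{0..<N}. e_mod N (dot3 v (plank_shift b c (t1, t2))))"
      by (simp add: sum.cartesian_product)
    then show ?thesis by (simp only: \<open>\<And>t1 t2. dot3 v (plank_shift b c (t1, t2)) = _\<close> e_mod_add sum_product)
  qed
  also have "\<dots> = (if plank_dual b c v then of_int N ^ 2 else 0)"
    unfolding sum_e_mod[OF N_pos] v by (simp add: power2_eq_square)
  finally show ?thesis .
qed

text \<open>Two points of a sector whose difference survives the average over the plank lie in a
  common sector of scale \<open>n - b\<close>: writing \<open>r = c + p ^ b * z\<close>, the first
  dual condition removes the height difference from the second and leaves
  \<open>p ^ b * (r - q) * t\<close>.\<close>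

lemma plank_dual_close:
  assumes b: "b \<le> n" and x: "x \<in> sector b c" "y \<in> sector b c" and dual: "plank_dual b c (cone_pt x - cone_pt y)"
  shows "p ^ (n - b) dvd snd x - snd y"
proof -
  obtain s r t q where xy: "x = (s, r)" "y = (t, q)" by (metis surj_pair)
  have "p ^ b dvd r - c"
    using x(1) by (auto simp: sector_def xy intro: mod_eq_dvd_iff[THEN iffD1])
  then obtain z where z: "r = c + p ^ b * z" by (metis dvdE diff_eq_eq add.commute)
  have d: "N dvd (s - t) * p ^ (2 * b)" "N dvd ((s * r - t * q) - c * (s - t)) * p ^ b"
    using dual by (auto simp: xy)
  have "N dvd ((s * r - t * q) - c * (s - t)) * p ^ b - (s - t) * p ^ (2 * b) * z"
    by (rule dvd_diff[OF d(2) dvd_mult2[OF d(1)]])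
  also have "((s * r - t * q) - c * (s - t)) * p ^ b - (s - t) * p ^ (2 * b) * z = (p ^ b * (r - q)) * t"
    unfolding z power_even_eq by algebra
  finally have "N dvd (p ^ b * (r - q)) * t" .
  moreover have "\<not> p dvd t" using unit[of y] x(2) sector_subset xy(2) by auto
  ultimately have "N dvd p ^ b * (r - q)" by (rule prime_pow_dvd_cancel[OF prime_p, rotated])
  then show ?thesis using prime_pow_dvd_mult_cancel[OF prime_p] xy by simp
qed

lemma sum_shifts_expand:
  "complex_of_real (\<Sum>t\<in>shifts. (cmod (G I (w + plank_shift b c t)))\<^sup>2)
    = (\<Sum>(x, y)\<in>I \<times> I. if plank_dual b c (cone_pt x - cone_pt y)
        then of_int N ^ 2 * (a x * cnj (a y) * e_mod N (dot3 (cone_pt x - cone_pt y) w)) else 0)"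
proof -
  have "complex_of_real (\<Sum>t\<in>shifts. (cmod (G I (w + plank_shift b c t)))\<^sup>2)
    = (\<Sum>t\<in>shifts. \<Sum>(x, y)\<in>I \<times> I. (a x * cnj (a y) * e_mod N (dot3 (cone_pt x - cone_pt y) w))
        * e_mod N (dot3 (cone_pt x - cone_pt y) (plank_shift b c t)))"
    by (simp only: of_real_sum complex_norm_square exp_sum_mult_cnj dot3_add_right e_mod_add mult.assoc)
  also have "\<dots> = (\<Sum>(x, y)\<in>I \<times> I. (a x * cnj (a y) * e_mod N (dot3 (cone_pt x - cone_pt y) w))
        * (\<Sum>t\<in>shifts. e_mod N (dot3 (cone_pt x - cone_pt y) (plank_shift b c t))))"
    unfolding split_def sum_distrib_left by (rule sum.swap)
  also have "\<dots> = (\<Sum>(x, y)\<in>I \<times> I. if plank_dual b c (cone_pt x - cone_pt y)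
        then of_int N ^ 2 * (a x * cnj (a y) * e_mod N (dot3 (cone_pt x - cone_pt y) w)) else 0)"
    unfolding sum_plank_shift by (intro sum.cong refl) (auto simp: mult.commute)
  finally show ?thesis .
qed

text \<open>There are \<open>N\<^sup>2\<close> shifts, so this bounds the average of the squared
  modulus over a plank by \<open>N\<close>. For \<open>n \<le> 2 * b\<close> the bound holds
  pointwise. Otherwise the average decouples the sector into \<open>p ^ (l - b)\<close> subsectors
  of scale \<open>l = n - b\<close>, each bounded by \<open>p ^ b\<close>, and
  \<open>l - b + 2 * b = n\<close>.\<close>

lemma sum_shifts_bound:
  assumes "b \<le> n" "0 \<le> c" "c < p ^ b"
  shows "(\<Sum>t\<in>shifts. (cmod (G (sector b c) (w + plank_shift b c t)))\<^sup>2) \<le> of_int N ^ 2 * of_int N"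
proof (cases "n \<le> 2 * b")
  case True
  have "(cmod (G (sector b c) w'))\<^sup>2 \<le> of_int N" for w'
  proof -
    have "(cmod (G (sector b c) w'))\<^sup>2 \<le> (of_int p ^ (n - b))\<^sup>2"
      using G_sector_bound[OF assms] by (intro power_mono) auto
    also have "\<dots> = of_int p ^ (2 * (n - b))" by (rule power_even_eq[symmetric])
    also have "\<dots> \<le> of_int p ^ n" using True real_p_ge_1 by (intro power_increasing) auto
    finally show ?thesis by simp
  qed
  then have "(\<Sum>t\<in>shifts. (cmod (G (sector b c) (w + plank_shift b c t)))\<^sup>2) \<le> (\<Sum>t\<in>shifts. of_int N)"
    by (rule sum_mono)
  also have "\<dots> = of_int N ^ 2 * of_int N"
    using N_pos by (simp add: card_cartesian_product power2_eq_square)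
  finally show ?thesis .
next
  case False
  define l where "l = n - b"
  have bl: "b \<le> l" "l \<le> n" "n - l = b" "l - b + 2 * b = n" using False assms(1) unfolding l_def by auto
  have "complex_of_real (\<Sum>t\<in>shifts. (cmod (G (sector b c) (w + plank_shift b c t)))\<^sup>2)
      = (\<Sum>c'\<in>subsectors l b c. complex_of_real (\<Sum>t\<in>shifts. (cmod (G (sector l c') (w + plank_shift b c t)))\<^sup>2))"
    unfolding sum_shifts_expand
    by (rule sum_sector_pairs_split[OF bl(1)])
      (auto split: if_splits simp: l_def intro: plank_dual_close[OF assms(1)])
  then have "(\<Sum>t\<in>shifts. (cmod (G (sector b c) (w + plank_shift b c t)))\<^sup>2)
      = (\<Sum>c'\<in>subsectors l b c. \<Sum>t\<in>shifts. (cmod (G (sector l c') (w + plank_shift b c t)))\<^sup>2)"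
    by (simp only: of_real_sum[symmetric] of_real_eq_iff)
  also have "\<dots> \<le> (\<Sum>c'\<in>subsectors l b c. \<Sum>t\<in>shifts. of_int p ^ (2 * b))"
  proof (intro sum_mono)
    fix c' t assume "c' \<in> subsectors l b c"
    then have "cmod (G (sector l c') (w + plank_shift b c t)) \<le> of_int p ^ b"
      using G_sector_bound[OF bl(2), of c'] bl(3) by (simp add: subsectors_def)
    then show "(cmod (G (sector l c') (w + plank_shift b c t)))\<^sup>2 \<le> of_int p ^ (2 * b)"
      unfolding power_even_eq by (intro power_mono) auto
  qed
  also have "\<dots> = of_int p ^ (l - b) * (of_int N ^ 2 * of_int p ^ (2 * b))"
    using N_pos card_subsectors[OF bl(1) assms(2,3)]
    by (simp add: card_cartesian_product power2_eq_square del: of_int_power)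
  also have "\<dots> = of_int N ^ 2 * (of_int p ^ (l - b) * of_int p ^ (2 * b))"
    by simp
  also have "of_int p ^ (l - b) * of_int p ^ (2 * b) = real_of_int N"
    unfolding power_add[symmetric] bl(4) by simp
  finally show ?thesis .
qed

text \<open>By Parseval the left side is, up to powers of \<open>N\<close>, the correlation of the
  squared modulus with its own plank averages. The averages are bounded by
  \<open>sum_shifts_bound\<close>, the other factor is summed by \<open>moment2\<close>.\<close>

lemma plank_energy_bound:
  assumes "b \<le> n" "0 \<le> c" "c < p ^ b"
  shows "(\<Sum>v\<in>cube N. plank_energy b c v) \<le> of_int N * mass (sector b c)"
proof -
  let ?f = "\<lambda>w. (cmod (G (sector b c) w))\<^sup>2"
  let ?P = "\<lambda>w. \<Sum>t\<in>shifts. ?f (w + plank_shift b c t)"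
  have P: "complex_of_real (?P w) = (\<Sum>v\<in>cube N. (if plank_dual b c v then of_int N ^ 2 * A (sector b c) v else 0) * e_mod N (dot3 v w))" for w
  proof -
    have "complex_of_real (?P w)
      = (\<Sum>t\<in>shifts. \<Sum>v\<in>cube N. (A (sector b c) v * e_mod N (dot3 v w)) * e_mod N (dot3 v (plank_shift b c t)))"
      by (simp only: of_real_sum exp_sum_sq_expand[OF N_pos] dot3_add_right e_mod_add mult.assoc)
    also have "\<dots> = (\<Sum>v\<in>cube N. (A (sector b c) v * e_mod N (dot3 v w)) * (\<Sum>t\<in>shifts. e_mod N (dot3 v (plank_shift b c t))))"
      unfolding sum_distrib_left by (rule sum.swap)
    also have "\<dots> = (\<Sum>v\<in>cube N. (if plank_dual b c v then of_int N ^ 2 * A (sector b c) v else 0) * e_mod N (dot3 v w))"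
      unfolding sum_plank_shift by (intro sum.cong refl) auto
    finally show ?thesis .
  qed
  have "complex_of_real (\<Sum>w\<in>cube N. ?P w * ?f w)
      = (\<Sum>w\<in>cube N. complex_of_real (?P w) * cnj (complex_of_real (?f w)))"
    by simp
  also have "\<dots> = of_int N ^ 3 * (\<Sum>v\<in>cube N. (if plank_dual b c v then of_int N ^ 2 * A (sector b c) v else 0)
      * cnj (A (sector b c) v))"
    unfolding P exp_sum_sq_expand[OF N_pos] by (rule parseval_cube[OF N_pos])
  also have "\<dots> = of_int N ^ 3 * (\<Sum>v\<in>cube N. of_int N ^ 2 * complex_of_real (plank_energy b c v))"
  proof -
    have "(if plank_dual b c v then of_int N ^ 2 * A (sector b c) v else 0) * cnj (A (sector b c) v)
        = of_int N ^ 2 * complex_of_real (plank_energy b c v)" for v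
      using complex_norm_square[of "A (sector b c) v"] by (simp add: plank_energy_def mult.assoc)
    then show ?thesis by simp
  qed
  also have "\<dots> = complex_of_real (of_int N ^ 3 * (of_int N ^ 2 * (\<Sum>v\<in>cube N. plank_energy b c v)))"
    by (simp add: sum_distrib_left)
  finally have "(\<Sum>w\<in>cube N. ?P w * ?f w) = of_int N ^ 3 * (of_int N ^ 2 * (\<Sum>v\<in>cube N. plank_energy b c v))"
    by (simp only: of_real_eq_iff)
  moreover have "(\<Sum>w\<in>cube N. ?P w * ?f w) \<le> (\<Sum>w\<in>cube N. (of_int N ^ 2 * of_int N) * ?f w)"
    by (intro sum_mono mult_right_mono sum_shifts_bound[OF assms]) simp
  moreover have "(\<Sum>w\<in>cube N. (of_int N ^ 2 * of_int N) * ?f w)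
      = of_int N ^ 3 * (of_int N ^ 2 * (of_int N * mass (sector b c)))"
    unfolding sum_distrib_left[symmetric] moment2[OF sector_subset] by (simp only: mult_ac)
  ultimately have "of_int N ^ 3 * (of_int N ^ 2 * (\<Sum>v\<in>cube N. plank_energy b c v))
      \<le> of_int N ^ 3 * (of_int N ^ 2 * (of_int N * mass (sector b c)))" by linarith
  moreover have "real_of_int N > 0" using N_pos by (simp only: of_int_0_less_iff)
  ultimately show ?thesis by (simp only: mult_le_cancel_left_pos zero_less_power)
qed

text \<open>Off the light cone all pairs together are absorbed by the square of the sum over
  sectors. On it, two distinct sectors that both see \<open>v\<close> are each the witness
  \<open>d\<close> for the other, so \<open>sector_acorr_lightlike\<close> bounds both. A sector has
  \<open>p ^ m\<close> partners in its parent; this loss falls only on the plank term, which does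
  not enter the recursion again.\<close>

lemma sector_pairs_pointwise:
  assumes j: "2 * (k + m) \<le> n"
  defines "j \<equiv> k + m"
  shows "(\<Sum>c\<in>{0..<p ^ k}. \<Sum>c1\<in>subsectors j k c. \<Sum>c2\<in>subsectors j k c. cmod (A (sector j c1) v) * cmod (A (sector j c2) v))
    \<le> (\<Sum>c\<in>{0..<p ^ j}. (cmod (A (sector j c) v))\<^sup>2)
      + 2 * (\<Sum>l\<in>{l. j \<le> l \<and> 2 * l < n}. \<Sum>c\<in>{0..<p ^ l}. (cmod (A (sector l c) v))\<^sup>2)
      + 2 * of_int p ^ m * (\<Sum>b\<in>{j..n}. \<Sum>c\<in>{0..<p ^ b}. plank_energy b c v)"
    (is "?L \<le> ?S1 + 2 * ?S2 + 2 * of_int p ^ m * ?S3")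
proof -
  have kj: "k \<le> j" and jn: "2 * j \<le> n" using j by (auto simp: j_def)
  let ?A = "\<lambda>c. cmod (A (sector j c) v)"
  have pe: "plank_energy b c v \<ge> 0" for b c by (simp add: plank_energy_def)
  have S: "?S1 \<ge> 0" "?S2 \<ge> 0" "?S3 \<ge> 0"
    by (intro sum_nonneg zero_le_power2 pe)+
  have pm: "real_of_int p ^ m \<ge> 0" using p_pos by simp
  show ?thesis
  proof (cases "N dvd disc v")
    case False
    have "?L = (\<Sum>c\<in>{0..<p ^ k}. (\<Sum>c1\<in>subsectors j k c. ?A c1)\<^sup>2)"
      by (simp add: power2_eq_square sum_product)
    also have "\<dots> \<le> (\<Sum>c\<in>{0..<p ^ k}. \<Sum>c1\<in>subsectors j k c. ?A c1)\<^sup>2"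
      by (intro sum_power2_le_power2_sum sum_nonneg) simp
    also have "\<dots> = (\<Sum>c\<in>{0..<p ^ j}. ?A c)\<^sup>2" by (simp only: sum_subsectors[OF kj])
    also have "\<dots> \<le> 2 * ?S2" by (rule sector_sum_spacelike[OF False])
    finally show ?thesis using S mult_nonneg_nonneg[OF pm S(3)] by linarith
  next
    case True
    define E where "E c = (\<Sum>b\<in>{j..n}. \<Sum>c'\<in>subsectors b j c. plank_energy b c' v)" for c
    have E0: "E c \<ge> 0" for c unfolding E_def by (intro sum_nonneg pe)
    have sumE: "(\<Sum>c\<in>{0..<p ^ j}. E c) = ?S3"
      unfolding E_def by (subst sum.swap) (auto intro!: sum.cong sum_subsectors)
    have pt: "?A c1 * ?A c2 \<le> (if c1 = c2 then (?A c1)\<^sup>2 else 0) + (E c1 + E c2)" for c1 c2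
    proof (cases "c1 = c2 \<or> ?A c1 = 0 \<or> ?A c2 = 0")
      case True
      then show ?thesis using E0[of c1] E0[of c2] by (auto simp: power2_eq_square)
    next
      case False
      then have "(?A c1)\<^sup>2 \<le> E c1" "(?A c2)\<^sup>2 \<le> E c2"
        unfolding E_def using sector_acorr_lightlike[OF \<open>N dvd disc v\<close> jn] by auto
      moreover have "2 * (?A c1 * ?A c2) \<le> (?A c1)\<^sup>2 + (?A c2)\<^sup>2"
        using sum_squares_bound[of "?A c1" "?A c2"] by simp
      ultimately show ?thesis using False E0[of c1] E0[of c2] by simp
    qed
    have "?L \<le> (\<Sum>c\<in>{0..<p ^ k}. \<Sum>c1\<in>subsectors j k c. \<Sum>c2\<in>subsectors j k c.
        (if c1 = c2 then (?A c1)\<^sup>2 else 0) + (E c1 + E c2))"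
      by (intro sum_mono pt)
    also have "\<dots> = (\<Sum>c\<in>{0..<p ^ k}. (\<Sum>c1\<in>subsectors j k c. (?A c1)\<^sup>2)
        + 2 * (real (card (subsectors j k c)) * (\<Sum>c1\<in>subsectors j k c. E c1)))"
      by (intro sum.cong refl) (simp add: sum.distrib sum_distrib_left)
    also have "\<dots> = (\<Sum>c\<in>{0..<p ^ k}. (\<Sum>c1\<in>subsectors j k c. (?A c1)\<^sup>2)
        + 2 * (of_int p ^ m * (\<Sum>c1\<in>subsectors j k c. E c1)))"
    proof (intro sum.cong refl)
      fix c assume "c \<in> {0..<p ^ k}"
      then have "real (card (subsectors j k c)) = of_int p ^ m"
        using card_subsectors[OF kj, of c] by (simp add: j_def)
      then show "(\<Sum>c1\<in>subsectors j k c. (?A c1)\<^sup>2) + 2 * (real (card (subsectors j k c)) * (\<Sum>c1\<in>subsectors j k c. E c1))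
        = (\<Sum>c1\<in>subsectors j k c. (?A c1)\<^sup>2) + 2 * (of_int p ^ m * (\<Sum>c1\<in>subsectors j k c. E c1))"
        by (simp only:)
    qed
    also have "\<dots> = ?S1 + 2 * of_int p ^ m * ?S3"
      by (simp only: sum.distrib sum_distrib_left[symmetric] sum_subsectors[OF kj] sumE mult.assoc)
    finally show ?thesis using S by linarith
  qed
qed

text \<open>The plank term is summed outright by \<open>plank_energy_bound\<close>, for at most
  \<open>n + 1\<close> scales \<open>b\<close>; the other terms are fourth moments of narrower
  sectors.\<close>

lemma fourth_recursion:
  assumes j: "2 * (k + m) \<le> n"
  shows "fourth k \<le> 2 * (fourth (k + m) + 2 * (\<Sum>l\<in>{l. k + m \<le> l \<and> 2 * l < n}. fourth l)
    + 2 * of_int p ^ m * (real (n + 1) * (of_int N * (of_int N ^ 3 * mass X))))"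
proof -
  define j where "j = k + m"
  let ?N = "real_of_int N ^ 3"
  let ?AA = "\<lambda>c1 c2 v. cmod (A (sector j c1) v) * cmod (A (sector j c2) v)"
  have N3: "?N \<ge> 0" using N_pos by (simp del: of_int_power)
  have "fourth k \<le> (\<Sum>c\<in>{0..<p ^ k}. 2 * (\<Sum>c1\<in>subsectors j k c. \<Sum>c2\<in>subsectors j k c.
        ?N * (\<Sum>v\<in>cube N. ?AA c1 c2 v)))"
    unfolding fourth_def
  proof (intro sum_mono)
    fix c
    have "(\<Sum>w\<in>cube N. cmod (G (sector k c) w) ^ 4) \<le> 2 * (\<Sum>c1\<in>subsectors j k c. \<Sum>c2\<in>subsectors j k c.
        \<Sum>w\<in>cube N. (cmod (G (sector j c1) w))\<^sup>2 * (cmod (G (sector j c2) w))\<^sup>2)"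
      using parabola_step_sector[OF j] by (simp only: j_def)
    also have "\<dots> \<le> 2 * (\<Sum>c1\<in>subsectors j k c. \<Sum>c2\<in>subsectors j k c. ?N * (\<Sum>v\<in>cube N. ?AA c1 c2 v))"
      by (intro mult_left_mono sum_mono moment22_le[OF N_pos]) simp
    finally show "(\<Sum>w\<in>cube N. cmod (G (sector k c) w) ^ 4)
      \<le> 2 * (\<Sum>c1\<in>subsectors j k c. \<Sum>c2\<in>subsectors j k c. ?N * (\<Sum>v\<in>cube N. ?AA c1 c2 v))" .
  qed
  also have "\<dots> = 2 * (?N * (\<Sum>v\<in>cube N. \<Sum>c\<in>{0..<p ^ k}. \<Sum>c1\<in>subsectors j k c. \<Sum>c2\<in>subsectors j k c. ?AA c1 c2 v))"
  proof -
    have "(\<Sum>v\<in>cube N. \<Sum>c\<in>{0..<p ^ k}. \<Sum>c1\<in>subsectors j k c. \<Sum>c2\<in>subsectors j k c. ?AA c1 c2 v)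
        = (\<Sum>c\<in>{0..<p ^ k}. \<Sum>c1\<in>subsectors j k c. \<Sum>c2\<in>subsectors j k c. \<Sum>v\<in>cube N. ?AA c1 c2 v)"
      by (subst sum.swap, rule sum.cong[OF refl], subst sum.swap, rule sum.cong[OF refl], rule sum.swap)
    then show ?thesis by (simp only: sum_distrib_left)
  qed
  also have "\<dots> \<le> 2 * (?N * (\<Sum>v\<in>cube N. (\<Sum>c\<in>{0..<p ^ j}. (cmod (A (sector j c) v))\<^sup>2)
      + 2 * (\<Sum>l\<in>{l. j \<le> l \<and> 2 * l < n}. \<Sum>c\<in>{0..<p ^ l}. (cmod (A (sector l c) v))\<^sup>2)
      + 2 * of_int p ^ m * (\<Sum>b\<in>{j..n}. \<Sum>c\<in>{0..<p ^ b}. plank_energy b c v)))"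
    unfolding j_def using N3 by (intro mult_left_mono sum_mono sector_pairs_pointwise[OF j]) simp_all
  also have "\<dots> = 2 * (fourth j + 2 * (\<Sum>l\<in>{l. j \<le> l \<and> 2 * l < n}. fourth l)
      + 2 * of_int p ^ m * (?N * (\<Sum>v\<in>cube N. \<Sum>b\<in>{j..n}. \<Sum>c\<in>{0..<p ^ b}. plank_energy b c v)))"
  proof -
    have "?N * (\<Sum>v\<in>cube N. \<Sum>l\<in>L. \<Sum>c\<in>{0..<p ^ l}. (cmod (A (sector l c) v))\<^sup>2) = (\<Sum>l\<in>L. fourth l)" for L
      unfolding fourth_acorr by (subst sum.swap) (simp only: sum_distrib_left)
    moreover have "?N * (\<Sum>v\<in>cube N. \<Sum>c\<in>{0..<p ^ j}. (cmod (A (sector j c) v))\<^sup>2) = fourth j"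
      by (simp only: fourth_acorr)
    moreover have "N' * (\<Sum>v\<in>S. f v + 2 * g v + 2 * P * h v)
        = N' * (\<Sum>v\<in>S. f v) + 2 * (N' * (\<Sum>v\<in>S. g v)) + 2 * P * (N' * (\<Sum>v\<in>S. h v))"
      for N' P :: real and f g h :: "int3 \<Rightarrow> real" and S
      by (simp add: sum.distrib sum_distrib_left algebra_simps)
    ultimately show ?thesis by (simp only:)
  qed
  also have "\<dots> \<le> 2 * (fourth j + 2 * (\<Sum>l\<in>{l. j \<le> l \<and> 2 * l < n}. fourth l)
      + 2 * of_int p ^ m * (?N * (real (n + 1) * (of_int N * mass X))))"
  proof -
    have "(\<Sum>v\<in>cube N. \<Sum>b\<in>{j..n}. \<Sum>c\<in>{0..<p ^ b}. plank_energy b c v)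
        = (\<Sum>b\<in>{j..n}. \<Sum>c\<in>{0..<p ^ b}. \<Sum>v\<in>cube N. plank_energy b c v)"
      by (subst sum.swap, rule sum.cong[OF refl], rule sum.swap)
    also have "\<dots> \<le> (\<Sum>b\<in>{j..n}. \<Sum>c\<in>{0..<p ^ b}. of_int N * mass (sector b c))"
      by (intro sum_mono plank_energy_bound) auto
    also have "\<dots> = real (card {j..n}) * (of_int N * mass X)"
      by (simp only: sum_distrib_left[symmetric] mass_sector_sum sum_constant mult.left_commute)
    also have "\<dots> \<le> real (n + 1) * (of_int N * mass X)"
      using mass_nonneg N_pos by (intro mult_right_mono mult_nonneg_nonneg) (auto simp del: of_int_power)
    finally show ?thesis using N3 p_pos by (intro mult_left_mono add_left_mono) simp_all
  qed
  finally show ?thesis by (simp only: j_def mult_ac)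
qed

end

text \<open>Put \<open>q = \<theta>\<^sup>2\<close> and \<open>j = k + m\<close>. The moments at
  finer scales form a geometric series of size \<open>q ^ (n - j) * q / (q - 1)\<close>, and the
  assumption on \<open>m\<close> makes their contribution at most half of the target. The assumption
  \<open>M \<ge> 8 * p ^ m * C\<close> bounds the plank term by the other half. For
  \<open>2 * (k + m) > n\<close> the trivial bound loses only the factor \<open>p ^ (2 * m)\<close>
  contained in \<open>M\<close>.\<close>

lemma recursion_bound:
  fixes F :: "nat \<Rightarrow> real" and p \<theta> U W M C :: real
  assumes p: "p \<ge> 1" and th: "\<theta> > 1" and W: "W \<ge> 0"
    and m: "4 + 8 * \<theta>\<^sup>2 / (\<theta>\<^sup>2 - 1) \<le> \<theta> ^ (2 * m)"
    and C: "real (n + 1) \<le> C * \<theta> ^ n"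
    and M: "M \<ge> p ^ (2 * m)" "M \<ge> 8 * p ^ m * C"
    and trivial: "\<And>k. k \<le> n \<Longrightarrow> F k \<le> p ^ (2 * (n - k)) * W"
    and rec: "\<And>k. 2 * (k + m) \<le> n \<Longrightarrow>
      F k \<le> 2 * (F (k + m) + 2 * (\<Sum>l\<in>{l. k + m \<le> l \<and> 2 * l < n}. F l) + 2 * p ^ m * (real (n + 1) * (p ^ n * W)))"
    and mpos: "m > 0"
  shows "k \<le> n \<Longrightarrow> F k \<le> M * \<theta> ^ (2 * (n - k)) * (p ^ n * W)"
proof (induction "n - k" arbitrary: k rule: less_induct)
  case less
  have M0: "M \<ge> 0" using M(1) p by (smt (verit) one_le_power)
  have th1: "1 \<le> \<theta> ^ i" for i using th by simp
  let ?U = "p ^ n * W"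
  have U0: "?U \<ge> 0" using p W by simp
  show ?case
  proof (cases "2 * (k + m) \<le> n")
    case False
    have "F k \<le> p ^ (2 * (n - k)) * W" by (rule trivial[OF less.prems])
    also have "\<dots> \<le> p ^ (2 * m + n) * W"
      using False p W by (intro mult_right_mono power_increasing) auto
    also have "\<dots> = p ^ (2 * m) * ?U" by (simp add: power_add)
    also have "\<dots> \<le> M * \<theta> ^ (2 * (n - k)) * ?U"
      using M(1) mult_left_mono[OF th1 M0, of "2 * (n - k)"] U0 by (intro mult_right_mono) auto
    finally show ?thesis .
  next
    case True
    define j where "j = k + m"
    have jn: "j \<le> n" "k < j" using True mpos by (auto simp: j_def)
    let ?q = "\<theta>\<^sup>2"
    have IH: "F l \<le> M * ?q ^ (n - l) * ?U" if "j \<le> l" "l \<le> n" for l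
      using less.hyps[of l] that jn by (auto simp: power_mult[symmetric])
    have q1: "?q > 1" using th by simp
    have "(\<Sum>l\<in>{l. j \<le> l \<and> 2 * l < n}. F l) \<le> (\<Sum>l\<in>{l. j \<le> l \<and> 2 * l < n}. M * ?U * ?q ^ (n - l))"
      using IH by (intro sum_mono) (auto simp: mult_ac)
    also have "\<dots> \<le> (\<Sum>l\<in>{j..n}. M * ?U * ?q ^ (n - l))"
      using M0 U0 by (intro sum_mono2) auto
    also have "\<dots> = M * ?U * (\<Sum>i\<in>{..n - j}. ?q ^ i)"
      unfolding sum_distrib_left
      by (rule sum.reindex_bij_witness[where i = "\<lambda>i. n - i" and j = "\<lambda>l. n - l"]) (use jn in auto)
    also have "(\<Sum>i\<in>{..n - j}. ?q ^ i) \<le> ?q ^ (n - j) * (?q / (?q - 1))"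
    proof -
      have "(\<Sum>i\<in>{..n - j}. ?q ^ i) = (?q ^ Suc (n - j) - 1) / (?q - 1)"
        using q1 geometric_sum[of ?q "Suc (n - j)"] by (simp only: lessThan_Suc_atMost)
      also have "\<dots> \<le> ?q ^ Suc (n - j) / (?q - 1)" using q1 by (intro divide_right_mono) auto
      finally show ?thesis by (simp add: mult.commute)
    qed
    finally have S: "(\<Sum>l\<in>{l. j \<le> l \<and> 2 * l < n}. F l) \<le> M * ?U * (?q ^ (n - j) * (?q / (?q - 1)))"
      using M0 U0 by (simp add: mult_left_mono)
    have last: "2 * p ^ m * (real (n + 1) * ?U) \<le> M / 4 * ?q ^ (n - k) * ?U"
    proof -
      have "C * \<theta> ^ n \<le> C * ?q ^ (n - k)"
      proof (rule mult_left_mono)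
        show "\<theta> ^ n \<le> ?q ^ (n - k)"
          unfolding power_mult[symmetric] using th True by (intro power_increasing) auto
        show "C \<ge> 0" using C th1[of n] by (smt (verit) of_nat_0_le_iff mult_neg_pos)
      qed
      then have "2 * p ^ m * real (n + 1) \<le> 2 * p ^ m * (C * ?q ^ (n - k))"
        using C p by (intro mult_left_mono) auto
      also have "\<dots> \<le> M / 4 * ?q ^ (n - k)"
        using M(2) mult_right_mono[of "8 * p ^ m * C" M "?q ^ (n - k)"] th by simp
      finally show ?thesis using U0 by (metis mult.assoc mult_right_mono)
    qed
    have "F k \<le> 2 * (F j + 2 * (\<Sum>l\<in>{l. j \<le> l \<and> 2 * l < n}. F l) + 2 * p ^ m * (real (n + 1) * ?U))"
      using rec[OF True] by (simp only: j_def)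
    also have "\<dots> \<le> 2 * (M * ?q ^ (n - j) * ?U + 2 * (M * ?U * (?q ^ (n - j) * (?q / (?q - 1)))) + M / 4 * ?q ^ (n - k) * ?U)"
      using IH[of j] jn S last by (intro mult_left_mono add_mono) (auto simp: power_mult)
    also have "\<dots> = M * ?U * (?q ^ (n - j) * ((4 + 8 * (?q / (?q - 1))) / 2) + ?q ^ (n - k) / 2)"
      by (simp add: algebra_simps)
    also have "\<dots> \<le> M * ?U * (?q ^ (n - k) / 2 + ?q ^ (n - k) / 2)"
    proof -
      have "?q ^ (n - j) * ((4 + 8 * (?q / (?q - 1))) / 2) \<le> ?q ^ (n - j) * (?q ^ m / 2)"
        using m th by (intro mult_left_mono) (auto simp: power_mult)
      also have "\<dots> = ?q ^ (n - k) / 2"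
        using True by (simp add: j_def flip: power_add)
      finally show ?thesis using M0 U0 by (intro mult_left_mono add_right_mono) auto
    qed
    also have "\<dots> = M * \<theta> ^ (2 * (n - k)) * ?U" unfolding power_mult by simp
    finally show ?thesis .
  qed
qed

lemma exists_linear_le_power:
  assumes "\<theta> > (1::real)"
  shows "\<exists>C. \<forall>n. real (n + 1) \<le> C * \<theta> ^ n"
proof -
  have "real (n + 1) \<le> max 1 (1 / (\<theta> - 1)) * \<theta> ^ n" for n
  proof -
    have "1 + real n * (\<theta> - 1) \<le> \<theta> ^ n"
      using Bernoulli_inequality[of "\<theta> - 1" n] assms by simp
    then have "max 1 (1 / (\<theta> - 1)) * (1 + real n * (\<theta> - 1)) \<le> max 1 (1 / (\<theta> - 1)) * \<theta> ^ n"
      by (intro mult_left_mono) auto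
    moreover have "1 \<le> max 1 (1 / (\<theta> - 1)) * 1" by simp
    moreover have "real n \<le> max 1 (1 / (\<theta> - 1)) * (real n * (\<theta> - 1))"
    proof -
      have "1 \<le> max 1 (1 / (\<theta> - 1)) * (\<theta> - 1)"
        using assms mult_right_mono[of "1 / (\<theta> - 1)" "max 1 (1 / (\<theta> - 1))" "\<theta> - 1"] by simp
      then show ?thesis using mult_left_mono[of 1 "max 1 (1 / (\<theta> - 1)) * (\<theta> - 1)" "real n"] by (simp add: mult_ac)
    qed
    ultimately show ?thesis by (simp add: distrib_left)
  qed
  then show ?thesis by blast
qed

text \<open>
  The sum over the cube is not normalised: \<open>p\<^sup>4\<^sup>n\<close> is the volume \<open>p\<^sup>3\<^sup>n\<close> times the sharp factor \<open>p\<^sup>n\<close>,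
  attained when one slab of each direction passes through a common point. The loss \<open>\<theta>\<^sup>2\<^sup>n\<close> plays the
  role of the \<open>\<epsilon>\<close>-power, since \<open>\<theta> > 1\<close> is arbitrary while \<open>m\<close> and \<open>M\<close> do not depend on \<open>n\<close>.
\<close>

theorem cone_fourth_moment:
  fixes p :: int
  assumes "p > 2" "\<theta> > (1::real)"
  shows "\<exists>m M. m > 0 \<and> M \<ge> 1 \<and> (\<forall>n X a. cone_sum p n m X a \<longrightarrow>
    (\<Sum>w\<in>cube (p ^ n). cmod (exp_sum (p ^ n) a X w) ^ 4)
      \<le> M * \<theta> ^ (2 * n) * of_int p ^ (4 * n) * (\<Sum>x\<in>X. (cmod (a x))\<^sup>2))"
proof -
  obtain C where C: "\<And>n. real (n + 1) \<le> C * \<theta> ^ n" using exists_linear_le_power[OF assms(2)] by blast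
  have q1: "\<theta>\<^sup>2 > 1" using assms(2) by simp
  obtain m0 where m0: "4 + 8 * \<theta>\<^sup>2 / (\<theta>\<^sup>2 - 1) < (\<theta>\<^sup>2) ^ m0" using real_arch_pow[OF q1] by blast
  define m where "m = Suc m0"
  define M where "M = max 1 (max (of_int p ^ (2 * m)) (8 * of_int p ^ m * C))"
  have m: "4 + 8 * \<theta>\<^sup>2 / (\<theta>\<^sup>2 - 1) \<le> \<theta> ^ (2 * m)"
  proof -
    have "(\<theta>\<^sup>2) ^ m0 \<le> (\<theta>\<^sup>2) ^ m" unfolding m_def using q1 by (intro power_increasing) auto
    then show ?thesis using m0 by (simp add: power_mult)
  qed
  have "(\<Sum>w\<in>cube (p ^ n). cmod (exp_sum (p ^ n) a X w) ^ 4)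
      \<le> M * \<theta> ^ (2 * n) * of_int p ^ (4 * n) * (\<Sum>x\<in>X. (cmod (a x))\<^sup>2)" if "cone_sum p n m X a" for n X a
  proof -
    interpret cone_sum p n m X a by fact
    let ?W = "of_int N ^ 3 * mass X"
    have "fourth 0 \<le> M * \<theta> ^ (2 * (n - 0)) * (of_int p ^ n * ?W)"
    proof (rule recursion_bound[where F = fourth and C = C and m = m])
      show "0 \<le> ?W" using mass_nonneg N_pos by (intro mult_nonneg_nonneg) (auto simp del: of_int_power)
      show "fourth k \<le> 2 * (fourth (k + m) + 2 * (\<Sum>l\<in>{l. k + m \<le> l \<and> 2 * l < n}. fourth l)
          + 2 * of_int p ^ m * (real (n + 1) * (of_int p ^ n * ?W)))" if "2 * (k + m) \<le> n" for k
        using fourth_recursion[OF that] by simp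
    qed (use assms m C real_p_ge_1 fourth_trivial in \<open>auto simp: M_def m_def simp del: of_int_power\<close>)
    moreover have "fourth 0 = (\<Sum>w\<in>cube N. cmod (G X w) ^ 4)"
    proof -
      have "{0..<1::int} = {0}" by auto
      then show ?thesis by (simp add: fourth_def sector_0)
    qed
    moreover have "M * \<theta> ^ (2 * (n - 0)) * (of_int p ^ n * ?W) = M * \<theta> ^ (2 * n) * of_int p ^ (4 * n) * mass X"
    proof -
      have "real_of_int p ^ n * (of_int N ^ 3) = of_int p ^ (4 * n)"
        by (simp add: power_mult[symmetric] flip: power_add)
      then show ?thesis by (simp add: mult_ac del: of_int_power)
    qed
    ultimately show ?thesis by (simp only: mass_def)
  qed
  moreover have "m > 0" "M \<ge> 1" by (simp_all add: m_def M_def)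
  ultimately show ?thesis by blast
qed

section \<open>Incidences with slabs at one scale\<close>

lemma sum_power4_le:
  fixes f :: "'a \<Rightarrow> real"
  shows "(\<Sum>x\<in>S. f x) ^ 4 \<le> real (card S) ^ 3 * (\<Sum>x\<in>S. f x ^ 4)"
proof -
  let ?k = "real (card S)"
  have 1: "(\<Sum>x\<in>S. f x)\<^sup>2 \<le> ?k * (\<Sum>x\<in>S. (f x)\<^sup>2)"
    using sum_squared_le_sum_of_squares[of f S] by (simp add: mult.commute)
  have 2: "(\<Sum>x\<in>S. (f x)\<^sup>2)\<^sup>2 \<le> ?k * (\<Sum>x\<in>S. f x ^ 4)"
    using sum_squared_le_sum_of_squares[of "\<lambda>x. (f x)\<^sup>2" S] by (simp add: mult.commute flip: power_mult)
  have "(\<Sum>x\<in>S. f x) ^ 4 = ((\<Sum>x\<in>S. f x)\<^sup>2)\<^sup>2" by (simp flip: power_mult)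
  also have "\<dots> \<le> (?k * (\<Sum>x\<in>S. (f x)\<^sup>2))\<^sup>2" using 1 by (intro power_mono) auto
  also have "\<dots> = ?k\<^sup>2 * (\<Sum>x\<in>S. (f x)\<^sup>2)\<^sup>2" by (rule power_mult_distrib)
  also have "\<dots> \<le> ?k\<^sup>2 * (?k * (\<Sum>x\<in>S. f x ^ 4))" using 2 by (intro mult_left_mono) auto
  finally show ?thesis by (simp add: power2_eq_square power3_eq_cube mult.assoc)
qed

section \<open>Fourier coefficients of sets of residues\<close>

lemma e_mod_power_cancel:
  fixes p :: int
  assumes "p > 0" "l \<le> n"
  shows "e_mod (p ^ n) (p ^ l * k) = e_mod (p ^ (n - l)) k"
proof -
  have "real_of_int (p ^ n) = of_int (p ^ l) * of_int (p ^ (n - l))"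
    using assms(2) by (simp flip: power_add of_int_mult)
  then have "2 * pi * real_of_int (p ^ l * k) / real_of_int (p ^ n) = 2 * pi * real_of_int k / real_of_int (p ^ (n - l))"
    using assms(1) by (simp add: field_simps)
  then show ?thesis unfolding e_mod_def by (simp only:)
qed

lemma sum_e_mod_residue_class:
  fixes p :: int
  assumes p: "p > 0" and l: "l \<le> n" and s0: "0 \<le> s0" "s0 < p ^ l"
  shows "(\<Sum>s\<in>{s\<in>{0..<p ^ n}. s mod p ^ l = s0}. e_mod (p ^ n) (s * z))
    = (if p ^ (n - l) dvd z then of_int p ^ (n - l) * e_mod (p ^ n) (s0 * z) else 0)"
proof -
  have pl: "p ^ l > 0" "p ^ (n - l) > 0" using p by auto
  have pn: "p ^ n = p ^ l * p ^ (n - l)" using l by (simp flip: power_add)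
  have "(\<Sum>s\<in>{s\<in>{0..<p ^ n}. s mod p ^ l = s0}. e_mod (p ^ n) (s * z))
    = (\<Sum>t\<in>{0..<p ^ (n - l)}. e_mod (p ^ n) ((s0 + p ^ l * t) * z))"
  proof (rule sum.reindex_bij_witness[where i = "\<lambda>t. s0 + p ^ l * t" and j = "\<lambda>s. s div p ^ l"])
    fix s assume s: "s \<in> {s\<in>{0..<p ^ n}. s mod p ^ l = s0}"
    show eq: "s0 + p ^ l * (s div p ^ l) = s" using s by auto
    have "p ^ l * (s div p ^ l) < p ^ l * p ^ (n - l)" using s s0 eq by (auto simp: pn[symmetric])
    then show "s div p ^ l \<in> {0..<p ^ (n - l)}" using s pl by (auto simp: pos_imp_zdiv_nonneg_iff)
    show "e_mod (p ^ n) ((s0 + p ^ l * (s div p ^ l)) * z) = e_mod (p ^ n) (s * z)" by (simp only: eq)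
  next
    fix t assume t: "t \<in> {0..<p ^ (n - l)}"
    show "(s0 + p ^ l * t) div p ^ l = t"
      using s0 p by (subst div_mult_self2) (auto simp: div_pos_pos_trivial)
    have "p ^ l * (t + 1) \<le> p ^ n" unfolding pn using t pl by (intro mult_left_mono) auto
    then have "s0 + p ^ l * t < p ^ n" using s0 by (simp add: distrib_left)
    then show "s0 + p ^ l * t \<in> {s\<in>{0..<p ^ n}. s mod p ^ l = s0}" using s0 t pl by simp
  qed
  also have "\<dots> = e_mod (p ^ n) (s0 * z) * (\<Sum>t\<in>{0..<p ^ (n - l)}. e_mod (p ^ (n - l)) (z * t))"
    unfolding sum_distrib_left
    by (intro sum.cong refl)
      (simp only: distrib_right e_mod_add mult.assoc e_mod_power_cancel[OF p l] mult.commute[of z])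
  finally show ?thesis using sum_e_mod[OF pl(2), of z] by (simp add: mult.commute)
qed

definition lin :: "int \<Rightarrow> int3 \<Rightarrow> int" where
  "lin r w = dot3 (cone_pt (1, r)) w"

lemma dot3_commute: "dot3 v w = dot3 w v"
  by (cases v; cases w) (simp add: mult.commute)

lemma dot3_cone_pt: "dot3 (cone_pt (s, r)) w = s * lin r w"
  by (cases w) (simp add: lin_def algebra_simps)

text \<open>For \<open>x = (s, r)\<close> the Fourier coefficient at \<open>s\<close> of the
  indicator of \<open>S r\<close> modulo \<open>N\<close>. Summing over \<open>s\<close> against the
  characters of \<open>cone_pt (s, r)\<close> evaluates this indicator at
  \<open>lin r w\<close>.\<close>

definition fourier_set :: "int \<Rightarrow> (int \<Rightarrow> int set) \<Rightarrow> int \<times> int \<Rightarrow> complex" where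
  "fourier_set N S x = (\<Sum>y\<in>S (snd x). e_mod N (- (fst x * y))) / of_int N"

text \<open>Keeping one class of frequencies modulo \<open>p ^ l\<close> averages over residues
  modulo \<open>p ^ (n - l)\<close>, up to phases. Used with \<open>l = 0\<close> (the indicator
  itself), \<open>l = 1\<close> and \<open>s0 = 0\<close> (the average over the parent) and
  \<open>l = 2 * m\<close> (one height class).\<close>

lemma fourier_set_inversion:
  fixes p :: int
  assumes p: "p > 0" and l: "l \<le> n" and s0: "0 \<le> s0" "s0 < p ^ l" and fin: "finite (S r)"
  shows "(\<Sum>s\<in>{s\<in>{0..<p ^ n}. s mod p ^ l = s0}. fourier_set (p ^ n) S (s, r) * e_mod (p ^ n) (s * z))
    = (\<Sum>y\<in>{y\<in>S r. p ^ (n - l) dvd z - y}. e_mod (p ^ n) (s0 * (z - y))) / of_int p ^ l"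
proof -
  let ?N = "p ^ n"
  have eq: "e_mod ?N (- (s * y)) * e_mod ?N (s * z) = e_mod ?N (s * (z - y))" for s y
    by (simp add: e_mod_add[symmetric] algebra_simps)
  have N: "complex_of_int ?N = of_int p ^ l * of_int p ^ (n - l)" using l by (simp flip: power_add)
  have "(\<Sum>s\<in>{s\<in>{0..<?N}. s mod p ^ l = s0}. fourier_set ?N S (s, r) * e_mod ?N (s * z))
    = (\<Sum>s\<in>{s\<in>{0..<?N}. s mod p ^ l = s0}. \<Sum>y\<in>S r. e_mod ?N (s * (z - y)) / of_int ?N)"
    by (simp add: fourier_set_def sum_divide_distrib sum_distrib_right eq)
  also have "\<dots> = (\<Sum>y\<in>S r. (\<Sum>s\<in>{s\<in>{0..<?N}. s mod p ^ l = s0}. e_mod ?N (s * (z - y))) / of_int ?N)"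
    by (subst sum.swap) (simp only: sum_divide_distrib)
  also have "\<dots> = (\<Sum>y\<in>S r. if p ^ (n - l) dvd z - y then e_mod ?N (s0 * (z - y)) / of_int p ^ l else 0)"
    unfolding sum_e_mod_residue_class[OF p l s0] N using p by (intro sum.cong refl) simp
  also have "\<dots> = (\<Sum>y\<in>{y\<in>S r. p ^ (n - l) dvd z - y}. e_mod ?N (s0 * (z - y))) / of_int p ^ l"
    using fin by (simp add: sum.inter_filter[symmetric] sum_divide_distrib)
  finally show ?thesis .
qed

lemma fourier_set_parseval:
  assumes N: "N > 0" and S: "S r \<subseteq> {0..<N}"
  shows "(\<Sum>s\<in>{0..<N}. (cmod (fourier_set N S (s, r)))\<^sup>2) = real (card (S r)) / of_int N"
proof -
  have fin: "finite (S r)" using S finite_subset by blast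
  have "complex_of_real ((cmod (fourier_set N S (s, r)))\<^sup>2)
      = (\<Sum>y\<in>S r. \<Sum>y'\<in>S r. e_mod N ((y' - y) * s) / of_int N ^ 2)" for s
  proof -
    have "e_mod N (- (s * y)) * cnj (e_mod N (- (s * y'))) = e_mod N ((y' - y) * s)" for y y'
      by (simp add: e_mod_diff[symmetric] algebra_simps)
    then have "(\<Sum>y\<in>S r. e_mod N (- (s * y))) * cnj (\<Sum>y\<in>S r. e_mod N (- (s * y)))
        = (\<Sum>y\<in>S r. \<Sum>y'\<in>S r. e_mod N ((y' - y) * s))"
      by (simp add: sum_product)
    then show ?thesis
      by (simp only: complex_norm_square fourier_set_def complex_cnj_divide complex_cnj_of_int
          times_divide_times_eq sum_divide_distrib[symmetric] fst_conv snd_conv power2_eq_square[symmetric])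
  qed
  then have "complex_of_real (\<Sum>s\<in>{0..<N}. (cmod (fourier_set N S (s, r)))\<^sup>2)
      = (\<Sum>s\<in>{0..<N}. \<Sum>y\<in>S r. \<Sum>y'\<in>S r. e_mod N ((y' - y) * s) / of_int N ^ 2)"
    by (simp only: of_real_sum)
  also have "\<dots> = (\<Sum>y\<in>S r. \<Sum>y'\<in>S r. (\<Sum>s\<in>{0..<N}. e_mod N ((y' - y) * s)) / of_int N ^ 2)"
    unfolding sum_divide_distrib by (subst sum.swap, rule sum.cong[OF refl], rule sum.swap)
  also have "\<dots> = (\<Sum>y\<in>S r. \<Sum>y'\<in>S r. if y' = y then 1 / of_int N else 0)"
  proof (intro sum.cong refl)
    fix y y' assume "y \<in> S r" "y' \<in> S r"
    then have "N dvd y' - y \<longleftrightarrow> y' = y" using S by (auto simp: mod_eq_dvd_iff[symmetric] subset_eq)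
    then show "(\<Sum>s\<in>{0..<N}. e_mod N ((y' - y) * s)) / of_int N ^ 2 = (if y' = y then 1 / of_int N else 0)"
      using N by (simp add: sum_e_mod power2_eq_square)
  qed
  also have "\<dots> = complex_of_real (real (card (S r)) / of_int N)"
    using fin by simp
  finally show ?thesis by (simp only: of_real_eq_iff)
qed

section \<open>Rich slabs and their high-frequency part\<close>

definition slab_count :: "int \<Rightarrow> 'b set \<Rightarrow> ('b \<Rightarrow> int3) \<Rightarrow> int \<Rightarrow> int \<Rightarrow> nat" where
  "slab_count q F u r y = card {w\<in>F. q dvd lin r (u w) - y}"

text \<open>At the fixed scale \<open>n\<close>, \<open>\<Lambda>\<close> is the proportion of
  \<open>F\<close> from which a slab counts as rich, \<open>\<kappa>\<close> bounds the proportion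
  in a cell, and \<open>\<beta>\<close> is the share left to the low frequencies. The fourth moment
  estimate is a parameter of the locale, so that one choice of \<open>m\<close> and \<open>M\<close>
  serves all scales.\<close>

locale slab_family =
  fixes p :: int and n m :: nat and F :: "'b set" and u :: "'b \<Rightarrow> int3" and \<Lambda> \<beta> \<kappa> M \<theta> :: real
  assumes prime_p: "prime p" and p_gt_2: "p > 2" and n: "0 < n" "2 * m \<le> n" and m_pos: "0 < m"
    and F: "finite F" and Lam: "\<Lambda> > 0" and beta: "0 \<le> \<beta>"
    and cells: "\<And>v. real (card {w\<in>F. dvd3 (p ^ n) (u w - v)}) \<le> \<kappa> * real (card F)"
    and fourth_moment: "\<And>X a. cone_sum p n m X a \<Longrightarrow> (\<Sum>w\<in>cube (p ^ n). cmod (exp_sum (p ^ n) a X w) ^ 4)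
      \<le> M * \<theta> ^ (2 * n) * of_int p ^ (4 * n) * (\<Sum>x\<in>X. (cmod (a x))\<^sup>2)"
    and M: "M \<ge> 0" and theta: "\<theta> \<ge> 0"
begin

abbreviation N :: int where "N \<equiv> p ^ n"

text \<open>
  Slabs that are rich at scale \<open>n\<close> while their parents at scale \<open>n - 1\<close> are not: for these, the
  frequencies divisible by \<open>p\<close> contribute at most the fraction \<open>\<beta>\<close> of the incidences.
\<close>

definition rich :: "int \<Rightarrow> int set" where
  "rich r = {y\<in>{0..<N}. \<Lambda> * real (card F) < real (slab_count N F u r y)
    \<and> real (slab_count (p ^ (n - 1)) F u r y) \<le> of_int p * \<beta> * (\<Lambda> * real (card F))}"

abbreviation coef :: "int \<times> int \<Rightarrow> complex" where "coef \<equiv> fourier_set N rich"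

definition freqs :: "int \<Rightarrow> (int \<times> int) set" where
  "freqs s0 = {(s, r). s \<in> {0..<N} \<and> r \<in> {0..<N} \<and> s mod p ^ (2 * m) = s0}"

definition units :: "int set" where
  "units = {s0\<in>{0..<p ^ (2 * m)}. \<not> p dvd s0}"

lemma p_pos: "p > 0" and N_pos: "N > 0" using p_gt_2 by auto

lemma rich_subset: "rich r \<subseteq> {0..<N}"
  by (auto simp: rich_def)

lemma finite_rich [simp]: "finite (rich r)"
  unfolding rich_def by (rule finite_subset[of _ "{0..<N}"]) auto

lemma finite_freqs [simp]: "finite (freqs s0)"
  by (rule finite_subset[of _ "{0..<N} \<times> {0..<N}"]) (auto simp: freqs_def)

lemma finite_units [simp]: "finite units"
  unfolding units_def by (rule finite_subset[of _ "{0..<p ^ (2 * m)}"]) auto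

lemma card_units: "real (card units) \<le> of_int p ^ (2 * m)"
proof -
  have "card units \<le> card {0..<p ^ (2 * m)}" unfolding units_def by (intro card_mono) auto
  also have "real \<dots> = of_int p ^ (2 * m)" using p_pos by simp
  finally show ?thesis by simp
qed

lemma exp_sum_ray:
  assumes "r \<in> {0..<N}"
  shows "exp_sum N coef {x\<in>freqs s0. snd x = r} w
    = (\<Sum>s\<in>{s\<in>{0..<N}. s mod p ^ (2 * m) = s0}. coef (s, r) * e_mod N (s * lin r w))"
proof -
  have "{x\<in>freqs s0. snd x = r} = (\<lambda>s. (s, r)) ` {s\<in>{0..<N}. s mod p ^ (2 * m) = s0}"
    using assms by (auto simp: freqs_def)
  then show ?thesis unfolding exp_sum_def
    by (simp add: sum.reindex inj_on_def dot3_cone_pt del: cone_pt.simps)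
qed

text \<open>By \<open>fourier_set_inversion\<close> the ray sum of one height class is a sum of
  unimodular terms over the elements of \<open>rich r\<close> in one residue class modulo
  \<open>p ^ (n - 2 * m)\<close>, divided by \<open>p ^ (2 * m)\<close>. The class has
  \<open>p ^ (2 * m)\<close> elements, whence the 1 of \<open>ray_bound\<close>.\<close>

lemma cone_sum_freqs:
  assumes "s0 \<in> units"
  shows "cone_sum p n m (freqs s0) coef"
proof
  show "prime p" "p > 2" "finite (freqs s0)" by (simp_all add: prime_p p_gt_2)
  fix x assume x: "x \<in> freqs s0"
  show "\<not> p dvd fst x"
  proof
    assume "p dvd fst x"
    moreover have "p dvd p ^ (2 * m)" using m_pos by (simp add: dvd_power)
    ultimately have "p dvd fst x mod p ^ (2 * m)" by (simp add: dvd_mod_iff)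
    then show False using x assms by (auto simp: freqs_def units_def)
  qed
  show "0 \<le> fst x \<and> fst x < N \<and> 0 \<le> snd x \<and> snd x < N" using x by (auto simp: freqs_def)
  fix y assume y: "y \<in> freqs s0"
  show "p ^ (2 * m) dvd fst x - fst y"
    using x y by (auto simp: freqs_def mod_eq_dvd_iff[symmetric])
next
  fix r w
  show "cmod (exp_sum N coef {x\<in>freqs s0. snd x = r} w) \<le> 1"
  proof (cases "r \<in> {0..<N}")
    case False
    then have "{x\<in>freqs s0. snd x = r} = {}" by (auto simp: freqs_def)
    then show ?thesis by (simp only: exp_sum_def) simp
  next
    case True
    let ?l = "2 * m"
    have s0: "0 \<le> s0" "s0 < p ^ ?l" using assms by (auto simp: units_def)
    let ?Y = "{y\<in>rich r. p ^ (n - ?l) dvd lin r w - y}"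
    have pl: "p ^ (n - ?l) > 0" using p_pos by simp
    have "exp_sum N coef {x\<in>freqs s0. snd x = r} w
        = (\<Sum>y\<in>?Y. e_mod N (s0 * (lin r w - y))) / of_int p ^ ?l"
      unfolding exp_sum_ray[OF True] by (rule fourier_set_inversion[OF p_pos n(2) s0]) simp
    then have "cmod (exp_sum N coef {x\<in>freqs s0. snd x = r} w)
        = cmod (\<Sum>y\<in>?Y. e_mod N (s0 * (lin r w - y))) / of_int p ^ ?l"
      using p_pos by (simp add: norm_divide norm_power)
    also have "\<dots> \<le> real (card ?Y) / of_int p ^ ?l"
      using p_pos sum_norm_le[of ?Y "\<lambda>y. e_mod N (s0 * (lin r w - y))" "\<lambda>_. 1"]
      by (intro divide_right_mono) auto
    also have "real (card ?Y) \<le> of_int p ^ ?l"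
    proof -
      have "?Y \<subseteq> {y\<in>{0..<N}. y mod p ^ (n - ?l) = lin r w mod p ^ (n - ?l)}"
        by (auto simp: rich_def mod_eq_dvd_iff dvd_diff_commute)
      then have "card ?Y \<le> card {y\<in>{0..<N}. y mod p ^ (n - ?l) = lin r w mod p ^ (n - ?l)}"
        by (intro card_mono) (auto intro: finite_subset[of _ "{0..<N}"])
      also have "real \<dots> = of_int p ^ (n - (n - ?l))"
        using pl by (intro card_residues[OF p_pos]) auto
      finally show ?thesis using n(2) by simp
    qed
    finally show ?thesis using p_pos by (simp add: divide_right_mono)
  qed
qed

lemma sum_slab_count:
  assumes "finite Y" "Y \<subseteq> {0..<N}"
  shows "(\<Sum>y\<in>Y. slab_count N F u r y) = card {w\<in>F. lin r (u w) mod N \<in> Y}"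
proof -
  have "slab_count N F u r y = card {w\<in>F. lin r (u w) mod N = y}" if "y \<in> Y" for y
    using that assms(2) unfolding slab_count_def
    by (intro arg_cong[where f = card] Collect_cong) (auto simp: mod_eq_dvd_iff[symmetric] subset_eq)
  then have "(\<Sum>y\<in>Y. slab_count N F u r y) = (\<Sum>y\<in>Y. card {w\<in>F. lin r (u w) mod N = y})" by simp
  also have "\<dots> = card (\<Union>y\<in>Y. {w\<in>F. lin r (u w) mod N = y})"
    using F assms(1) by (subst card_UN_disjoint) auto
  also have "(\<Union>y\<in>Y. {w\<in>F. lin r (u w) mod N = y}) = {w\<in>F. lin r (u w) mod N \<in> Y}" by auto
  finally show ?thesis .
qed

text \<open>The slabs of one direction are disjoint, and each rich one takes more than the
  proportion \<open>\<Lambda>\<close> of \<open>F\<close>.\<close>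

lemma card_rich:
  assumes "F \<noteq> {}"
  shows "real (card (rich r)) \<le> 1 / \<Lambda>"
proof -
  have F0: "real (card F) > 0" using F assms by (simp add: card_gt_0_iff)
  have "real (card (rich r)) * (\<Lambda> * real (card F)) \<le> (\<Sum>y\<in>rich r. real (slab_count N F u r y))"
    using sum_mono[of "rich r" "\<lambda>_. \<Lambda> * real (card F)" "\<lambda>y. real (slab_count N F u r y)"]
    by (auto simp: rich_def)
  also have "\<dots> = real (card {w\<in>F. lin r (u w) mod N \<in> rich r})"
    by (subst sum_slab_count[symmetric]) (simp_all add: rich_subset)
  also have "\<dots> \<le> real (card F)" using F by (simp add: card_mono)
  finally have "(real (card (rich r)) * \<Lambda>) * real (card F) \<le> 1 * real (card F)" by (simp add: mult.assoc)
  then have "real (card (rich r)) * \<Lambda> \<le> 1" using F0 by (simp only: mult_le_cancel_right_pos)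
  then show ?thesis using Lam by (simp add: field_simps)
qed

text \<open>Parseval in \<open>s\<close> gives \<open>card (rich r) / N\<close> for each of the
  \<open>N\<close> directions.\<close>

lemma mass_freqs:
  assumes "F \<noteq> {}"
  shows "(\<Sum>x\<in>freqs s0. (cmod (coef x))\<^sup>2) \<le> 1 / \<Lambda>"
proof -
  have "(\<Sum>x\<in>freqs s0. (cmod (coef x))\<^sup>2) \<le> (\<Sum>x\<in>{0..<N} \<times> {0..<N}. (cmod (coef x))\<^sup>2)"
    by (intro sum_mono2) (auto simp: freqs_def)
  also have "\<dots> = (\<Sum>s\<in>{0..<N}. \<Sum>r\<in>{0..<N}. (cmod (coef (s, r)))\<^sup>2)"
    by (simp add: sum.cartesian_product)
  also have "\<dots> = (\<Sum>r\<in>{0..<N}. \<Sum>s\<in>{0..<N}. (cmod (coef (s, r)))\<^sup>2)"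
    by (rule sum.swap)
  also have "\<dots> = (\<Sum>r\<in>{0..<N}. real (card (rich r)) / of_int N)"
    by (intro sum.cong refl fourier_set_parseval[OF N_pos]) (auto simp: rich_def)
  also have "\<dots> \<le> (\<Sum>r\<in>{0..<N}. (1 / \<Lambda>) / of_int N)"
    using N_pos by (intro sum_mono divide_right_mono card_rich[OF assms]) (auto simp del: of_int_power)
  also have "\<dots> = 1 / \<Lambda>" using p_pos by simp
  finally show ?thesis .
qed

text \<open>The high-frequency part \<open>G\<close> of the overview, cut into height classes so
  that the fourth moment estimate applies to each piece.\<close>

definition total :: "int3 \<Rightarrow> complex" where
  "total w = (\<Sum>s0\<in>units. exp_sum N coef (freqs s0) w)"

text \<open>With at most \<open>p ^ (2 * m)\<close> height classes, the power mean inequality costs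
  their number cubed and the sum over the classes once more; hence \<open>8 * m\<close>.\<close>

lemma total_fourth_moment:
  assumes "F \<noteq> {}"
  shows "(\<Sum>w\<in>cube N. cmod (total w) ^ 4)
    \<le> of_int p ^ (8 * m) * (M * \<theta> ^ (2 * n) * of_int p ^ (4 * n) / \<Lambda>)"
proof -
  let ?B = "M * \<theta> ^ (2 * n) * of_int p ^ (4 * n) / \<Lambda>"
  let ?q = "real_of_int p ^ (2 * m)"
  have q0: "?q \<ge> 0" using p_pos by simp
  have B0: "?B \<ge> 0" using M theta Lam p_pos by simp
  have "cmod (total w) ^ 4 \<le> ?q ^ 3 * (\<Sum>s0\<in>units. cmod (exp_sum N coef (freqs s0) w) ^ 4)" for w
  proof -
    have "cmod (total w) ^ 4 \<le> (\<Sum>s0\<in>units. cmod (exp_sum N coef (freqs s0) w)) ^ 4"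
      unfolding total_def by (intro power_mono norm_sum) simp
    also have "\<dots> \<le> real (card units) ^ 3 * (\<Sum>s0\<in>units. cmod (exp_sum N coef (freqs s0) w) ^ 4)"
      by (rule sum_power4_le)
    also have "\<dots> \<le> ?q ^ 3 * (\<Sum>s0\<in>units. cmod (exp_sum N coef (freqs s0) w) ^ 4)"
      using card_units by (intro mult_right_mono power_mono sum_nonneg) auto
    finally show ?thesis .
  qed
  then have "(\<Sum>w\<in>cube N. cmod (total w) ^ 4)
      \<le> (\<Sum>w\<in>cube N. ?q ^ 3 * (\<Sum>s0\<in>units. cmod (exp_sum N coef (freqs s0) w) ^ 4))"
    by (rule sum_mono)
  also have "\<dots> = ?q ^ 3 * (\<Sum>s0\<in>units. \<Sum>w\<in>cube N. cmod (exp_sum N coef (freqs s0) w) ^ 4)"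
    unfolding sum_distrib_left[symmetric] by (subst sum.swap) simp
  also have "\<dots> \<le> ?q ^ 3 * (\<Sum>s0\<in>units. ?B)"
  proof (intro mult_left_mono sum_mono)
    fix s0 assume "s0 \<in> units"
    then have "(\<Sum>w\<in>cube N. cmod (exp_sum N coef (freqs s0) w) ^ 4)
        \<le> M * \<theta> ^ (2 * n) * of_int p ^ (4 * n) * (\<Sum>x\<in>freqs s0. (cmod (coef x))\<^sup>2)"
      by (intro fourth_moment cone_sum_freqs)
    also have "\<dots> \<le> M * \<theta> ^ (2 * n) * of_int p ^ (4 * n) * (1 / \<Lambda>)"
      using M theta p_pos by (intro mult_left_mono mass_freqs[OF assms]) simp
    finally show "(\<Sum>w\<in>cube N. cmod (exp_sum N coef (freqs s0) w) ^ 4) \<le> ?B" by simp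
  qed (use q0 in simp)
  also have "\<dots> \<le> ?q ^ 3 * (?q * ?B)"
  proof (rule mult_left_mono)
    show "(\<Sum>s0\<in>units. ?B) \<le> ?q * ?B"
      unfolding sum_constant by (rule mult_right_mono[OF card_units B0])
  qed (use q0 in simp)
  also have "\<dots> = of_int p ^ (8 * m) * ?B"
  proof -
    have "?q ^ 3 * ?q = of_int p ^ (8 * m)" by (simp flip: power_mult power_Suc2 power_add)
    then show ?thesis by (simp only: mult.assoc[symmetric])
  qed
  finally show ?thesis .
qed

text \<open>The frequencies prime to \<open>p\<close> are all frequencies minus those divisible by
  \<open>p\<close>: the indicators of the rich slabs minus their averages over the parents at scale
  \<open>n - 1\<close>.\<close>

lemma total_eq:
  "total w = of_real (\<Sum>r\<in>{0..<N}. real (card {y\<in>rich r. N dvd lin r w - y})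
    - real (card {y\<in>rich r. p ^ (n - 1) dvd lin r w - y}) / of_int p)"
proof -
  let ?t = "\<lambda>r s. coef (s, r) * e_mod N (s * lin r w)"
  let ?l = "2 * m"
  have "total w = (\<Sum>s0\<in>units. \<Sum>r\<in>{0..<N}. \<Sum>s\<in>{s\<in>{0..<N}. s mod p ^ ?l = s0}. ?t r s)"
    unfolding total_def
  proof (rule sum.cong[OF refl])
    fix s0
    have "freqs s0 = (\<lambda>(r, s). (s, r)) ` ({0..<N} \<times> {s\<in>{0..<N}. s mod p ^ ?l = s0})"
      by (auto simp: freqs_def)
    then show "exp_sum N coef (freqs s0) w = (\<Sum>r\<in>{0..<N}. \<Sum>s\<in>{s\<in>{0..<N}. s mod p ^ ?l = s0}. ?t r s)"
      unfolding exp_sum_def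
      by (simp add: sum.reindex inj_on_def dot3_cone_pt sum.cartesian_product split_def del: cone_pt.simps)
  qed
  also have "\<dots> = (\<Sum>r\<in>{0..<N}. \<Sum>s0\<in>units. \<Sum>s\<in>{s\<in>{0..<N}. s mod p ^ ?l = s0}. ?t r s)"
    by (rule sum.swap)
  also have "\<dots> = (\<Sum>r\<in>{0..<N}. \<Sum>s\<in>{s\<in>{0..<N}. \<not> p dvd s}. ?t r s)"
  proof (rule sum.cong[OF refl])
    fix r
    have dvd_iff: "p dvd s mod p ^ ?l \<longleftrightarrow> p dvd s" for s
      using m_pos by (intro dvd_mod_iff) (simp add: dvd_power)
    have "(\<Sum>s0\<in>units. \<Sum>s\<in>{s\<in>{s\<in>{0..<N}. \<not> p dvd s}. s mod p ^ ?l = s0}. ?t r s)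
        = (\<Sum>s\<in>{s\<in>{0..<N}. \<not> p dvd s}. ?t r s)"
    proof (rule sum.group)
      show "finite {s\<in>{0..<N}. \<not> p dvd s}" by (rule finite_subset[of _ "{0..<N}"]) auto
      show "(\<lambda>s. s mod p ^ ?l) ` {s\<in>{0..<N}. \<not> p dvd s} \<subseteq> units"
        using p_pos by (auto simp: units_def dvd_iff)
    qed simp
    moreover have "{s\<in>{s\<in>{0..<N}. \<not> p dvd s}. s mod p ^ ?l = s0} = {s\<in>{0..<N}. s mod p ^ ?l = s0}"
      if "s0 \<in> units" for s0
      using that by (auto simp: units_def) (metis dvd_iff)
    ultimately show "(\<Sum>s0\<in>units. \<Sum>s\<in>{s\<in>{0..<N}. s mod p ^ ?l = s0}. ?t r s)
        = (\<Sum>s\<in>{s\<in>{0..<N}. \<not> p dvd s}. ?t r s)" by simp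
  qed
  also have "\<dots> = (\<Sum>r\<in>{0..<N}. of_real (real (card {y\<in>rich r. N dvd lin r w - y})
    - real (card {y\<in>rich r. p ^ (n - 1) dvd lin r w - y}) / of_int p))"
  proof (rule sum.cong[OF refl])
    fix r
    have "(\<Sum>s\<in>{0..<N}. ?t r s) = (\<Sum>s\<in>{s\<in>{0..<N}. \<not> p dvd s}. ?t r s) + (\<Sum>s\<in>{s\<in>{0..<N}. p dvd s}. ?t r s)"
      by (subst sum.union_disjoint[symmetric]) (auto intro!: sum.cong intro: finite_subset[of _ "{0..<N}"])
    moreover have "(\<Sum>s\<in>{0..<N}. ?t r s) = of_nat (card {y\<in>rich r. N dvd lin r w - y})"
    proof -
      have "{s\<in>{0..<N}. s mod p ^ 0 = 0} = {0..<N}" by auto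
      then show ?thesis
        using fourier_set_inversion[of p 0 n 0 rich r "lin r w"] p_pos by (simp only:) simp
    qed
    moreover have "(\<Sum>s\<in>{s\<in>{0..<N}. p dvd s}. ?t r s) = of_nat (card {y\<in>rich r. p ^ (n - 1) dvd lin r w - y}) / of_int p"
      using fourier_set_inversion[of p 1 n 0 rich r "lin r w"] p_pos n(1) by (simp add: dvd_eq_mod_eq_0)
    ultimately show "(\<Sum>s\<in>{s\<in>{0..<N}. \<not> p dvd s}. ?t r s) = of_real (real (card {y\<in>rich r. N dvd lin r w - y})
    - real (card {y\<in>rich r. p ^ (n - 1) dvd lin r w - y}) / of_int p)"
      by (simp add: algebra_simps)
  qed
  finally show ?thesis by simp
qed

lemma sum_card_swap:
  assumes "finite Y"
  shows "(\<Sum>w\<in>F. card {y\<in>Y. q dvd lin r (u w) - y}) = (\<Sum>y\<in>Y. slab_count q F u r y)"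
proof -
  have "(\<Sum>w\<in>F. card {y\<in>Y. q dvd lin r (u w) - y}) = (\<Sum>w\<in>F. \<Sum>y\<in>Y. if q dvd lin r (u w) - y then 1 else 0)"
    using assms by (simp add: sum.If_cases Int_def)
  also have "\<dots> = (\<Sum>y\<in>Y. \<Sum>w\<in>F. if q dvd lin r (u w) - y then 1 else 0)" by (rule sum.swap)
  also have "\<dots> = (\<Sum>y\<in>Y. slab_count q F u r y)"
    using F by (simp add: slab_count_def sum.If_cases Int_def)
  finally show ?thesis .
qed

definition incidences :: real where
  "incidences = (\<Sum>r\<in>{0..<N}. real (card {w\<in>F. lin r (u w) mod N \<in> rich r}))"

text \<open>Summed over \<open>F\<close>, the subtracted averages count the points of the parents
  with weight \<open>1 / p\<close>; the second condition in \<open>rich\<close> bounds them by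
  \<open>\<beta>\<close> times the incidences.\<close>

lemma total_sum_ge: "(1 - \<beta>) * incidences \<le> cmod (\<Sum>w\<in>F. total (u w))"
proof -
  let ?a = "\<lambda>r. real (\<Sum>y\<in>rich r. slab_count N F u r y)"
  let ?b = "\<lambda>r. real (\<Sum>y\<in>rich r. slab_count (p ^ (n - 1)) F u r y) / of_int p"
  have "(\<Sum>w\<in>F. total (u w)) = of_real (\<Sum>w\<in>F. \<Sum>r\<in>{0..<N}. real (card {y\<in>rich r. N dvd lin r (u w) - y})
    - real (card {y\<in>rich r. p ^ (n - 1) dvd lin r (u w) - y}) / of_int p)"
    unfolding total_eq by (simp only: of_real_sum)
  also have "(\<Sum>w\<in>F. \<Sum>r\<in>{0..<N}. real (card {y\<in>rich r. N dvd lin r (u w) - y})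
    - real (card {y\<in>rich r. p ^ (n - 1) dvd lin r (u w) - y}) / of_int p) = (\<Sum>r\<in>{0..<N}. ?a r - ?b r)"
    by (subst sum.swap)
      (simp only: sum_subtractf sum_divide_distrib[symmetric] sum_card_swap[OF finite_rich] flip: of_nat_sum)
  finally have eq: "cmod (\<Sum>w\<in>F. total (u w)) = \<bar>\<Sum>r\<in>{0..<N}. ?a r - ?b r\<bar>" by (simp only: norm_of_real)
  have b: "?b r \<le> \<beta> * ?a r" for r
  proof -
    have "real (slab_count (p ^ (n - 1)) F u r y) \<le> of_int p * \<beta> * real (slab_count N F u r y)"
      if "y \<in> rich r" for y
    proof -
      have "real (slab_count (p ^ (n - 1)) F u r y) \<le> of_int p * \<beta> * (\<Lambda> * real (card F))"
        using that by (simp add: rich_def)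
      also have "\<dots> \<le> of_int p * \<beta> * real (slab_count N F u r y)"
        using that p_pos beta by (intro mult_left_mono) (auto simp: rich_def)
      finally show ?thesis .
    qed
    then have "real (\<Sum>y\<in>rich r. slab_count (p ^ (n - 1)) F u r y) \<le> of_int p * \<beta> * ?a r"
      unfolding of_nat_sum sum_distrib_left by (rule sum_mono)
    then show ?thesis using p_pos by (simp add: field_simps)
  qed
  have "(1 - \<beta>) * incidences = (\<Sum>r\<in>{0..<N}. ?a r - \<beta> * ?a r)"
  proof -
    have "card {w\<in>F. lin r (u w) mod N \<in> rich r} = (\<Sum>y\<in>rich r. slab_count N F u r y)" for r
      by (rule sum_slab_count[symmetric]) (simp_all add: rich_subset)
    then show ?thesis unfolding incidences_def by (simp only: sum_distrib_left left_diff_distrib mult_1)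
  qed
  also have "\<dots> \<le> (\<Sum>r\<in>{0..<N}. ?a r - ?b r)" by (intro sum_mono diff_left_mono b)
  also have "\<dots> \<le> cmod (\<Sum>w\<in>F. total (u w))" unfolding eq by simp
  finally show ?thesis .
qed

lemma total_periodic: "total (mod3 v N) = total v"
proof -
  have "dvd3 N (v - mod3 v N)" using dvd3_diff_iff_mod3[OF mod3_in_cube[OF N_pos]] by blast
  then have "N dvd dot3 c (mod3 v N) - dot3 c v" for c
  proof -
    have "N dvd dot3 (v - mod3 v N) c" by (rule dvd3_dot3) fact
    then show ?thesis by (metis dot3_commute dot3_diff dvd_diff_commute)
  qed
  then have "e_mod N (dot3 c (mod3 v N)) = e_mod N (dot3 c v)" for c by (rule e_mod_cong)
  then show ?thesis by (simp only: total_def exp_sum_def)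
qed

text \<open>After a power mean inequality over \<open>F\<close>, \<open>cells\<close> passes from
  \<open>F\<close> to the whole cube, as each residue class holds at most
  \<open>\<kappa> * card F\<close> points. The factor \<open>p ^ (4 * n)\<close> of the fourth
  moment is the fourth power of the number of directions and cancels.\<close>

lemma incidences_bound:
  assumes "F \<noteq> {}" "\<beta> < 1"
  shows "((1 - \<beta>) * incidences / (real (card F) * of_int N)) ^ 4
    \<le> of_int p ^ (8 * m) * M * \<theta> ^ (2 * n) * \<kappa> / \<Lambda>"
proof -
  have F0: "real (card F) > 0" using F assms by (simp add: card_gt_0_iff)
  have I0: "incidences \<ge> 0" unfolding incidences_def by (intro sum_nonneg) simp
  have N0: "real_of_int N > 0" using N_pos by (simp only: of_int_0_less_iff)
  have "((1 - \<beta>) * incidences) ^ 4 \<le> (\<Sum>w\<in>F. cmod (total (u w))) ^ 4"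
    using I0 assms(2) by (intro power_mono order_trans[OF total_sum_ge norm_sum]) auto
  also have "\<dots> \<le> real (card F) ^ 3 * (\<Sum>w\<in>F. cmod (total (u w)) ^ 4)" by (rule sum_power4_le)
  also have "(\<Sum>w\<in>F. cmod (total (u w)) ^ 4) = (\<Sum>v\<in>cube N. \<Sum>w\<in>{w\<in>F. mod3 (u w) N = v}. cmod (total (u w)) ^ 4)"
    by (rule sum.group[symmetric]) (simp_all add: F image_subsetI mod3_in_cube[OF N_pos])
  also have "\<dots> = (\<Sum>v\<in>cube N. real (card {w\<in>F. mod3 (u w) N = v}) * cmod (total v) ^ 4)"
  proof (rule sum.cong[OF refl])
    fix v
    have "cmod (total (u w)) ^ 4 = cmod (total v) ^ 4" if "w \<in> {w\<in>F. mod3 (u w) N = v}" for w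
      using that total_periodic[of "u w"] by auto
    then show "(\<Sum>w\<in>{w\<in>F. mod3 (u w) N = v}. cmod (total (u w)) ^ 4)
        = real (card {w\<in>F. mod3 (u w) N = v}) * cmod (total v) ^ 4"
      by (simp only: sum_constant cong: sum.cong)
  qed
  also have "\<dots> \<le> (\<Sum>v\<in>cube N. (\<kappa> * real (card F)) * cmod (total v) ^ 4)"
  proof (intro sum_mono mult_right_mono)
    fix v assume "v \<in> cube N"
    then have "{w\<in>F. mod3 (u w) N = v} = {w\<in>F. dvd3 N (u w - v)}"
      using dvd3_diff_iff_mod3 by auto
    then show "real (card {w\<in>F. mod3 (u w) N = v}) \<le> \<kappa> * real (card F)" using cells[of v] by simp
  qed simp
  also have "\<dots> = \<kappa> * real (card F) * (\<Sum>v\<in>cube N. cmod (total v) ^ 4)" by (simp only: sum_distrib_left)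
  also have "\<dots> \<le> \<kappa> * real (card F) * (of_int p ^ (8 * m) * (M * \<theta> ^ (2 * n) * of_int p ^ (4 * n) / \<Lambda>))"
  proof (intro mult_left_mono total_fourth_moment[OF assms(1)])
    show "0 \<le> \<kappa> * real (card F)" using cells[of 0] by (meson of_nat_0_le_iff order_trans)
  qed
  finally have "((1 - \<beta>) * incidences) ^ 4
      \<le> real (card F) ^ 3 * (\<kappa> * real (card F) * (of_int p ^ (8 * m) * (M * \<theta> ^ (2 * n) * of_int p ^ (4 * n) / \<Lambda>)))"
    by (simp add: mult_left_mono)
  also have "\<dots> = (of_int p ^ (8 * m) * M * \<theta> ^ (2 * n) * \<kappa> / \<Lambda>) * (real (card F) * of_int N) ^ 4"
  proof -
    have "real_of_int p ^ (4 * n) = of_int N ^ 4" by (simp add: power_mult[symmetric] mult.commute)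
    then show ?thesis by (simp add: power_mult_distrib power4_eq_xxxx power3_eq_cube)
  qed
  finally have "((1 - \<beta>) * incidences) ^ 4
      \<le> (of_int p ^ (8 * m) * M * \<theta> ^ (2 * n) * \<kappa> / \<Lambda>) * (real (card F) * of_int N) ^ 4" .
  moreover have "0 < (real (card F) * of_int N) ^ 4" using F0 N0 by (intro zero_less_power mult_pos_pos)
  ultimately show ?thesis unfolding power_divide by (simp only: pos_divide_le_eq)
qed

end

section \<open>Restricted projections of integer points\<close>

lemma lin_cong: "q dvd r - r' \<Longrightarrow> q dvd lin r v - lin r' v"
proof (cases v)
  case (fields v1 v2 v3)
  assume "q dvd r - r'"
  moreover have "lin r v - lin r' v = (r - r') * (v2 + (r + r') * v3)"
    by (simp add: fields lin_def algebra_simps power2_eq_square)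
  ultimately show ?thesis by simp
qed

lemma slab_count_cong:
  assumes "q dvd r - r'" "q dvd y - y'"
  shows "slab_count q F u r y = slab_count q F u r' y'"
proof -
  have "q dvd lin r (u w) - y \<longleftrightarrow> q dvd lin r' (u w) - y'" for w
  proof -
    have "q dvd (lin r (u w) - y) - (lin r' (u w) - y')"
      using dvd_diff[OF lin_cong[OF assms(1), of "u w"] assms(2)] by (simp add: algebra_simps)
    then show ?thesis by (metis dvd_diff dvd_diff_right_iff dvd_diff_left_iff)
  qed
  then show ?thesis by (simp only: slab_count_def)
qed

lemma sum_mod_prime_pow:
  fixes p :: int and g :: "int \<Rightarrow> real"
  assumes "p > 0" "n \<le> L"
  shows "(\<Sum>r\<in>{0..<p ^ L}. g (r mod p ^ n)) = of_int p ^ (L - n) * (\<Sum>r\<in>{0..<p ^ n}. g r)"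
proof -
  have "(\<Sum>r\<in>{0..<p ^ L}. g (r mod p ^ n))
      = (\<Sum>c\<in>{0..<p ^ n}. \<Sum>r\<in>{r\<in>{0..<p ^ L}. r mod p ^ n = c}. g (r mod p ^ n))"
    by (rule sum_residue_classes[OF assms, symmetric])
  also have "\<dots> = (\<Sum>c\<in>{0..<p ^ n}. real (card {r\<in>{0..<p ^ L}. r mod p ^ n = c}) * g c)"
    by (intro sum.cong refl) simp
  also have "\<dots> = (\<Sum>c\<in>{0..<p ^ n}. of_int p ^ (L - n) * g c)"
  proof (rule sum.cong[OF refl])
    fix c assume "c \<in> {0..<p ^ n}"
    then have "real (card {r\<in>{0..<p ^ L}. r mod p ^ n = c}) = of_int p ^ (L - n)"
      by (intro card_residues[OF assms]) auto
    then show "real (card {r\<in>{0..<p ^ L}. r mod p ^ n = c}) * g c = of_int p ^ (L - n) * g c" by (simp only:)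
  qed
  finally show ?thesis by (simp only: sum_distrib_left)
qed

lemma sum_geometric_tail_le:
  fixes x :: real
  assumes "0 < x" "x < 1"
  shows "(\<Sum>n\<in>{n0<..L}. x ^ n) \<le> x ^ n0 / (1 - x)"
proof -
  have "(\<Sum>n\<in>{n0<..L}. x ^ n) \<le> (\<Sum>n\<in>{n0..<Suc (max n0 L)}. x ^ n)"
    using assms by (intro sum_mono2) auto
  also have "\<dots> = (x ^ n0 - x ^ Suc (max n0 L)) / (1 - x)"
    using assms by (subst sum_power_shift[of n0 "max n0 L" x, unfolded atLeastLessThanSuc_atLeastAtMost[symmetric]])
      (auto simp: sum_gp0 field_simps Suc_diff_le simp flip: power_add)
  also have "\<dots> \<le> x ^ n0 / (1 - x)" using assms by (intro divide_right_mono) auto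
  finally show ?thesis .
qed

text \<open>\<open>C\<close> precedes \<open>\<alpha>\<close>, \<open>L\<close>, \<open>F\<close>
  and \<open>u\<close>: the decay over the scales is governed only by the gap
  \<open>\<epsilon>\<close> between the two exponents.\<close>

theorem discrete_restricted_projection:
  fixes p :: int and \<epsilon> \<delta> D' :: real
  assumes p: "prime p" "p > 2" and eps: "0 < \<epsilon>" and delta: "0 < \<delta>" and D: "D' > 0"
  shows "\<exists>C\<ge>1. \<forall>\<alpha> L (F :: 'b set) u. \<epsilon> \<le> \<alpha> \<longrightarrow> \<alpha> < 1 \<longrightarrow> finite F \<longrightarrow> F \<noteq> {} \<longrightarrow>
    (\<forall>n\<le>L. \<forall>v. real (card {w\<in>F. dvd3 (p ^ n) (u w - v)}) \<le> D' * of_int p powr - (real n * \<alpha>) * real (card F)) \<longrightarrow>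
    real (card {r\<in>{0..<p ^ L}. real (card F) / of_int p < real (card {w\<in>F. \<exists>n\<in>{1..L}.
        C * of_int p powr - (real n * (\<alpha> - \<epsilon>)) * real (card F) < real (slab_count (p ^ n) F u r (lin r (u w)))})})
      \<le> \<delta> * of_int p ^ L"
proof -
  define P where "P = real_of_int p"
  have P: "P > 2" "P > 0" "P \<ge> 1" using p(2) by (auto simp: P_def)
  define \<theta> where "\<theta> = P powr (\<epsilon> / 4)"
  define \<beta> where "\<beta> = P powr - \<epsilon>"
  define x where "x = P powr - (\<epsilon> / 8)"
  have theta: "\<theta> > 1" unfolding \<theta>_def using P eps by simp
  have beta: "0 \<le> \<beta>" "\<beta> < 1" unfolding \<beta>_def using P eps by (auto simp: powr_less_one)
  have x: "0 < x" "x < 1" unfolding x_def using P eps by (auto simp: powr_less_one)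
  obtain m M where m: "m > 0" and M: "M \<ge> 1" and moment: "\<And>n X a. cone_sum p n m X a \<Longrightarrow>
    (\<Sum>w\<in>cube (p ^ n). cmod (exp_sum (p ^ n) a X w) ^ 4)
      \<le> M * \<theta> ^ (2 * n) * of_int p ^ (4 * n) * (\<Sum>x\<in>X. (cmod (a x))\<^sup>2)"
    using cone_fourth_moment[OF p(2) theta] by blast
  \<comment> \<open>The lower bound 1 gives \<open>K \<le> K ^ 4\<close>, so that fourth roots can
    be taken in \<open>inc_le\<close>.\<close>
  define K where "K = max 1 (P ^ (8 * m) * M * D' / (1 - \<beta>) ^ 4)"
  have K1: "K \<ge> 1" by (simp add: K_def)
  have "(\<lambda>n. x ^ n) \<longlonglongrightarrow> 0" using x by (intro LIMSEQ_power_zero) auto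
  then have "(\<lambda>n. K * x ^ n / (1 - x)) \<longlonglongrightarrow> K * 0 / (1 - x)"
    using x by (intro tendsto_divide tendsto_mult tendsto_const) auto
  then have "(\<lambda>n. K * x ^ n / (1 - x)) \<longlonglongrightarrow> 0" by simp
  then have "eventually (\<lambda>n. K * x ^ n / (1 - x) < \<delta> / P) sequentially"
    using delta P by (intro order_tendstoD(2)[of _ 0]) auto
  then obtain n1 where n1: "\<And>n. n \<ge> n1 \<Longrightarrow> K * x ^ n / (1 - x) < \<delta> / P"
    by (auto simp: eventually_sequentially)
  \<comment> \<open>Beyond \<open>n1\<close> the geometric tail is small; \<open>2 * m\<close> is
    the least scale that \<open>slab_family\<close> admits.\<close>
  define n0 where "n0 = max n1 (2 * m)"
  have n0: "n0 \<ge> 1" "n0 \<ge> 2 * m" "K * x ^ n0 / (1 - x) < \<delta> / P"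
    using m n1[of n0] by (auto simp: n0_def)
  \<comment> \<open>With this \<open>C\<close> every threshold \<open>\<Lambda> n\<close> with
    \<open>n \<le> n0\<close> is at least 1, so a violation can occur only beyond
    \<open>n0\<close>.\<close>
  define C where "C = P ^ n0"
  have C1: "C \<ge> 1" unfolding C_def using P by simp
  show ?thesis
  proof (intro exI[of _ C] conjI allI impI)
    fix \<alpha> :: real and L :: nat and F :: "'b set" and u :: "'b \<Rightarrow> int3"
    assume alpha: "\<epsilon> \<le> \<alpha>" "\<alpha> < 1" and F: "finite F" "F \<noteq> {}"
      and frostman: "\<forall>n\<le>L. \<forall>v. real (card {w\<in>F. dvd3 (p ^ n) (u w - v)}) \<le> D' * of_int p powr - (real n * \<alpha>) * real (card F)"
    have F0: "real (card F) > 0" using F by (simp add: card_gt_0_iff)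
    define \<Lambda> where "\<Lambda> n = C * P powr - (real n * (\<alpha> - \<epsilon>))" for n
    define \<kappa> where "\<kappa> n = D' * P powr - (real n * \<alpha>)" for n
    define rich where "rich n = slab_family.rich p n F u (\<Lambda> n) \<beta>" for n
    define inc where "inc n = slab_family.incidences p n F u (\<Lambda> n) \<beta>" for n
    define bad where "bad r w \<longleftrightarrow> (\<exists>n\<in>{1..L}. \<Lambda> n * real (card F) < real (slab_count (p ^ n) F u r (lin r (u w))))" for r w
    have Lam0: "\<Lambda> n > 0" for n unfolding \<Lambda>_def using C1 P by simp
    have family: "slab_family p n m F u (\<Lambda> n) \<beta> (\<kappa> n) M \<theta>" if "n0 < n" "n \<le> L" for n
      using that p n0 m F Lam0 beta M theta moment frostman unfolding \<kappa>_def
      by unfold_locales (auto simp: P_def)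
    have inc_le: "inc n \<le> K * x ^ n * (real (card F) * P ^ n)" if n: "n0 < n" "n \<le> L" for n
    proof -
      interpret S: slab_family p n m F u "\<Lambda> n" \<beta> "\<kappa> n" M \<theta> by (rule family[OF n])
      define y where "y = inc n / (real (card F) * of_int (p ^ n))"
      have inc0: "inc n \<ge> 0" unfolding inc_def S.incidences_def by (intro sum_nonneg) simp
      have pn0: "real_of_int (p ^ n) > 0" using P by (simp add: P_def)
      have y0: "y \<ge> 0" unfolding y_def using inc0 F0 pn0 by simp
      have "((1 - \<beta>) * y) ^ 4 \<le> P ^ (8 * m) * M * \<theta> ^ (2 * n) * \<kappa> n / \<Lambda> n"
        using S.incidences_bound[OF F(2) beta(2)] by (simp add: y_def inc_def P_def)
      also have "\<dots> = P ^ (8 * m) * M * D' / C * (\<theta> ^ (2 * n) * (P powr - (real n * \<alpha>) / P powr - (real n * (\<alpha> - \<epsilon>))))"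
        by (simp add: \<kappa>_def \<Lambda>_def)
      also have "P powr - (real n * \<alpha>) / P powr - (real n * (\<alpha> - \<epsilon>)) = P powr - (real n * \<epsilon>)"
        using P by (simp add: powr_diff[symmetric] algebra_simps)
      also have "\<theta> ^ (2 * n) * P powr - (real n * \<epsilon>) = x ^ (4 * n)"
        using P unfolding \<theta>_def x_def
        by (simp add: powr_realpow[symmetric] powr_powr powr_add[symmetric] algebra_simps)
      also have "P ^ (8 * m) * M * D' / C * x ^ (4 * n) \<le> P ^ (8 * m) * M * D' * x ^ (4 * n)"
      proof (rule mult_right_mono)
        have "P ^ (8 * m) * M * D' \<ge> 0" using P M D by simp
        then show "P ^ (8 * m) * M * D' / C \<le> P ^ (8 * m) * M * D'"
          using C1 mult_left_mono[of 1 C "P ^ (8 * m) * M * D'"] by (simp add: divide_le_eq)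
      qed (use x in simp)
      finally have "(1 - \<beta>) ^ 4 * y ^ 4 \<le> P ^ (8 * m) * M * D' * x ^ (4 * n)"
        by (simp only: power_mult_distrib)
      then have "y ^ 4 \<le> P ^ (8 * m) * M * D' / (1 - \<beta>) ^ 4 * x ^ (4 * n)"
        using beta by (simp add: field_simps)
      also have "\<dots> \<le> K * x ^ (4 * n)"
        using x by (intro mult_right_mono) (auto simp: K_def)
      also have "\<dots> \<le> K ^ 4 * x ^ (4 * n)"
        using K1 x power_increasing[of 1 4 K] by (intro mult_right_mono) auto
      also have "\<dots> = (K * x ^ n) ^ 4"
        by (simp add: power_mult_distrib power_mult[symmetric] mult.commute)
      finally have "y \<le> K * x ^ n"
        using K1 x by (intro power_le_imp_le_base[of y 3]) (auto simp: numeral_eq_Suc)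
      then show ?thesis
        using F0 pn0 unfolding y_def by (simp add: pos_divide_le_eq P_def)
    qed
    have bad_rich: "\<exists>n\<in>{n0<..L}. lin (r mod p ^ n) (u w) mod p ^ n \<in> rich n (r mod p ^ n)" if "bad r w" for r w
    proof -
      let ?Q = "\<lambda>n. 1 \<le> n \<and> n \<le> L \<and> \<Lambda> n * real (card F) < real (slab_count (p ^ n) F u r (lin r (u w)))"
      \<comment> \<open>The first scale that is too rich. Its parent is not, provided
        \<open>n - 1\<close> still lies in the range from 1 on; \<open>n0 \<ge> 1\<close> guarantees
        this.\<close>
      define n where "n = (LEAST n. ?Q n)"
      have ex: "\<exists>n. ?Q n" using that by (auto simp: bad_def)
      have n: "?Q n" unfolding n_def by (rule LeastI_ex[OF ex])
      have least: "\<not> ?Q k" if "k < n" for k using not_less_Least[of k ?Q] that unfolding n_def by blast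
      have "n0 < n"
      proof (rule ccontr)
        assume "\<not> n0 < n"
        then have "real n * (\<alpha> - \<epsilon>) \<le> real n0 * 1"
          using alpha eps by (intro mult_mono) auto
        then have "P powr - real n0 \<le> P powr - (real n * (\<alpha> - \<epsilon>))"
          using P by (intro powr_mono) auto
        then have "C * P powr - real n0 \<le> \<Lambda> n" unfolding \<Lambda>_def using C1 by (intro mult_left_mono) auto
        moreover have "C * P powr - real n0 = 1"
          unfolding C_def using P by (simp add: powr_minus powr_realpow)
        ultimately have "1 * real (card F) \<le> \<Lambda> n * real (card F)" by (intro mult_right_mono) auto
        moreover have "slab_count (p ^ n) F u r (lin r (u w)) \<le> card F"
          unfolding slab_count_def using F by (intro card_mono) auto
        ultimately show False using n by simp
      qed
      then have n1: "1 \<le> n - 1" "n - 1 < n" "Suc (n - 1) = n" using n0 by auto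
      interpret S: slab_family p n m F u "\<Lambda> n" \<beta> "\<kappa> n" M \<theta>
        using \<open>n0 < n\<close> n by (intro family) auto
      let ?r = "r mod p ^ n"
      let ?y = "lin ?r (u w) mod p ^ n"
      have cong: "p ^ n dvd r - ?r" by (simp add: mod_eq_dvd_iff[symmetric])
      have congy: "p ^ n dvd lin r (u w) - ?y"
      proof -
        have "p ^ n dvd (lin r (u w) - lin ?r (u w)) + (lin ?r (u w) - ?y)"
          by (intro dvd_add lin_cong[OF cong]) (simp add: mod_eq_dvd_iff[symmetric])
        then show ?thesis by simp
      qed
      have dvd: "p ^ (n - 1) dvd p ^ n" by (simp add: le_imp_power_dvd)
      have "slab_count (p ^ n) F u ?r ?y = slab_count (p ^ n) F u r (lin r (u w))"
        by (rule slab_count_cong[OF cong congy, symmetric])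
      moreover have "slab_count (p ^ (n - 1)) F u ?r ?y = slab_count (p ^ (n - 1)) F u r (lin r (u w))"
        by (rule slab_count_cong[OF dvd_trans[OF dvd cong] dvd_trans[OF dvd congy], symmetric])
      moreover have "real (slab_count (p ^ (n - 1)) F u r (lin r (u w))) \<le> P * \<beta> * (\<Lambda> n * real (card F))"
      proof -
        have "real (slab_count (p ^ (n - 1)) F u r (lin r (u w))) \<le> \<Lambda> (n - 1) * real (card F)"
          using least[OF n1(2)] n1 n by linarith
        also have "\<Lambda> (n - 1) = P powr (\<alpha> - \<epsilon>) * \<Lambda> n"
        proof -
          have "- (real (n - 1) * (\<alpha> - \<epsilon>)) = (\<alpha> - \<epsilon>) + - (real n * (\<alpha> - \<epsilon>))"
            using n1(3) by (simp add: algebra_simps of_nat_diff n)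
          then show ?thesis unfolding \<Lambda>_def by (simp only: powr_add mult.left_commute)
        qed
        also have "P powr (\<alpha> - \<epsilon>) * \<Lambda> n * real (card F) \<le> P * \<beta> * (\<Lambda> n * real (card F))"
        proof -
          \<comment> \<open>Here \<open>\<alpha> < 1\<close> enters: it keeps the ratio of the
            thresholds at consecutive scales below \<open>P * \<beta>\<close> with
            \<open>\<beta> < 1\<close>.\<close>
          have "P powr (\<alpha> - \<epsilon>) \<le> P powr (1 + - \<epsilon>)" using P alpha by (intro powr_mono) auto
          also have "\<dots> = P * \<beta>" unfolding \<beta>_def powr_add using P by simp
          finally have "P powr (\<alpha> - \<epsilon>) * (\<Lambda> n * real (card F)) \<le> P * \<beta> * (\<Lambda> n * real (card F))"
            using Lam0[of n] by (intro mult_right_mono) auto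
          then show ?thesis by (simp only: mult.assoc)
        qed
        finally show ?thesis .
      qed
      ultimately have "?y \<in> rich n ?r"
        using n P unfolding rich_def S.rich_def by (simp add: P_def)
      then show ?thesis using \<open>n0 < n\<close> n by auto
    qed
    let ?B = "\<lambda>r. {w\<in>F. bad r w}"
    let ?T = "\<lambda>n r. card {w\<in>F. lin r (u w) mod p ^ n \<in> rich n r}"
    have "(\<Sum>r\<in>{0..<p ^ L}. real (card (?B r))) \<le> (\<Sum>r\<in>{0..<p ^ L}. \<Sum>n\<in>{n0<..L}. real (?T n (r mod p ^ n)))"
    proof (rule sum_mono)
      fix r
      have "card (?B r) \<le> card (\<Union>n\<in>{n0<..L}. {w\<in>F. lin (r mod p ^ n) (u w) mod p ^ n \<in> rich n (r mod p ^ n)})"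
        using bad_rich[of r] F by (intro card_mono) auto
      also have "\<dots> \<le> (\<Sum>n\<in>{n0<..L}. ?T n (r mod p ^ n))" by (rule card_UN_le) simp
      finally show "real (card (?B r)) \<le> (\<Sum>n\<in>{n0<..L}. real (?T n (r mod p ^ n)))"
        unfolding of_nat_sum[symmetric] of_nat_le_iff .
    qed
    also have "\<dots> = (\<Sum>n\<in>{n0<..L}. \<Sum>r\<in>{0..<p ^ L}. real (?T n (r mod p ^ n)))" by (rule sum.swap)
    \<comment> \<open>The incidences at scale \<open>n\<close> depend only on \<open>r\<close>
      modulo \<open>p ^ n\<close>, and each residue has \<open>p ^ (L - n)\<close> lifts.\<close>
    also have "\<dots> = (\<Sum>n\<in>{n0<..L}. P ^ (L - n) * inc n)"
    proof (rule sum.cong[OF refl])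
      fix n assume n: "n \<in> {n0<..L}"
      interpret S: slab_family p n m F u "\<Lambda> n" \<beta> "\<kappa> n" M \<theta> using n by (intro family) auto
      show "(\<Sum>r\<in>{0..<p ^ L}. real (?T n (r mod p ^ n))) = P ^ (L - n) * inc n"
        using sum_mod_prime_pow[of p n L "\<lambda>r. real (?T n r)"] n p
        unfolding inc_def S.incidences_def rich_def P_def by simp
    qed
    also have "\<dots> \<le> (\<Sum>n\<in>{n0<..L}. (real (card F) * P ^ L * K) * x ^ n)"
    proof (rule sum_mono)
      fix n assume n: "n \<in> {n0<..L}"
      have "P ^ (L - n) * inc n \<le> P ^ (L - n) * (K * x ^ n * (real (card F) * P ^ n))"
        using inc_le[of n] n P by (intro mult_left_mono) auto
      also have "\<dots> = (real (card F) * (P ^ (L - n) * P ^ n) * K) * x ^ n" by (simp only: mult_ac)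
      also have "P ^ (L - n) * P ^ n = P ^ L" using n by (simp flip: power_add)
      finally show "P ^ (L - n) * inc n \<le> (real (card F) * P ^ L * K) * x ^ n" .
    qed
    also have "\<dots> \<le> (real (card F) * P ^ L * K) * (x ^ n0 / (1 - x))"
      unfolding sum_distrib_left[symmetric] using K1 P
      by (intro mult_left_mono sum_geometric_tail_le[OF x]) auto
    also have "\<dots> = (real (card F) * P ^ L) * (K * x ^ n0 / (1 - x))" by simp
    also have "\<dots> \<le> (real (card F) * P ^ L) * (\<delta> / P)"
      using n0(3) P by (intro mult_left_mono) auto
    finally have sum_le: "(\<Sum>r\<in>{0..<p ^ L}. real (card (?B r))) \<le> real (card F) * P ^ L * (\<delta> / P)" .
    let ?R = "{r\<in>{0..<p ^ L}. real (card F) / P < real (card (?B r))}"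
    \<comment> \<open>Markov's inequality at the level \<open>card F / P\<close>, compensated by the
      factor \<open>1 / P\<close> in the tail bound.\<close>
    have "real (card ?R) * (real (card F) / P) \<le> (\<Sum>r\<in>?R. real (card (?B r)))"
      using sum_mono[of ?R "\<lambda>_. real (card F) / P" "\<lambda>r. real (card (?B r))"] by auto
    also have "\<dots> \<le> (\<Sum>r\<in>{0..<p ^ L}. real (card (?B r)))" by (intro sum_mono2) auto
    also have "\<dots> \<le> real (card F) * P ^ L * (\<delta> / P)" by (rule sum_le)
    also have "\<dots> = (\<delta> * P ^ L) * (real (card F) / P)" by simp
    finally have "real (card ?R) \<le> \<delta> * P ^ L"
      using F0 P by (simp only: mult_le_cancel_right_pos divide_pos_pos)
    then show "real (card {r\<in>{0..<p ^ L}. real (card F) / of_int p < real (card {w\<in>F. \<exists>n\<in>{1..L}.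
        C * of_int p powr - (real n * (\<alpha> - \<epsilon>)) * real (card F) < real (slab_count (p ^ n) F u r (lin r (u w)))})})
      \<le> \<delta> * of_int p ^ L"
      unfolding bad_def \<Lambda>_def P_def .
  qed (rule C1)
qed

section \<open>Passage to the p-adic numbers\<close>

abbreviation of_int_padic :: "int \<Rightarrow> 'p::prime_card padic" where
  "of_int_padic k \<equiv> to_fract (of_int k)"

lemma res_of_int: "res (of_int k :: 'p::prime_card padic_int) n = k mod int CARD('p) ^ n"
proof -
  have nat: "res (of_nat m :: 'p padic_int) n = int m mod int CARD('p) ^ n" for m
    by (induction m) (simp_all add: one_padic_int.rep_eq mod_simps)
  show ?thesis
  proof (cases "k \<ge> 0")
    case True
    then show ?thesis using nat[of "nat k"] by simp
  next
    case False
    then have "(of_int k :: 'p padic_int) = - of_nat (nat (- k))" by simp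
    then have "res (of_int k :: 'p padic_int) n = (- (- k mod int CARD('p) ^ n)) mod int CARD('p) ^ n"
      using nat[of "nat (- k)"] False by (simp only: res_simps) simp
    then show ?thesis by (simp add: mod_minus_eq)
  qed
qed

lemma padic_abs_of_int_le_iff:
  "padic_abs (of_int_padic k :: 'p::prime_card padic) \<le> (1 / real CARD('p)) ^ n \<longleftrightarrow> int CARD('p) ^ n dvd k"
  by (simp add: padic_int_abs_le_iff res_of_int dvd_eq_mod_eq_0)

lemma padic_abs_minus: "padic_abs (- x) = padic_abs x"
  by (cases x) (simp add: padic_abs_Fract)

lemma padic_abs_minus_commute: "padic_abs (x - y) = padic_abs (y - x)"
  using padic_abs_minus[of "x - y"] by simp

lemma padic_abs_of_int_le_1: "padic_abs (of_int_padic k) \<le> 1"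
  using padic_abs_of_int_le_iff[of k 0] by simp

lemma padic_abs_to_fract_le_1: "padic_abs (to_fract x) \<le> 1"
  using padic_int_abs_le_iff[of x 0] by simp

lemma padic_abs_add_leI: "padic_abs x \<le> e \<Longrightarrow> padic_abs y \<le> e \<Longrightarrow> padic_abs (x + y) \<le> e"
  using padic_abs_add_le[of x y] by simp

lemma padic_abs_nonneg: "padic_abs x \<ge> 0"
  by (cases x) (simp add: padic_abs_Fract)

lemma padic_abs_eq_1: "padic_abs (to_fract x) = 1" if "\<not> padic_abs (to_fract x) \<le> 1 / real CARD('p)"
  for x :: "'p::prime_card padic_int"
proof -
  have x: "x \<noteq> 0" "res x 1 \<noteq> 0" using that padic_int_abs_le_iff[of x 1] by auto
  then have "padic_val x = 0" using res_eq_0_iff[of x 1] by linarith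
  with x show ?thesis by (simp add: padic_int_abs_def)
qed

text \<open>Write \<open>q = a / b\<close> and take residues with \<open>padic_val b\<close> extra
  digits, since cancelling that power of \<open>p\<close> loses as many. The cofactor
  \<open>b'\<close> of \<open>b\<close> is then a unit modulo \<open>p ^ L\<close> and can be
  inverted. For \<open>L = 0\<close> it is not a unit, but any integer will do.\<close>

lemma padic_int_approx:
  fixes q :: "'p::prime_card padic"
  assumes "padic_abs q \<le> 1"
  shows "\<exists>k. padic_abs (q - of_int_padic k) \<le> (1 / real CARD('p)) ^ L"
proof (cases q)
  case (Fract a b)
  let ?p = "int CARD('p)" and ?v = "padic_val b"
  have p: "prime ?p" by (rule prime_card_int)
  have b: "b \<noteq> 0" by fact
  have babs: "padic_int_abs b = (1 / real CARD('p)) ^ ?v" using b by (simp add: padic_int_abs_def)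
  have bpos: "padic_int_abs b > 0" using b by (rule padic_int_abs_pos)
  have "padic_int_abs a \<le> padic_int_abs b"
    using assms bpos by (simp add: Fract padic_abs_Fract b divide_le_eq)
  then have "res a ?v = 0" unfolding babs padic_int_abs_le_iff .
  then have "?p ^ ?v dvd res a (?v + L)" using res_mod_le[of ?v "?v + L" a] by (simp add: dvd_eq_mod_eq_0)
  then obtain a' where a': "res a (?v + L) = ?p ^ ?v * a'" ..
  have "?p ^ ?v dvd res b (?v + L)"
    using res_mod_le[of ?v "?v + L" b] b by (simp add: dvd_eq_mod_eq_0 res_eq_0_iff)
  then obtain b' where b': "res b (?v + L) = ?p ^ ?v * b'" ..
  have "\<exists>k. ?p ^ L dvd a' - k * b'"
  proof (cases "L = 0")
    case False
    have "\<not> ?p dvd b'"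
    proof
      assume "?p dvd b'"
      then have "?p ^ Suc ?v dvd res b (?v + L)" by (simp add: b' mult_dvd_mono mult.commute)
      then have "res b (Suc ?v) = 0"
        using res_mod_le[of "Suc ?v" "?v + L" b] False by (simp add: mod_eq_0_iff_dvd)
      then show False using b by (simp add: res_eq_0_iff)
    qed
    then have "gcd b' (?p ^ L) = 1"
      using prime_imp_coprime[OF p] by (simp add: coprime_commute flip: coprime_iff_gcd_eq_1)
    then obtain y z where yz: "y * b' + z * ?p ^ L = 1" using bezout_int[of b' "?p ^ L"] by auto
    have "a' - y * a' * b' = (y * b' + z * ?p ^ L) * a' - y * a' * b'" by (simp only: yz mult_1)
    also have "\<dots> = ?p ^ L * (z * a')" by (simp add: algebra_simps)
    finally have "a' - y * a' * b' = ?p ^ L * (z * a')" .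
    then show ?thesis by (intro exI[of _ "y * a'"]) simp
  qed simp
  then obtain k where "?p ^ L dvd a' - k * b'" ..
  then have "?p ^ (?v + L) dvd ?p ^ ?v * (a' - k * b')" by (simp add: power_add)
  then have "(res a (?v + L) - k * res b (?v + L)) mod ?p ^ (?v + L) = 0"
  proof -
    have "res a (?v + L) - k * res b (?v + L) = ?p ^ ?v * (a' - k * b')"
      unfolding a' b' by (simp add: algebra_simps)
    then show ?thesis using \<open>?p ^ (?v + L) dvd ?p ^ ?v * (a' - k * b')\<close> by (simp only: dvd_eq_mod_eq_0)
  qed
  then have "res (a - of_int k * b) (?v + L) = 0"
    by (simp add: res_of_int mod_simps)
  then have "padic_int_abs (a - of_int k * b) \<le> (1 / real CARD('p)) ^ (?v + L)"
    unfolding padic_int_abs_le_iff .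
  moreover have "q - of_int_padic k = Fract (a - of_int k * b) b"
    using b by (simp add: Fract to_fract_def)
  ultimately have "padic_abs (q - of_int_padic k) \<le> (1 / real CARD('p)) ^ L"
    using b bpos by (simp add: padic_abs_Fract babs power_add divide_le_eq mult.commute)
  then show ?thesis ..
qed

lemma padic_close_mult:
  assumes "padic_abs (x - y) \<le> e" "padic_abs (x' - y') \<le> e" "padic_abs x \<le> 1" "padic_abs y' \<le> 1"
  shows "padic_abs (x * x' - y * y') \<le> e"
proof -
  have "x * x' - y * y' = x * (x' - y') + (x - y) * y'" by (simp add: algebra_simps)
  moreover have "padic_abs (x * (x' - y')) \<le> 1 * e"
    unfolding padic_abs_mult using assms padic_abs_nonneg by (intro mult_mono) auto
  moreover have "padic_abs ((x - y) * y') \<le> e * 1"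
    unfolding padic_abs_mult using assms padic_abs_nonneg order_trans by (intro mult_mono) blast+
  ultimately show ?thesis by (simp add: padic_abs_add_leI)
qed

lemma padic_close_add:
  assumes "padic_abs (x - y) \<le> e" "padic_abs (x' - y') \<le> e"
  shows "padic_abs (x + x' - (y + y')) \<le> e"
  using padic_abs_add_leI[OF assms] by (simp add: algebra_simps)

lemma padic_close_le_iff:
  assumes "padic_abs (x - y) \<le> e"
  shows "padic_abs x \<le> e \<longleftrightarrow> padic_abs y \<le> e"
  using padic_abs_add_leI[of "x - y" e y] padic_abs_add_leI[of "y - x" e x] assms padic_abs_minus_commute[of x y]
  by auto

definition prime_elt :: "'p::prime_card padic" where
  "prime_elt = to_fract (of_nat CARD('p))"

lemma padic_abs_prime_elt_power: "padic_abs ((prime_elt :: 'p::prime_card padic) ^ l) = (1 / real CARD('p)) ^ l"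
proof (induction l)
  case 0
  have "padic_int_abs (1 :: 'p padic_int) = 1" using padic_int_abs_mult[of "1 :: 'p padic_int" 1] by simp
  then have "padic_abs (to_fract (1 :: 'p padic_int)) = 1" by (simp only: padic_abs_to_fract)
  then show ?case by (simp only: to_fract_1 power_0)
next
  case (Suc l)
  then show ?case by (simp add: padic_abs_mult prime_elt_def padic_int_abs_prime)
qed

lemma prime_elt_power_nonzero: "(prime_elt :: 'p::prime_card padic) ^ l \<noteq> 0"
proof
  assume "(prime_elt :: 'p padic) ^ l = 0"
  then have "padic_abs (0 :: 'p padic) = (1 / real CARD('p)) ^ l" by (metis padic_abs_prime_elt_power)
  moreover have "padic_abs (0 :: 'p padic) = 0" using padic_abs_to_fract[of "0 :: 'p padic_int"] by simp
  ultimately show False using prime_card_gt_1[where 'p = 'p] by simp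
qed

text \<open>Translations by integers permute the \<open>p ^ L\<close> residue classes transitively,
  so by invariance all have the same measure.\<close>

lemma haar_residue_class:
  fixes \<mu> :: "'p::prime_card padic_int measure"
  assumes "haar_prob \<mu>" "B \<subseteq> {0..<int CARD('p) ^ L}"
  shows "measure \<mu> {x. res x L \<in> B} = real (card B) / real CARD('p) ^ L"
proof -
  let ?p = "int CARD('p)"
  interpret prob_space \<mu> using assms(1) by (simp add: haar_prob_def)
  have sets: "sets \<mu> = sets borel" and inv: "distr \<mu> borel (\<lambda>x. a + x) = \<mu>" for a
    using assms(1) by (simp_all add: haar_prob_def)
  have space: "space \<mu> = UNIV" using sets_eq_imp_space_eq[OF sets] by simp
  have class_sets: "residue_class L k \<in> sets \<mu>" for k
    unfolding sets by (intro borel_open open_residue_class)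
  have eq: "measure \<mu> (residue_class L k) = measure \<mu> (residue_class L 0)" if k: "k \<in> {0..<?p ^ L}" for k
  proof -
    have "continuous_on UNIV (\<lambda>x. of_int k + x :: 'p padic_int)"
      unfolding continuous_on_iff by (auto simp: dist_padic_int_def)
    then have "(\<lambda>x. of_int k + x :: 'p padic_int) \<in> borel_measurable borel"
      by (rule borel_measurable_continuous_onI)
    then have meas: "(\<lambda>x. of_int k + x) \<in> \<mu> \<rightarrow>\<^sub>M borel"
      by (simp cong: measurable_cong_sets add: sets)
    have "measure \<mu> (residue_class L k) = measure (distr \<mu> borel (\<lambda>x. of_int k + x)) (residue_class L k)"
      by (simp only: inv)
    also have "\<dots> = measure \<mu> ((\<lambda>x. of_int k + x) -` residue_class L k)"
      using class_sets[of k] by (subst measure_distr[OF meas]) (simp_all add: sets space)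
    also have "(\<lambda>x. of_int k + x) -` residue_class L k = (residue_class L 0 :: 'p padic_int set)"
    proof -
      have "(k mod ?p ^ L + res x L) mod ?p ^ L = k \<longleftrightarrow> res x L = 0" for x :: "'p padic_int"
      proof -
        have "(k mod ?p ^ L + res x L) mod ?p ^ L = k mod ?p ^ L \<longleftrightarrow> ?p ^ L dvd res x L"
          unfolding mod_add_left_eq mod_eq_dvd_iff by simp
        moreover have "?p ^ L dvd res x L \<longleftrightarrow> res x L = 0"
          using res_bounds[of x L] zdvd_imp_le[of "?p ^ L" "res x L"] by fastforce
        moreover have "k mod ?p ^ L = k" using k by simp
        ultimately show ?thesis by simp
      qed
      then show ?thesis by (auto simp: residue_class_def res_of_int)
    qed
    finally show ?thesis .
  qed
  have fin: "finite B" using assms(2) finite_subset by blast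
  have sum: "measure \<mu> {x. res x L \<in> B} = real (card B) * measure \<mu> (residue_class L 0)"
    if B: "B \<subseteq> {0..<?p ^ L}" for B
  proof -
    have finB: "finite B" using B finite_subset by blast
    have "{x :: 'p padic_int. res x L \<in> B} = (\<Union>k\<in>B. residue_class L k)" by (auto simp: residue_class_def)
    then have "measure \<mu> {x. res x L \<in> B} = (\<Sum>k\<in>B. measure \<mu> (residue_class L k))"
      using class_sets finB
      by (simp only:) (intro finite_measure_finite_Union, auto simp: disjoint_family_on_def residue_class_def)
    also have "\<dots> = (\<Sum>k\<in>B. measure \<mu> (residue_class L 0))" using B eq by (intro sum.cong) auto
    finally show ?thesis by simp
  qed
  have "{x :: 'p padic_int. res x L \<in> {0..<?p ^ L}} = space \<mu>"
    using res_bounds by (auto simp: space)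
  then have "1 = real (card {0..<?p ^ L}) * measure \<mu> (residue_class L 0)"
    using sum[of "{0..<?p ^ L}"] prob_space by simp
  then have "measure \<mu> (residue_class L 0) = 1 / real CARD('p) ^ L"
    using prime_card_gt_1[where 'p = 'p] by (simp add: field_simps)
  then show ?thesis using sum[OF assms(2)] by simp
qed

lemma max_norm_le_iff: "max_norm w \<le> b \<longleftrightarrow> (\<forall>i j. padic_abs (w $ i $ j) \<le> b)"
  unfolding max_norm_def by (subst Max_le_iff) auto

lemma trace_2: "trace w = w $ 1 $ 1 + w $ 2 $ 2" for w :: "'p::prime_card padic ^ 2 ^ 2"
  by (simp add: trace_def sum_2)

lemma to_fract_2: "to_fract 2 = (2 :: 'p::prime_card padic)"
  by (simp only: one_add_one[symmetric] to_fract_add to_fract_1)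

lemma padic_abs_2:
  assumes "CARD('p) > 2"
  shows "padic_abs (2 :: 'p::prime_card padic) = 1"
proof -
  have "\<not> int CARD('p) ^ 1 dvd 2" using assms by (auto dest: zdvd_imp_le)
  then have "\<not> padic_abs (of_int_padic 2 :: 'p padic) \<le> 1 / real CARD('p)"
    using padic_abs_of_int_le_iff[where 'p = 'p, of 2 1] by simp
  then have "padic_abs (to_fract (of_int 2) :: 'p padic) = 1" by (rule padic_abs_eq_1)
  then show ?thesis by (simp add: to_fract_2)
qed

text \<open>Divide by \<open>p ^ l\<close> and approximate the coefficients of \<open>xi\<close>,
  namely the entry 12, -2 times the entry 11 and minus the entry 21, by integers up to
  \<open>p ^ (-L)\<close>. This loses nothing up to scale \<open>L\<close>, and \<open>u\<close>
  does not depend on \<open>r\<close>, so one point set serves all directions. As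
  \<open>p > 2\<close>, 2 is a unit, and the three coefficients control the norm of a trace-zero
  matrix.\<close>

lemma discretize:
  fixes F :: "('p::prime_card padic ^ 2 ^ 2) set"
  assumes p: "CARD('p) > 2" and F: "F \<subseteq> sl2_ball 0 ((1 / real CARD('p)) ^ l)"
  obtains u :: "'p padic ^ 2 ^ 2 \<Rightarrow> int3" where
    "\<And>w w' n r. w \<in> F \<Longrightarrow> w' \<in> F \<Longrightarrow> n \<le> L \<Longrightarrow> padic_abs (xi r w' - xi r w) \<le> (1 / real CARD('p)) ^ (l + n)
      \<longleftrightarrow> int CARD('p) ^ n dvd lin (res r L) (u w') - lin (res r L) (u w)"
    "\<And>w w' n. w \<in> F \<Longrightarrow> w' \<in> F \<Longrightarrow> n \<le> L \<Longrightarrow> dvd3 (int CARD('p) ^ n) (u w' - u w)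
      \<Longrightarrow> w' \<in> sl2_ball w ((1 / real CARD('p)) ^ (l + n))"
proof -
  let ?e = "\<lambda>n. (1 / real CARD('p)) ^ n"
  let ?\<pi> = "(prime_elt :: 'p padic) ^ l"
  have P: "real CARD('p) > 1" using p by simp
  have e0: "?e n > 0" for n using P by simp
  have e_mono: "?e L \<le> ?e n" if "n \<le> L" for n using P that by (intro power_decreasing) auto
  have pi0: "?\<pi> \<noteq> 0" by (rule prime_elt_power_nonzero)
  have abs_scale: "padic_abs (?\<pi> * q) \<le> ?e (l + n) \<longleftrightarrow> padic_abs q \<le> ?e n" for q n
    using e0[of l] by (simp add: padic_abs_mult padic_abs_prime_elt_power power_add del: power_one_over)
  define app where "app q = (SOME k. padic_abs (q - of_int_padic k) \<le> ?e L)" for q :: "'p padic"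
  have app: "padic_abs (q - of_int_padic (app q)) \<le> ?e L" if "padic_abs q \<le> 1" for q
    unfolding app_def by (rule someI_ex[OF padic_int_approx[OF that]])
  define Q1 where "Q1 w = w $ 1 $ 2 / ?\<pi>" for w :: "'p padic ^ 2 ^ 2"
  define Q2 where "Q2 w = - 2 * w $ 1 $ 1 / ?\<pi>" for w :: "'p padic ^ 2 ^ 2"
  define Q3 where "Q3 w = - (w $ 2 $ 1) / ?\<pi>" for w :: "'p padic ^ 2 ^ 2"
  have Q: "w $ 1 $ 2 = ?\<pi> * Q1 w" "- 2 * w $ 1 $ 1 = ?\<pi> * Q2 w" "- (w $ 2 $ 1) = ?\<pi> * Q3 w" for w
    using pi0 by (simp_all add: Q1_def Q2_def Q3_def)
  define u where "u w = (app (Q1 w), app (Q2 w), app (Q3 w))" for w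
  have Q_le: "padic_abs (Q1 w) \<le> 1 \<and> padic_abs (Q2 w) \<le> 1 \<and> padic_abs (Q3 w) \<le> 1" if "w \<in> F" for w
  proof -
    have w: "padic_abs (w $ i $ j) \<le> ?e l" for i j
      using that F by (auto simp: sl2_ball_def max_norm_le_iff)
    have "padic_abs (- 2 * w $ 1 $ 1) \<le> ?e l"
      using w[of 1 1] padic_abs_2[OF p] by (simp add: padic_abs_minus padic_abs_mult)
    moreover have "padic_abs (- (w $ 2 $ 1)) \<le> ?e l" using w by (simp add: padic_abs_minus)
    ultimately show ?thesis using w[of 1 2] unfolding Q using abs_scale[of _ 0] by simp
  qed
  have close: "padic_abs (Q1 w - of_int_padic (app (Q1 w))) \<le> ?e L"
    "padic_abs (Q2 w - of_int_padic (app (Q2 w))) \<le> ?e L"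
    "padic_abs (Q3 w - of_int_padic (app (Q3 w))) \<le> ?e L" if "w \<in> F" for w
    using app Q_le[OF that] by auto
  show ?thesis
  proof
    fix w w' n and r :: "'p padic_int" assume w: "w \<in> F" "w' \<in> F" and n: "n \<le> L"
    let ?r = "to_fract r" and ?R = "res r L"
    \<comment> \<open>Nested so that every product has the factor \<open>?r\<close>, of absolute
      value at most 1, and approximation errors never grow.\<close>
    define Y where "Y w = Q1 w + (?r * Q2 w + ?r * (?r * Q3 w))" for w
    have r1: "padic_abs ?r \<le> 1" by (rule padic_abs_to_fract_le_1)
    have rR: "padic_abs (?r - of_int_padic ?R) \<le> ?e L"
    proof -
      have "res (r - of_int ?R) L = 0" by (simp add: res_of_int mod_diff_right_eq)
      then have "padic_int_abs (r - of_int ?R) \<le> ?e L" by (simp only: padic_int_abs_le_iff)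
      then show ?thesis by (simp only: to_fract_diff[symmetric] padic_abs_to_fract)
    qed
    have Y: "padic_abs (Y w - of_int_padic (lin ?R (u w))) \<le> ?e L" if "w \<in> F" for w
    proof -
      have "of_int_padic (lin ?R (u w)) = of_int_padic (app (Q1 w))
          + (of_int_padic ?R * of_int_padic (app (Q2 w)) + of_int_padic ?R * of_int_padic (?R * app (Q3 w)) :: 'p padic)"
        by (simp add: lin_def u_def power2_eq_square mult.assoc add.assoc)
      moreover have "padic_abs (?r * Q3 w - of_int_padic (?R * app (Q3 w))) \<le> ?e L"
        using padic_close_mult[OF rR close(3)[OF that] r1 padic_abs_of_int_le_1] by simp
      ultimately show ?thesis
        unfolding Y_def
        by (simp only:) (intro padic_close_add padic_close_mult rR r1 close that padic_abs_of_int_le_1)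
    qed
    have xi: "xi r w = ?\<pi> * Y w" for w
    proof -
      have "xi r w = w $ 1 $ 2 + ?r * (- 2 * w $ 1 $ 1) + ?r * (?r * (- (w $ 2 $ 1)))"
        by (simp add: xi_def power2_eq_square algebra_simps)
      then show ?thesis unfolding Q by (simp add: Y_def algebra_simps)
    qed
    let ?d = "lin ?R (u w') - lin ?R (u w)"
    have "padic_abs ((Y w' - Y w) - of_int_padic ?d) \<le> ?e L"
    proof -
      have "padic_abs ((Y w' - of_int_padic (lin ?R (u w'))) + - (Y w - of_int_padic (lin ?R (u w)))) \<le> ?e L"
        using Y w by (intro padic_abs_add_leI) (simp_all add: padic_abs_minus del: minus_diff_eq)
      then show ?thesis by (simp add: algebra_simps)
    qed
    then have "padic_abs ((Y w' - Y w) - of_int_padic ?d) \<le> ?e n" using e_mono[OF n] by linarith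
    then have "padic_abs (Y w' - Y w) \<le> ?e n \<longleftrightarrow> padic_abs (of_int_padic ?d :: 'p padic) \<le> ?e n"
      by (rule padic_close_le_iff)
    then show "padic_abs (xi r w' - xi r w) \<le> ?e (l + n) \<longleftrightarrow> int CARD('p) ^ n dvd ?d"
      unfolding xi right_diff_distrib[symmetric] abs_scale padic_abs_of_int_le_iff .
  next
    fix w w' n assume w: "w \<in> F" "w' \<in> F" and n: "n \<le> L" and dvd: "dvd3 (int CARD('p) ^ n) (u w' - u w)"
    have sl: "w \<in> sl2" "w' \<in> sl2" using w F by (auto simp: sl2_ball_def)
    have diff: "padic_abs (q' - q) \<le> ?e n"
      if "int CARD('p) ^ n dvd k' - k" "padic_abs (q - of_int_padic k) \<le> ?e L" "padic_abs (q' - of_int_padic k') \<le> ?e L"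
      for q q' :: "'p padic" and k k'
    proof -
      have "padic_abs ((q' - of_int_padic k') + (- (q - of_int_padic k) + of_int_padic (k' - k))) \<le> ?e n"
        using that e_mono[OF n] padic_abs_of_int_le_iff[where 'p = 'p, of "k' - k" n]
        by (intro padic_abs_add_leI) (simp_all add: padic_abs_minus del: minus_diff_eq of_int_diff)
      then show ?thesis by (simp add: algebra_simps)
    qed
    have "int CARD('p) ^ n dvd app (Q1 w') - app (Q1 w)" "int CARD('p) ^ n dvd app (Q2 w') - app (Q2 w)"
      "int CARD('p) ^ n dvd app (Q3 w') - app (Q3 w)"
      using dvd by (auto simp: u_def)
    then have d: "padic_abs (Q1 w' - Q1 w) \<le> ?e n" "padic_abs (Q2 w' - Q2 w) \<le> ?e n" "padic_abs (Q3 w' - Q3 w) \<le> ?e n"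
      using diff close w by blast+
    have 12: "padic_abs ((w' - w) $ 1 $ 2) \<le> ?e (l + n)"
      using d(1) unfolding vector_minus_component Q right_diff_distrib[symmetric] abs_scale .
    have 21: "padic_abs ((w' - w) $ 2 $ 1) \<le> ?e (l + n)"
    proof -
      have "- ((w' - w) $ 2 $ 1) = ?\<pi> * (Q3 w' - Q3 w)"
        unfolding vector_minus_component right_diff_distrib Q(3)[symmetric] by simp
      then have "padic_abs ((w' - w) $ 2 $ 1) = padic_abs (?\<pi> * (Q3 w' - Q3 w))" by (metis padic_abs_minus)
      then show ?thesis using d(3) by (simp only: abs_scale)
    qed
    have 11: "padic_abs ((w' - w) $ 1 $ 1) \<le> ?e (l + n)"
    proof -
      have "- 2 * ((w' - w) $ 1 $ 1) = ?\<pi> * (Q2 w' - Q2 w)"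
        unfolding vector_minus_component right_diff_distrib Q(2)[symmetric] ..
      moreover have "padic_abs (- 2 * z) = padic_abs z" for z :: "'p padic"
        by (simp add: padic_abs_mult padic_abs_minus padic_abs_2[OF p])
      ultimately have "padic_abs ((w' - w) $ 1 $ 1) = padic_abs (?\<pi> * (Q2 w' - Q2 w))" by metis
      then show ?thesis using d(2) by (simp only: abs_scale)
    qed
    have "(w' - w) $ 2 $ 2 = - ((w' - w) $ 1 $ 1)"
    proof -
      have "w $ 2 $ 2 = - (w $ 1 $ 1)" "w' $ 2 $ 2 = - (w' $ 1 $ 1)"
        using sl by (simp_all add: sl2_def trace_2 add_eq_0_iff)
      then show ?thesis by simp
    qed
    then have 22: "padic_abs ((w' - w) $ 2 $ 2) \<le> ?e (l + n)" using 11 padic_abs_minus by metis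
    show "w' \<in> sl2_ball w (?e (l + n))"
      using sl 11 12 21 22 by (simp add: sl2_ball_def max_norm_le_iff forall_2)
  qed
qed

text \<open>\<open>C\<close> is quantified before the remaining data, so it depends only on its
  three arguments. For \<open>\<alpha> < \<epsilon>\<close> the exponent is negative: as
  \<open>b\<close> grows, the right side tends to 0 while the left side becomes 1, hence the
  restriction to \<open>b \<le> b1\<close> in that case.\<close>

theorem theorem1p3:
  fixes p :: nat and \<mu> :: "'p::prime_card padic_int measure"
  assumes "CARD('p) = p" and "p > 3"
    and "haar_prob \<mu>"
  shows "\<exists>C :: real \<Rightarrow> real \<Rightarrow> real \<Rightarrow> real.
    \<forall>(\<alpha>::real) (l0::nat) (l1::nat) (b0::real) (b1::real) (F :: ('p padic ^ 2 ^ 2) set)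
      (D'::real) (\<epsilon>::real) (c :: 'p padic_int) (\<rho>::real) J.
      0 < \<alpha> \<and> \<alpha> < 1 \<longrightarrow>
      0 < l0 \<and> 0 < l1 \<and> b0 = 1 / real p ^ l0 \<and> b1 = 1 / real p ^ l1 \<and>
        0 < b0 \<and> b0 < b1 \<and> b1 < 1 \<longrightarrow>
      finite F \<and> F \<noteq> {} \<and> F \<subseteq> sl2_ball 0 b1 \<longrightarrow>
      1 \<le> D' \<longrightarrow>
      (\<forall>w\<in>sl2. \<forall>b\<ge>b0. real (card (F \<inter> sl2_ball w b)) / real (card F) \<le> D' * (b / b1) powr \<alpha>) \<longrightarrow>
      0 < \<epsilon> \<and> \<epsilon> < 0.01 \<longrightarrow>
      0 < \<rho> \<and> J = cball c \<rho> \<longrightarrow>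
      (\<exists>J'\<subseteq>J. J' \<in> sets \<mu> \<and> measure \<mu> J' \<ge> (1 - 1 / real p) * measure \<mu> J \<and>
        (\<forall>r\<in>J'. \<exists>F\<^sub>r\<subseteq>F. real (card F\<^sub>r) \<ge> (1 - 1 / real p) * real (card F) \<and>
          (\<forall>w\<in>F\<^sub>r. \<forall>b\<ge>b0. \<epsilon> \<le> \<alpha> \<or> b \<le> b1 \<longrightarrow>
            real (card {w'\<in>F. padic_abs (xi r w' - xi r w) \<le> b}) / real (card F)
              \<le> C \<epsilon> (measure \<mu> J) D' * (b / b1) powr (\<alpha> - \<epsilon>))))"
proof -
  let ?p = "int CARD('p)" and ?P = "real p"
  have P: "?P > 3" using assms(2) by simp
  have pP: "real_of_int ?p = ?P" using assms(1) by simp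
  have p2: "?p > 2" "prime ?p" "CARD('p) > 2" using assms(1,2) prime_card_int[where 'p = 'p] by auto
  interpret prob_space \<mu> using assms(3) by (simp add: haar_prob_def)
  have sets: "sets \<mu> = sets borel" using assms(3) by (simp add: haar_prob_def)
  define good where "good \<epsilon> \<delta> D' C \<longleftrightarrow> C \<ge> 1 \<and> (\<forall>\<alpha> L (F :: ('p padic ^ 2 ^ 2) set) u. \<epsilon> \<le> \<alpha> \<longrightarrow> \<alpha> < 1 \<longrightarrow> finite F \<longrightarrow> F \<noteq> {} \<longrightarrow>
    (\<forall>n\<le>L. \<forall>v. real (card {w\<in>F. dvd3 (?p ^ n) (u w - v)}) \<le> D' * ?P powr - (real n * \<alpha>) * real (card F)) \<longrightarrow>
    real (card {r\<in>{0..<?p ^ L}. real (card F) / ?P < real (card {w\<in>F. \<exists>n\<in>{1..L}.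
        C * ?P powr - (real n * (\<alpha> - \<epsilon>)) * real (card F) < real (slab_count (?p ^ n) F u r (lin r (u w)))})})
      \<le> \<delta> * ?P ^ L)" for \<epsilon> \<delta> D' C :: real
  have good_ex: "\<exists>C. good \<epsilon> \<delta> D' C" if "0 < \<epsilon>" "0 < \<delta>" "1 \<le> D'" for \<epsilon> \<delta> D'
    using discrete_restricted_projection[OF p2(2,1) that(1,2), of D', where 'b = "'p padic ^ 2 ^ 2"] that(3)
    unfolding good_def pP by auto
  \<comment> \<open>\<open>M\<close> stands for \<open>measure \<mu> J\<close>, and
    \<open>M / p\<close> is the measure that the exceptional directions may take; only here does
    \<open>J\<close> influence the constant.\<close>
  define K where "K \<epsilon> M D' = (SOME C. good \<epsilon> (M / ?P) D' C)" for \<epsilon> M D'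
  \<comment> \<open>The factor \<open>p\<close> pays for rounding a radius up to \<open>b1\<close>
    times a power of \<open>1 / p\<close>; the lower bound 1 covers the cases where the count is
    estimated by \<open>card F\<close>.\<close>
  define C where "C \<epsilon> M D' = max 1 (?P * K \<epsilon> M D')" for \<epsilon> M D'
  have C1: "C \<epsilon> M D' \<ge> 1" for \<epsilon> M D' by (simp add: C_def)
  show ?thesis
  proof (intro exI[of _ C] allI impI, elim conjE)
    fix \<alpha> :: real and l0 l1 :: nat and b0 b1 :: real and F :: "('p padic ^ 2 ^ 2) set"
      and D' \<epsilon> :: real and c :: "'p padic_int" and \<rho> :: real and J
    assume alpha: "0 < \<alpha>" "\<alpha> < 1" and b0: "b0 = 1 / real p ^ l0" and b1: "b1 = 1 / real p ^ l1"
      and b: "0 < b0" "b0 < b1" and F: "finite F" "F \<noteq> {}" "F \<subseteq> sl2_ball 0 b1" and D: "1 \<le> D'"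
      and frostman: "\<forall>w\<in>sl2. \<forall>b\<ge>b0. real (card (F \<inter> sl2_ball w b)) / real (card F) \<le> D' * (b / b1) powr \<alpha>"
      and eps: "0 < \<epsilon>" and J: "J = cball c \<rho>"
    let ?M = "measure \<mu> J"
    have F0: "real (card F) > 0" using F by (simp add: card_gt_0_iff)
    have J_sets: "J \<in> sets \<mu>" unfolding J sets by simp
    have le1: "real (card {w'\<in>F. Q w'}) / real (card F) \<le> 1" for Q
      using F F0 by (simp add: card_mono)
    have shrink: "(1 - 1 / ?P) * x \<le> x" if "x \<ge> 0" for x
      using that P mult_right_mono[of "1 - 1 / ?P" 1 x] by simp
    show "\<exists>J'\<subseteq>J. J' \<in> sets \<mu> \<and> measure \<mu> J' \<ge> (1 - 1 / real p) * measure \<mu> J \<and>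
        (\<forall>r\<in>J'. \<exists>F\<^sub>r\<subseteq>F. real (card F\<^sub>r) \<ge> (1 - 1 / real p) * real (card F) \<and>
          (\<forall>w\<in>F\<^sub>r. \<forall>b\<ge>b0. \<epsilon> \<le> \<alpha> \<or> b \<le> b1 \<longrightarrow>
            real (card {w'\<in>F. padic_abs (xi r w' - xi r w) \<le> b}) / real (card F)
              \<le> C \<epsilon> (measure \<mu> J) D' * (b / b1) powr (\<alpha> - \<epsilon>)))"
    \<comment> \<open>\<open>good_ex\<close> requires a positive share of directions; for a null set
      \<open>J\<close> the empty set will do.\<close>
    proof (cases "?M = 0")
      case True
      then show ?thesis by (intro exI[of _ "{}"]) simp
    next
      case False
      then have M0: "?M > 0" by (simp add: less_le)
      show ?thesis
      proof (cases "\<epsilon> \<le> \<alpha>")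
        \<comment> \<open>With a negative exponent and \<open>b \<le> b1\<close> the power is at
          least 1, so the claim is trivial and no direction is removed.\<close>
        case False
        have "real (card {w'\<in>F. padic_abs (xi r w' - xi r w) \<le> b'}) / real (card F)
            \<le> C \<epsilon> ?M D' * (b' / b1) powr (\<alpha> - \<epsilon>)" if "b0 \<le> b'" "b' \<le> b1" for r w b'
        proof -
          have "1 \<le> (b' / b1) powr (\<alpha> - \<epsilon>)"
            using powr_mono'[of "\<alpha> - \<epsilon>" 0 "b' / b1"] that b False by simp
          then have "1 \<le> C \<epsilon> ?M D' * (b' / b1) powr (\<alpha> - \<epsilon>)"
            using mult_mono[of 1 "C \<epsilon> ?M D'" 1 "(b' / b1) powr (\<alpha> - \<epsilon>)"] C1[of \<epsilon> ?M D']
              by linarith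
          then show ?thesis by (rule order_trans[OF le1])
        qed
        then show ?thesis
          using J_sets shrink[of ?M] shrink[of "real (card F)"] False
          by (intro exI[of _ J] conjI ballI exI[of _ F]) auto
      next
        case True
        define L where "L = l0 - l1"
        have "l1 \<le> l0"
        proof (rule ccontr)
          assume "\<not> l1 \<le> l0"
          then have "?P ^ l0 \<le> ?P ^ l1" using P by (intro power_increasing) auto
          then have "b1 \<le> b0" unfolding b0 b1 using P by (intro divide_left_mono) auto
          then show False using b by simp
        qed
        then have L: "l0 = l1 + L" by (simp add: L_def)
        have e: "(1 / real CARD('p)) ^ k = 1 / ?P ^ k" for k using assms(1) by (simp add: power_one_over)
        have e_add: "1 / ?P ^ (l1 + n) = b1 * (1 / ?P ^ n)" for n unfolding b1 by (simp add: power_add)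
        have e_le: "b0 \<le> b1 * (1 / ?P ^ n)" if "n \<le> L" for n
          unfolding e_add[symmetric] b0 L using that P by (intro divide_left_mono power_increasing) auto
        have e_powr: "(b1 * (1 / ?P ^ n) / b1) powr x = ?P powr - (real n * x)" for n x
          using b P by (simp add: powr_minus powr_realpow[symmetric] powr_powr powr_divide inverse_eq_divide)
        have Fl: "F \<subseteq> sl2_ball 0 ((1 / real CARD('p)) ^ l1)" using F(3) unfolding e b1 .
        obtain u where u1: "\<And>w w' n r. w \<in> F \<Longrightarrow> w' \<in> F \<Longrightarrow> n \<le> L \<Longrightarrow>
            padic_abs (xi r w' - xi r w) \<le> b1 * (1 / ?P ^ n) \<longleftrightarrow> ?p ^ n dvd lin (res r L) (u w') - lin (res r L) (u w)"
          and u2: "\<And>w w' n. w \<in> F \<Longrightarrow> w' \<in> F \<Longrightarrow> n \<le> L \<Longrightarrow> dvd3 (?p ^ n) (u w' - u w)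
            \<Longrightarrow> w' \<in> sl2_ball w (b1 * (1 / ?P ^ n))"
          using discretize[OF p2(3) Fl, of L] unfolding e e_add by metis
        have "good \<epsilon> (?M / ?P) D' (K \<epsilon> ?M D')"
          unfolding K_def by (rule someI_ex, rule good_ex) (use eps M0 D P in auto)
        moreover have "real (card {w\<in>F. dvd3 (?p ^ n) (u w - v)}) \<le> D' * ?P powr - (real n * \<alpha>) * real (card F)"
          if n: "n \<le> L" for n v
        proof (cases "{w\<in>F. dvd3 (?p ^ n) (u w - v)} = {}")
          case True
          then show ?thesis using D by (simp only:) simp
        next
          case False
          \<comment> \<open>The arbitrary centre \<open>v\<close> of the cell is replaced by a point
            of \<open>F\<close> in it, where the hypothesis on balls applies; being ultrametric, the
            ball keeps its radius.\<close>
          then obtain w where w: "w \<in> F" "dvd3 (?p ^ n) (u w - v)" by blast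
          have "w' \<in> sl2_ball w (b1 * (1 / ?P ^ n))" if "w' \<in> F" "dvd3 (?p ^ n) (u w' - v)" for w'
          proof -
            have "dvd3 (?p ^ n) (u w' - u w)" using dvd3_diff[OF that(2) w(2)] by simp
            then show ?thesis using u2 w that n by blast
          qed
          then have "card {w\<in>F. dvd3 (?p ^ n) (u w - v)} \<le> card (F \<inter> sl2_ball w (b1 * (1 / ?P ^ n)))"
            using F by (intro card_mono) auto
          moreover have "w \<in> sl2" using w F(3) by (auto simp: sl2_ball_def)
          then have "real (card (F \<inter> sl2_ball w (b1 * (1 / ?P ^ n)))) / real (card F) \<le> D' * ?P powr - (real n * \<alpha>)"
            using frostman e_le[OF n] unfolding e_powr[symmetric] by blast
          ultimately show ?thesis using F0 by (simp add: divide_le_eq)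
        qed
        ultimately have K1: "K \<epsilon> ?M D' \<ge> 1" and main: "real (card {r\<in>{0..<?p ^ L}. real (card F) / ?P < real (card {w\<in>F. \<exists>n\<in>{1..L}.
            K \<epsilon> ?M D' * ?P powr - (real n * (\<alpha> - \<epsilon>)) * real (card F) < real (slab_count (?p ^ n) F u r (lin r (u w)))})})
            \<le> ?M / ?P * ?P ^ L"
          unfolding good_def using True alpha F by blast+
        define bad where "bad r w \<longleftrightarrow> (\<exists>n\<in>{1..L}. K \<epsilon> ?M D' * ?P powr - (real n * (\<alpha> - \<epsilon>)) * real (card F)
          < real (slab_count (?p ^ n) F u r (lin r (u w))))" for r w
        define B where "B = {r\<in>{0..<?p ^ L}. real (card F) / ?P < real (card {w\<in>F. bad r w})}"
        have "B \<subseteq> {0..<?p ^ L}" by (auto simp: B_def)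
        define BB where "BB = {r :: 'p padic_int. res r L \<in> B}"
        have BB_measure: "measure \<mu> BB \<le> ?M / ?P"
        proof -
          have "measure \<mu> BB = real (card B) / ?P ^ L"
            unfolding BB_def using haar_residue_class[OF assms(3) \<open>B \<subseteq> _\<close>] assms(1) by simp
          also have "\<dots> \<le> ?M / ?P"
            using main P unfolding B_def bad_def by (simp add: pos_divide_le_eq)
          finally show ?thesis .
        qed
        have BB_sets: "BB \<in> sets \<mu>"
        proof -
          have "BB = (\<Union>k\<in>B. residue_class L k)" by (auto simp: BB_def residue_class_def)
          then show ?thesis unfolding sets by (auto intro!: borel_open open_UN open_residue_class)
        qed
        have "measure \<mu> (J - BB) \<ge> (1 - 1 / ?P) * ?M"
        proof -
          have "?M \<le> measure \<mu> ((J - BB) \<union> BB)" using J_sets BB_sets by (intro finite_measure_mono) auto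
          also have "\<dots> \<le> measure \<mu> (J - BB) + measure \<mu> BB" using J_sets BB_sets by (intro measure_Un_le) auto
          finally show ?thesis using BB_measure by (simp add: left_diff_distrib)
        qed
        moreover have "\<exists>F\<^sub>r\<subseteq>F. real (card F\<^sub>r) \<ge> (1 - 1 / real p) * real (card F) \<and>
          (\<forall>w\<in>F\<^sub>r. \<forall>b\<ge>b0. \<epsilon> \<le> \<alpha> \<or> b \<le> b1 \<longrightarrow>
            real (card {w'\<in>F. padic_abs (xi r w' - xi r w) \<le> b}) / real (card F)
              \<le> C \<epsilon> (measure \<mu> J) D' * (b / b1) powr (\<alpha> - \<epsilon>))" if r: "r \<in> J - BB" for r
        proof (intro exI[of _ "{w\<in>F. \<not> bad (res r L) w}"] conjI ballI allI impI)
          let ?R = "res r L"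
          have "?R \<in> {0..<?p ^ L}" using res_bounds[of r L] by simp
          then have "real (card {w\<in>F. bad ?R w}) \<le> real (card F) / ?P"
            using r by (auto simp: BB_def B_def not_less)
          moreover have "card F = card {w\<in>F. bad ?R w} + card {w\<in>F. \<not> bad ?R w}"
            using F by (subst card_Un_disjoint[symmetric]) (auto intro: arg_cong[where f = card])
          ultimately show "(1 - 1 / ?P) * real (card F) \<le> real (card {w\<in>F. \<not> bad ?R w})"
            by (simp add: left_diff_distrib)
          fix w b' assume w: "w \<in> {w\<in>F. \<not> bad ?R w}" and b': "b0 \<le> b'"
          let ?S = "{w'\<in>F. padic_abs (xi r w' - xi r w) \<le> b'}"
          have pos: "\<alpha> - \<epsilon> \<ge> 0" using True by simp
          show "real (card ?S) / real (card F) \<le> C \<epsilon> ?M D' * (b' / b1) powr (\<alpha> - \<epsilon>)"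
          proof (cases "b1 \<le> b'")
            case True
            then have "1 \<le> (b' / b1) powr (\<alpha> - \<epsilon>)" using pos b by (intro ge_one_powr_ge_zero) auto
            then have "1 \<le> C \<epsilon> ?M D' * (b' / b1) powr (\<alpha> - \<epsilon>)"
              using mult_mono[of 1 "C \<epsilon> ?M D'" 1 "(b' / b1) powr (\<alpha> - \<epsilon>)"] C1[of \<epsilon> ?M D']
              by linarith
            then show ?thesis by (rule order_trans[OF le1])
          next
            case False
            \<comment> \<open>The radius is rounded up to \<open>b1 / p ^ n\<close>. For
              \<open>n = L\<close> it is the lower bound \<open>b0\<close> on \<open>b'\<close> that
              keeps the rounding within one factor \<open>p\<close>.\<close>
            define n where "n = (GREATEST n. n \<le> L \<and> b' \<le> b1 * (1 / ?P ^ n))"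
            have n: "n \<le> L \<and> b' \<le> b1 * (1 / ?P ^ n)"
              unfolding n_def by (rule GreatestI_nat[where k = 0 and b = L]) (use False in auto)
            have n_max: "b1 * (1 / ?P ^ Suc n) \<le> b'"
            proof (cases "n = L")
              case True
              have "b1 * (1 / ?P ^ Suc n) \<le> 1 / ?P ^ (l1 + L)"
                unfolding e_add[symmetric] True using P by (intro divide_left_mono power_increasing) auto
              then show ?thesis using b' unfolding b0 L by simp
            next
              case False
              show ?thesis
              proof (rule ccontr)
                assume "\<not> ?thesis"
                then have "Suc n \<le> n"
                  unfolding n_def using False n by (intro Greatest_le_nat[where b = L]) (auto simp: n_def)
                then show False by simp
              qed
            qed
            have "card ?S \<le> card {w'\<in>F. ?p ^ n dvd lin ?R (u w') - lin ?R (u w)}"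
            proof (rule card_mono)
              show "?S \<subseteq> {w'\<in>F. ?p ^ n dvd lin ?R (u w') - lin ?R (u w)}"
              proof
                fix w' assume "w' \<in> ?S"
                then have "w' \<in> F" "padic_abs (xi r w' - xi r w) \<le> b1 * (1 / ?P ^ n)" using n by auto
                then show "w' \<in> {w'\<in>F. ?p ^ n dvd lin ?R (u w') - lin ?R (u w)}"
                  using u1[of w w' n r] w n by blast
              qed
            qed (use F in simp)
            also have "\<dots> = slab_count (?p ^ n) F u ?R (lin ?R (u w))" by (simp only: slab_count_def)
            also have "real \<dots> \<le> K \<epsilon> ?M D' * ?P powr - (real n * (\<alpha> - \<epsilon>)) * real (card F)"
            \<comment> \<open>\<open>bad\<close> looks only at scales from 1 on; at scale 0 the
              bound is trivial because \<open>K\<close> is at least 1.\<close>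
            proof (cases "n = 0")
              case True
              have "real (slab_count (?p ^ n) F u ?R (lin ?R (u w))) \<le> 1 * real (card F)"
                unfolding slab_count_def using F by (simp add: card_mono)
              also have "\<dots> \<le> K \<epsilon> ?M D' * ?P powr - (real n * (\<alpha> - \<epsilon>)) * real (card F)"
                using K1 True P by (intro mult_right_mono) auto
              finally show ?thesis .
            next
              case False
              then show ?thesis using w n by (auto simp: bad_def not_less)
            qed
            finally have "real (card ?S) / real (card F) \<le> K \<epsilon> ?M D' * ?P powr - (real n * (\<alpha> - \<epsilon>))"
              using F0 by (simp add: divide_le_eq)
            also have "\<dots> \<le> K \<epsilon> ?M D' * (?P * (b' / b1) powr (\<alpha> - \<epsilon>))"
            proof (rule mult_left_mono)
              have "?P powr - (real n * (\<alpha> - \<epsilon>)) = ?P powr (\<alpha> - \<epsilon>) * ?P powr - (real (Suc n) * (\<alpha> - \<epsilon>))"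
                by (simp add: powr_add[symmetric] algebra_simps)
              also have "?P powr - (real (Suc n) * (\<alpha> - \<epsilon>)) = (b1 * (1 / ?P ^ Suc n) / b1) powr (\<alpha> - \<epsilon>)"
                by (rule e_powr[symmetric])
              also have "\<dots> \<le> (b' / b1) powr (\<alpha> - \<epsilon>)"
                using n_max b P pos by (intro powr_mono2 divide_right_mono) auto
              also have "?P powr (\<alpha> - \<epsilon>) \<le> ?P powr 1" using P alpha eps by (intro powr_mono) auto
              finally show "?P powr - (real n * (\<alpha> - \<epsilon>)) \<le> ?P * (b' / b1) powr (\<alpha> - \<epsilon>)"
                using P by (simp add: mult_left_mono mult_right_mono)
            qed (use K1 in simp)
            also have "\<dots> = (?P * K \<epsilon> ?M D') * (b' / b1) powr (\<alpha> - \<epsilon>)" by simp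
            also have "\<dots> \<le> C \<epsilon> ?M D' * (b' / b1) powr (\<alpha> - \<epsilon>)"
              unfolding C_def by (intro mult_right_mono) auto
            finally show ?thesis .
          qed
        qed auto
        ultimately show ?thesis using J_sets BB_sets by (intro exI[of _ "J - BB"]) auto
      qed
    qed
  qed
qed

end
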